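(* Let $p\ge3$ be an integer and $k$ a positive integer. Every rational period function (RPF) of weight $2k$ on the Hecke group $G_p$ is of the form $$q(z)=\sum_{\ell=1}^{L}C_\ell\sum_{\alpha\in Z_{\mathcal{A}_\ell}}\bigl(q_{k,\alpha}(z)-q_{k,T\alpha}(z)\bigr)+c_0\,q_{k,0}(z)+\sum_{n=1}^{2k-1}\frac{c_n}{z^n},$$ where each $\mathcal{A}_\ell$ is a hyperbolic $G_p$-equivalence class of $\lambda_p$-BQFs, $Z_{\mathcal{A}_\ell}$ is the associated cycle of positive poles, the functions $q_{k,\alpha}$ (for $\alpha$ a hyperbolic fixed point of $G_p$) are $$q_{k,\alpha}(z)=PP_\alpha\!\left[\frac{D^{k/2}}{Q_\alpha(z,1)^k}\right]=PP_\alpha\!\left[\frac{(\alpha-\alpha')^k}{(z-\alpha)^k(z-\alpha')^k}\right]$$ with $D$ the discriminant of $Q_\alpha$, $q_{k,0}$ is a function of the form $$q_{k,0}(z)=\begin{cases} a_0(1-z^{-2k}), & 2k\ne 2,\\ a_0(1-z^{-2})+b_1z^{-1}, & 2k=2,\end{cases}$$ with constants $a_0,b_1$, and the $C_\ell$ and $c_n$ are all constants.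
   Context: Hecke groups. For an integer $p\ge 3$ put $\lambda=\lambda_p=2\cos(\pi/p)$, $S=\begin{pmatrix}1&\lambda\\0&1\end{pmatrix}$, $T=\begin{pmatrix}0&-1\\1&0\end{pmatrix}$, $U=ST$, and $G_p=\langle S,T\rangle/\{\pm I\}$, acting on the Riemann sphere by linear fractional transformations. In $G_p$ one has $T^2=U^p=I$. An element $\begin{pmatrix}a&b\\c&d\end{pmatrix}\in G_p$ is hyperbolic if $|a+d|>2$; a hyperbolic fixed point of $G_p$ is a fixed point of a hyperbolic element of $G_p$. Rational period functions. For $M=\begin{pmatrix}*&*\\c&d\end{pmatrix}\in \mathrm{SL}(2,\mathbb{R})$, $(f\mid M)(z)=(cz+d)^{-2k}f(Mz)$. For $k\in\mathbb{Z}^+$, a rational period function (RPF) of weight $2k$ on $G_p$ is a rational function $q$ with $q+q\mid T=0$ and $q+q\mid U+q\mid U^2+\dots+q\mid U^{p-1}=0$. $PP_\alpha[f]$ denotes the principal part (polar part of the Laurent expansion) of $f$ at $z=\alpha$. Binary quadratic forms. A $\lambda_p$-BQF is a form $Q=[A,B,C]$, $Q(x,y)=Ax^2+Bxy+Cy^2$, with $A,B,C\in\mathbb{Z}[\lambda_p]$ and discriminant $D=B^2-4AC>0$; if $\mathbb{Z}[\lambda_p]$ is a PID it is also required to be primitive, i.e. $A,B,C$ generate the unit ideal. To a hyperbolic fixed point $\alpha$ of $G_p$ a form $Q_\alpha$ is attached as follows. Let $M_\alpha=\begin{pmatrix}a&b\\c&d\end{pmatrix}$ be a generator of the (cyclic)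 stabilizer of $\alpha$ in $G_p$. If $\mathbb{Z}[\lambda_p]$ is a PID, let $g>0$ be the positive generator of the ideal generated by $c,d-a,-b$ (for each nonzero ideal one positive generator is fixed once and for all); otherwise let $g=1$. Then $Q_\alpha=\frac1g[c,d-a,-b]$ if $\alpha=\frac{a-d+\sqrt{(a+d)^2-4}}{2c}$, and $Q_\alpha=-\frac1g[c,d-a,-b]$ if $\alpha=\frac{a-d-\sqrt{(a+d)^2-4}}{2c}$. Thus $\alpha=\frac{-B+\sqrt D}{2A}$ when $Q_\alpha=[A,B,C]$. The forms $Q_\alpha$ are called hyperbolic. The Hecke conjugate of $\alpha$ is $\alpha'=\frac{-B-\sqrt D}{2A}$. Equivalence. $M=\begin{pmatrix}a&b\\c&d\end{pmatrix}\in G_p$ acts by $(Q\circ M)(x,y)=Q(ax+by,cx+dy)$; forms $Q_1,Q_2$ are $G_p$-equivalent if $Q_2=Q_1\circ V$ for some $V\in G_p$. A $G_p$-equivalence class consists either entirely of hyperbolic forms (a hyperbolic class) or contains none. A hyperbolic form $[A,B,C]$ is simple if $A>0>C$. For a hyperbolic class $\mathcal{A}$, $Z_{\mathcal{A}}=\{x: Q_x\in\mathcal{A},\ Q_x\text{ simple}\}$, a finite nonempty set of positive numbers. *)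

theory Defs
  imports
    "HOL-Complex_Analysis.Complex_Analysis"
    "HOL-Computational_Algebra.Computational_Algebra"
    "HOL-Algebra.Generated_Groups"
    "HOL-Algebra.Generated_Rings"
    "HOL-Algebra.Ring_Divisibility"
    "HOL-Algebra.Algebraic_Closure_Type"
begin

section \<open>Hecke groups\<close>

definition SL2R :: "(real^2^2) monoid" where
  "SL2R = \<lparr>carrier = {M. det M = 1}, mult = (**), one = mat 1\<rparr>"

lemma group_SL2R: "group SL2R"
proof (rule groupI)
  fix M assume "M \<in> carrier SL2R"
  then have d: "det M = 1"
    by (simp add: SL2R_def)
  then obtain N where N: "N ** M = mat 1"
    by (metis invertible_def invertible_det_nz zero_neq_one)
  then have "det N = 1"
    using d by (metis det_I det_mul mult.right_neutral)
  with N show "\<exists>N\<in>carrier SL2R. N \<otimes>\<^bsub>SL2R\<^esub> M = \<one>\<^bsub>SL2R\<^esub>"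
    by (auto simp: SL2R_def)
qed (auto simp: SL2R_def det_mul matrix_mul_assoc)

definition hecke_lambda :: "nat \<Rightarrow> real" where
  "hecke_lambda p = 2 * cos (pi / real p)"

definition hecke_S :: "nat \<Rightarrow> real^2^2" where
  "hecke_S p = vector [vector [1, hecke_lambda p], vector [0, 1]]"

definition hecke_T :: "real^2^2" where
  "hecke_T = vector [vector [0, -1], vector [1, 0]]"

definition hecke_U :: "nat \<Rightarrow> real^2^2" where
  "hecke_U p = hecke_S p ** hecke_T"

text \<open>
  The preimage in \<open>SL(2,\<real>)\<close> of the Hecke group \<open>G\<^sub>p = \<langle>S,T\<rangle>/{\<plusminus>I}\<close>; it contains \<open>-I = T\<^sup>2\<close>. An element
  of \<open>G\<^sub>p\<close> is thus represented by two matrices \<open>\<plusminus>M\<close>, and all notions below are invariant under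
  \<open>M \<mapsto> -M\<close>.
\<close>
definition hecke_group :: "nat \<Rightarrow> (real^2^2) set" where
  "hecke_group p = generate SL2R {hecke_S p, hecke_T}"

lemma hecke_T_squared: "hecke_T ** hecke_T = - mat 1"
  by (simp add: hecke_T_def vec_eq_iff forall_2 matrix_matrix_mult_def sum_2 mat_def)

lemma uminus_one_in_hecke_group: "- mat 1 \<in> hecke_group p"
proof -
  have "hecke_T \<otimes>\<^bsub>SL2R\<^esub> hecke_T \<in> hecke_group p"
    unfolding hecke_group_def by (intro generate.eng generate.incl) auto
  then show ?thesis
    by (simp add: SL2R_def hecke_T_squared)
qed

definition moebius_map :: "real^2^2 \<Rightarrow> 'a::real_field \<Rightarrow> 'a" where
  "moebius_map M z = (of_real (M$1$1) * z + of_real (M$1$2)) / (of_real (M$2$1) * z + of_real (M$2$2))"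

text \<open>
  The condition on the denominator says \<open>Mx \<noteq> \<infinity>\<close>. Only finite real points are needed: fixed points
  of hyperbolic elements are real or \<open>\<infinity>\<close>, and \<open>\<infinity>\<close> is not one of them, being fixed by the parabolic
  element \<open>S\<close> of the discrete group \<open>G\<^sub>p\<close>.
\<close>
definition fixes_point :: "real^2^2 \<Rightarrow> real \<Rightarrow> bool" where
  "fixes_point M x \<longleftrightarrow> M$2$1 * x + M$2$2 \<noteq> 0 \<and> moebius_map M x = x"

definition hyperbolic_matrix :: "real^2^2 \<Rightarrow> bool" where
  "hyperbolic_matrix M \<longleftrightarrow> \<bar>trace M\<bar> > 2"

definition hyperbolic_fixed_points :: "nat \<Rightarrow> real set" where
  "hyperbolic_fixed_points p =
     {x. \<exists>M\<in>hecke_group p. hyperbolic_matrix M \<and> fixes_point M x}"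

definition hecke_stabilizer :: "nat \<Rightarrow> real \<Rightarrow> (real^2^2) set" where
  "hecke_stabilizer p x = {M \<in> hecke_group p. fixes_point M x}"

text \<open>
  \<open>M\<close> generates the stabilizer of \<open>x\<close> in \<open>G\<^sub>p\<close> iff \<open>M\<close> and \<open>-I\<close> generate its preimage in \<open>SL(2,\<real>)\<close>.
\<close>
definition stabilizer_generator :: "nat \<Rightarrow> real \<Rightarrow> real^2^2 \<Rightarrow> bool" where
  "stabilizer_generator p x M \<longleftrightarrow>
     M \<in> hecke_stabilizer p x \<and> generate SL2R {M, - mat 1} = hecke_stabilizer p x"


section \<open>Rational period functions\<close>

text \<open>
  A rational function is represented by any function agreeing with it off a finite set, so that
  equality of rational functions is equality at all but finitely many points.
\<close>
definition rational_function :: "(complex \<Rightarrow> complex) \<Rightarrow> bool" where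
  "rational_function f \<longleftrightarrow>
     (\<exists>P Q. Q \<noteq> 0 \<and> (\<forall>z. poly Q z \<noteq> 0 \<longrightarrow> f z = poly P z / poly Q z))"

definition slash :: "nat \<Rightarrow> (complex \<Rightarrow> complex) \<Rightarrow> real^2^2 \<Rightarrow> complex \<Rightarrow> complex" where
  "slash k f M z =
     f (moebius_map M z) / (of_real (M$2$1) * z + of_real (M$2$2)) ^ (2 * k)"

definition rational_period_function :: "nat \<Rightarrow> nat \<Rightarrow> (complex \<Rightarrow> complex) \<Rightarrow> bool" where
  "rational_period_function p k q \<longleftrightarrow>
     rational_function q \<and>
     (\<forall>\<^sub>F z in cofinite. q z + slash k q hecke_T z = 0) \<and>
     (\<forall>\<^sub>F z in cofinite. q z + (\<Sum>j=1..p-1. slash k q (hecke_U p [^]\<^bsub>SL2R\<^esub> j) z) = 0)"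


section \<open>Binary quadratic forms\<close>

text \<open>The ring \<open>\<int>[\<lambda>\<^sub>p]\<close>.\<close>
definition hecke_ring :: "nat \<Rightarrow> real ring" where
  "hecke_ring p =
     ring_of_type_algebra\<lparr>carrier := generate_ring ring_of_type_algebra {hecke_lambda p}\<rparr>"

datatype bqf = BQF (coeff_A: real) (coeff_B: real) (coeff_C: real)

definition eval_bqf :: "bqf \<Rightarrow> 'a::real_field \<Rightarrow> 'a \<Rightarrow> 'a" where
  "eval_bqf Q x y =
     of_real (coeff_A Q) * x\<^sup>2 + of_real (coeff_B Q) * x * y + of_real (coeff_C Q) * y\<^sup>2"

definition discriminant :: "bqf \<Rightarrow> real" where
  "discriminant Q = (coeff_B Q)\<^sup>2 - 4 * coeff_A Q * coeff_C Q"

definition lambda_bqfs :: "nat \<Rightarrow> bqf set" where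
  "lambda_bqfs p =
     {Q. {coeff_A Q, coeff_B Q, coeff_C Q} \<subseteq> carrier (hecke_ring p) \<and>
         discriminant Q > 0 \<and>
         (principal_domain (hecke_ring p) \<longrightarrow>
            Idl\<^bsub>hecke_ring p\<^esub> {coeff_A Q, coeff_B Q, coeff_C Q} = carrier (hecke_ring p))}"

definition bqf_act :: "bqf \<Rightarrow> real^2^2 \<Rightarrow> bqf" where
  "bqf_act Q M =
     (let A = coeff_A Q; B = coeff_B Q; C = coeff_C Q;
          a = M$1$1; b = M$1$2; c = M$2$1; d = M$2$2
      in BQF (A * a\<^sup>2 + B * a * c + C * c\<^sup>2)
             (2 * A * a * b + B * (a * d + b * c) + 2 * C * c * d)
             (A * b\<^sup>2 + B * b * d + C * d\<^sup>2))"

lemma eval_bqf_act: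
  "eval_bqf (bqf_act Q M) x y =
     eval_bqf Q (of_real (M$1$1) * x + of_real (M$1$2) * y)
                (of_real (M$2$1) * x + of_real (M$2$2) * y)"
  by (simp add: eval_bqf_def bqf_act_def Let_def power2_eq_square algebra_simps)

definition bqf_equivalence :: "nat \<Rightarrow> (bqf \<times> bqf) set" where
  "bqf_equivalence p =
     {(Q\<^sub>1, Q\<^sub>2). Q\<^sub>1 \<in> lambda_bqfs p \<and> Q\<^sub>2 \<in> lambda_bqfs p \<and>
                (\<exists>V\<in>hecke_group p. Q\<^sub>2 = bqf_act Q\<^sub>1 V)}"

text \<open>
  The choice operator depends on the ideal only, so this fixes one positive generator per ideal.
\<close>
definition ideal_generator :: "nat \<Rightarrow> real set \<Rightarrow> real" where
  "ideal_generator p I =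
     (if principal_domain (hecke_ring p)
      then SOME g. g \<in> carrier (hecke_ring p) \<and> g > 0 \<and> I = PIdl\<^bsub>hecke_ring p\<^esub> g
      else 1)"

text \<open>
  The two generators \<open>M\<close>, \<open>M\<^sup>-\<^sup>1\<close> of the stabilizer in \<open>G\<^sub>p\<close>, with either sign of their matrices, yield
  the same form.
\<close>
definition hyperbolic_form :: "nat \<Rightarrow> real \<Rightarrow> bqf" where
  "hyperbolic_form p \<alpha> =
     (THE Q. \<exists>M. stabilizer_generator p \<alpha> M \<and>
        (let a = M$1$1; b = M$1$2; c = M$2$1; d = M$2$2;
             g = ideal_generator p (Idl\<^bsub>hecke_ring p\<^esub> {c, d - a, - b});
             s = sqrt ((a + d)\<^sup>2 - 4)
         in \<alpha> = (a - d + s) / (2 * c) \<and> Q = BQF (c / g) ((d - a) / g) (- b / g) \<or>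
            \<alpha> = (a - d - s) / (2 * c) \<and> Q = BQF (- (c / g)) (- ((d - a) / g)) (- (- b / g))))"

definition hyperbolic_forms :: "nat \<Rightarrow> bqf set" where
  "hyperbolic_forms p = hyperbolic_form p ` hyperbolic_fixed_points p"

definition hecke_conjugate :: "nat \<Rightarrow> real \<Rightarrow> real" where
  "hecke_conjugate p \<alpha> =
     (let Q = hyperbolic_form p \<alpha>
      in (- coeff_B Q - sqrt (discriminant Q)) / (2 * coeff_A Q))"

definition hyperbolic_class :: "nat \<Rightarrow> bqf set \<Rightarrow> bool" where
  "hyperbolic_class p \<A> \<longleftrightarrow>
     \<A> \<in> lambda_bqfs p // bqf_equivalence p \<and> \<A> \<subseteq> hyperbolic_forms p"

definition simple_bqf :: "bqf \<Rightarrow> bool" where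
  "simple_bqf Q \<longleftrightarrow> coeff_A Q > 0 \<and> 0 > coeff_C Q"

definition pole_cycle :: "nat \<Rightarrow> bqf set \<Rightarrow> real set" where
  "pole_cycle p \<A> =
     {x \<in> hyperbolic_fixed_points p. hyperbolic_form p x \<in> \<A> \<and> simple_bqf (hyperbolic_form p x)}"


section \<open>The building blocks of rational period functions\<close>

definition principal_part :: "complex \<Rightarrow> (complex \<Rightarrow> complex) \<Rightarrow> complex \<Rightarrow> complex" where
  "principal_part \<alpha> f z = poly (fls_prpart (laurent_expansion f \<alpha>)) (1 / (z - \<alpha>))"

definition q_hyp :: "nat \<Rightarrow> nat \<Rightarrow> real \<Rightarrow> complex \<Rightarrow> complex" where
  "q_hyp p k \<alpha> =
     (let Q = hyperbolic_form p \<alpha>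
      in principal_part (of_real \<alpha>)
           (\<lambda>z. of_real (discriminant Q powr (real k / 2)) / eval_bqf Q z 1 ^ k))"

definition q_zero :: "nat \<Rightarrow> complex \<Rightarrow> complex \<Rightarrow> complex \<Rightarrow> complex" where
  "q_zero k a\<^sub>0 b\<^sub>1 z =
     (if 2 * k \<noteq> 2 then a\<^sub>0 * (1 - 1 / z ^ (2 * k)) else a\<^sub>0 * (1 - 1 / z\<^sup>2) + b\<^sub>1 / z)"

end

(*
  Since U^j T = - V_(p-j) in the notation below, the two relations for q turn into q | T = - q and
  q = sum of q | V_i over 0 < i < p, where the matrices V_i have nonnegative entries and map the right half plane
  into disjoint half discs. So every pole of q in the right half plane is sent to exactly one other
  such pole by exactly one V_i. These poles therefore form cycles: each is fixed by a nonempty word W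
  in the V_i, hence is real, positive and hyperbolic with negative conjugate, and q - q | W is regular
  there. In the coordinate (z - x)/(z - x') the map W is multiplication by some mu with |mu| <> 1, so
  comparing expansions shows that up to a function regular at x, q is a multiple of
  ((x - x')/((z - x)(z - x')))^k, which is invariant under slashing.

  Any element of the group maps a sufficiently long word to plus or minus a word, or T times a word,
  changing a bounded initial part only. This yields that hyperbolic fixed points are not cusps and have
  cyclic stabilizers, and that each point of the cycle of x is W x for a word W whose last letter must be
  the one preserving the poles; so the whole cycle consists of poles, with the same coefficient.

  Subtracting all principal parts leaves a rational function whose only finite pole is 0. As the V_i with
  i < p - 1 send infinity to cusps, q(z) - q(z + lambda) tends to 0 at infinity, so q has a
  finite limit there, and q | T = - q gives the behaviour at 0.
*)
theory Submission
  imports Defs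
begin

text \<open>Length bookkeeping for words takes the place of discreteness of the group and of a
  fundamental domain. It gives the two facts on which the forms rest: upper triangular elements have
  equal diagonal entries 1 or -1, and a shortest period generates the stabilizer. Both are forced by
  the definition of \<open>hyperbolic_form\<close>: its \<open>THE\<close> has a value only because
  a generator exists and is unique up to sign and inverse.

  Why the order is exactly k: let F be the invariant function with poles at x and x', and put h =
  q/F. Invariance of F gives h - h o W = (q - q | W)/F, which vanishes to order k at x. If h starts
  with the exponent n < k, comparing leading coefficients gives mu^n = 1, so n = 0. Subtracting that
  constant C and arguing once more leaves h - C of order at least k, so q - C F is regular. Only
  leading terms are ever compared.

  Rational functions are known only off finite sets, so poles are expressed through limits in
  punctured neighbourhoods.\<close>

no_notation fps_nth (infixl \<open>$\<close> 75)

section \<open>Linear fractional transformations\<close>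

definition mat2 :: "real \<Rightarrow> real \<Rightarrow> real \<Rightarrow> real \<Rightarrow> real^2^2" where
  "mat2 a b c d = vector [vector [a, b], vector [c, d]]"

lemma mat2_nth [simp]:
  "mat2 a b c d $ 1 $ 1 = a" "mat2 a b c d $ 1 $ 2 = b"
  "mat2 a b c d $ 2 $ 1 = c" "mat2 a b c d $ 2 $ 2 = d"
  by (simp_all add: mat2_def)

lemma matrix_mult_nth2 [simp]:
  fixes A B :: "real^2^2"
  shows "(A ** B) $ i $ j = A$i$1 * B$1$j + A$i$2 * B$2$j"
  by (simp add: matrix_matrix_mult_def sum_2)

lemma mat_one_nth2 [simp]:
  "(mat 1 :: real^2^2) $ 1 $ 1 = 1" "(mat 1 :: real^2^2) $ 1 $ 2 = 0"
  "(mat 1 :: real^2^2) $ 2 $ 1 = 0" "(mat 1 :: real^2^2) $ 2 $ 2 = 1"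
  by (simp_all add: mat_def)

lemma mat2_eq_iff:
  "A = B \<longleftrightarrow> A$1$1 = B$1$1 \<and> A$1$2 = B$1$2 \<and> A$2$1 = B$2$1 \<and> A$2$2 = (B::real^2^2)$2$2"
  by (simp only: vec_eq_iff forall_2 conj_assoc)

lemma matrix_mul_minus [simp]:
  fixes A B :: "real^2^2"
  shows "(- A) ** B = - (A ** B)" "A ** (- B) = - (A ** B)"
  by (simp_all add: mat2_eq_iff)

lemma hecke_T_nth [simp]:
  "hecke_T $ 1 $ 1 = 0" "hecke_T $ 1 $ 2 = -1" "hecke_T $ 2 $ 1 = 1" "hecke_T $ 2 $ 2 = 0"
  by (simp_all add: hecke_T_def)

text \<open>The adjugate, which is the inverse in determinant 1. Being linear in the entries it
  satisfies identities such as \<open>adj2_adj2\<close> for all matrices.\<close>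

definition adj2 :: "real^2^2 \<Rightarrow> real^2^2" where
  "adj2 M = mat2 (M$2$2) (- (M$1$2)) (- (M$2$1)) (M$1$1)"

lemma adj2_nth [simp]:
  "adj2 M $ 1 $ 1 = M$2$2" "adj2 M $ 1 $ 2 = - (M$1$2)"
  "adj2 M $ 2 $ 1 = - (M$2$1)" "adj2 M $ 2 $ 2 = M$1$1"
  by (simp_all add: adj2_def)

lemma adj2_adj2 [simp]: "adj2 (adj2 M) = M"
  by (simp add: mat2_eq_iff)

lemma adj2_minus [simp]: "adj2 (- M) = - adj2 M"
  by (simp add: mat2_eq_iff)

lemma det_eq_1_iff: "det (M::real^2^2) = 1 \<longleftrightarrow> M$1$1 * M$2$2 = 1 + M$1$2 * M$2$1"
  by (auto simp: det_2)

lemma det_eq_1D: "det (M::real^2^2) = 1 \<Longrightarrow> M$1$1 * M$2$2 = 1 + M$1$2 * M$2$1"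
  by (simp add: det_eq_1_iff)

lemma det_minus2 [simp]: "det (- M :: real^2^2) = det M"
  by (simp add: det_2)

lemma det_adj2 [simp]: "det (adj2 M) = det M"
  by (simp add: det_2)

lemma adj2_inverse [simp]:
  assumes "det M = 1"
  shows "adj2 M ** M = mat 1" "M ** adj2 M = mat 1"
  using det_eq_1D[OF assms] by (simp_all add: mat2_eq_iff algebra_simps)

lemma det_mult1: "det A = 1 \<Longrightarrow> det B = 1 \<Longrightarrow> det (A ** B :: real^2^2) = 1"
  by (simp add: det_mul)

text \<open>Polymorphic in the field, because the same matrix acts on real fixed points and on the
  complex variable.\<close>

definition aut_factor :: "real^2^2 \<Rightarrow> 'a::real_field \<Rightarrow> 'a" where
  "aut_factor M z = of_real (M$2$1) * z + of_real (M$2$2)"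

lemma moebius_map_alt:
  "moebius_map M z = (of_real (M$1$1) * z + of_real (M$1$2)) / aut_factor M z"
  by (simp add: moebius_map_def aut_factor_def)

lemma aut_factor_mult:
  "aut_factor B z \<noteq> 0 \<Longrightarrow> aut_factor (A ** B) z = aut_factor A (moebius_map B z) * aut_factor B z"
  unfolding moebius_map_alt by (simp add: aut_factor_def[of A] aut_factor_def[of "A ** B"] field_simps)
    (simp add: aut_factor_def algebra_simps)

lemma moebius_map_mult:
  assumes "aut_factor B z \<noteq> 0"
  shows "moebius_map (A ** B) z = moebius_map A (moebius_map B z)"
proof -
  have "of_real (A$1$1) * moebius_map B z + of_real (A$1$2) =
      (of_real ((A ** B)$1$1) * z + of_real ((A ** B)$1$2)) / aut_factor B z"
    using assms unfolding moebius_map_alt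
    by (simp add: field_simps) (simp add: aut_factor_def algebra_simps)
  then show ?thesis
    unfolding moebius_map_alt[of "A ** B"] moebius_map_alt[of A] aut_factor_mult[OF assms]
    using assms by simp
qed

lemma aut_factor_minus [simp]: "aut_factor (- M) z = - aut_factor M z"
  by (simp add: aut_factor_def)

lemma aut_factor_one [simp]: "aut_factor (mat 1) z = 1"
  by (simp add: aut_factor_def)

lemma moebius_map_minus [simp]: "moebius_map (- M) z = moebius_map M z"
proof -
  have "of_real ((- M)$1$1) * z + of_real ((- M)$1$2) = - (of_real (M$1$1) * z + of_real (M$1$2))"
    by simp
  then show ?thesis
    unfolding moebius_map_alt aut_factor_minus by (simp only: minus_divide_divide)
qed

lemma moebius_map_one [simp]: "moebius_map (mat 1) z = z"
  by (simp add: moebius_map_def)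

lemma moebius_map_T: "moebius_map hecke_T z = - 1 / z"
  by (simp add: moebius_map_def)

lemma aut_factor_T [simp]: "aut_factor hecke_T z = z"
  by (simp add: aut_factor_def)

lemma aut_factor_of_real: "aut_factor M (of_real x) = of_real (aut_factor M x)"
  by (simp add: aut_factor_def)

lemma moebius_map_of_real: "moebius_map M (of_real x) = of_real (moebius_map M x)"
  by (simp add: moebius_map_def)

lemma aut_factor_of_real_eq_0 [simp]: "aut_factor M (of_real x) = 0 \<longleftrightarrow> aut_factor M x = 0"
  by (simp add: aut_factor_of_real)

text \<open>Source of injectivity, of the multiplier at a fixed point and of the slash invariance of
  \<open>pole_fun\<close>.\<close>

lemma moebius_map_diff:
  assumes "det M = 1" "aut_factor M z \<noteq> 0" "aut_factor M w \<noteq> 0"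
  shows "moebius_map M z - moebius_map M w = (z - w) / (aut_factor M z * aut_factor M w)"
proof -
  have d: "of_real (M$1$1) * of_real (M$2$2) = 1 + of_real (M$1$2) * (of_real (M$2$1) :: 'a)"
    using arg_cong[OF det_eq_1D[OF assms(1)], of "of_real :: _ \<Rightarrow> 'a"] by simp
  have "moebius_map M z - moebius_map M w = ((of_real (M$1$1) * z + of_real (M$1$2)) * aut_factor M w
      - (of_real (M$1$1) * w + of_real (M$1$2)) * aut_factor M z) / (aut_factor M z * aut_factor M w)"
    using assms(2,3) unfolding moebius_map_alt by (simp add: field_simps)
  also have "(of_real (M$1$1) * z + of_real (M$1$2)) * aut_factor M w
      - (of_real (M$1$1) * w + of_real (M$1$2)) * aut_factor M z =
      (of_real (M$1$1) * of_real (M$2$2) - of_real (M$1$2) * of_real (M$2$1)) * (z - w)"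
    by (simp add: aut_factor_def algebra_simps)
  finally show ?thesis by (simp add: d)
qed

lemma moebius_map_inj:
  assumes "det M = 1" "aut_factor M z \<noteq> 0" "aut_factor M w \<noteq> 0" "moebius_map M z = moebius_map M w"
  shows "z = w"
  using moebius_map_diff[OF assms(1-3)] assms by simp

lemma aut_factor_adj:
  assumes "det M = 1" "aut_factor M z \<noteq> 0"
  shows "aut_factor (adj2 M) (moebius_map M z) = 1 / aut_factor M z"
  using aut_factor_mult[OF assms(2), of "adj2 M"] assms by (simp add: field_simps)

lemma moebius_map_adj:
  assumes "det M = 1" "aut_factor M z \<noteq> 0"
  shows "moebius_map (adj2 M) (moebius_map M z) = z"
  using moebius_map_mult[OF assms(2), of "adj2 M"] assms by simp

lemma fixes_point_alt: "fixes_point M x \<longleftrightarrow> aut_factor M x \<noteq> 0 \<and> moebius_map M x = x"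
  by (simp add: fixes_point_def aut_factor_def)

text \<open>Equality in the quotient by the centre; group elements stay matrices and are compared up
  to sign.\<close>

definition eq_sign :: "real^2^2 \<Rightarrow> real^2^2 \<Rightarrow> bool" where
  "eq_sign A B \<longleftrightarrow> A = B \<or> A = - B"

lemma eq_sign_refl [simp]: "eq_sign A A"
  by (simp add: eq_sign_def)

lemma eq_sign_trans: "eq_sign A B \<Longrightarrow> eq_sign B C \<Longrightarrow> eq_sign A C"
  by (auto simp: eq_sign_def)

lemma eq_sign_mult: "eq_sign A B \<Longrightarrow> eq_sign C D \<Longrightarrow> eq_sign (A ** C) (B ** D)"
  by (auto simp: eq_sign_def)

lemma eq_sign_aut_factor: "eq_sign A B \<Longrightarrow> \<bar>aut_factor A (x::real)\<bar> = \<bar>aut_factor B x\<bar>"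
  by (auto simp: eq_sign_def)

lemma eq_sign_moebius: "eq_sign A B \<Longrightarrow> moebius_map A x = moebius_map B x"
  by (auto simp: eq_sign_def)

section \<open>The Hecke group\<close>

lemma SL2R_simps [simp]:
  "carrier SL2R = {M. det M = 1}" "A \<otimes>\<^bsub>SL2R\<^esub> B = A ** B" "\<one>\<^bsub>SL2R\<^esub> = mat 1"
  by (simp_all add: SL2R_def)

lemma inv_SL2R [simp]: "det M = 1 \<Longrightarrow> inv\<^bsub>SL2R\<^esub> M = adj2 M"
  by (rule group.inv_equality[OF group_SL2R]) simp_all

lemma det_hecke_T [simp]: "det hecke_T = 1"
  by (simp add: det_2)

lemma det_hecke_S [simp]: "det (hecke_S p) = 1"
  by (simp add: det_2 hecke_S_def)

lemma hecke_group_det: "M \<in> hecke_group p \<Longrightarrow> det M = 1"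
  unfolding hecke_group_def
  using group.generate_incl[OF group_SL2R, of "{hecke_S p, hecke_T}"] by auto

lemma hecke_group_induct [consumes 1, case_names one T S inv mult]:
  assumes "M \<in> hecke_group p" "P (mat 1)" "P hecke_T" "P (hecke_S p)"
    "\<And>M. M \<in> {hecke_T, hecke_S p} \<Longrightarrow> P (adj2 M)"
    "\<And>M N. M \<in> hecke_group p \<Longrightarrow> N \<in> hecke_group p \<Longrightarrow> P M \<Longrightarrow> P N \<Longrightarrow> P (M ** N)"
  shows "P M"
  using assms(1) unfolding hecke_group_def
proof (induction M rule: generate.induct)
  case (eng h1 h2)
  then show ?case using assms(6)[of h1 h2] by (simp add: hecke_group_def)
qed (use assms in auto)

lemma hecke_group_one [simp]: "mat 1 \<in> hecke_group p"
  using generate.one[of SL2R] by (simp add: hecke_group_def)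

lemma hecke_group_mult [simp, intro]:
  "M \<in> hecke_group p \<Longrightarrow> N \<in> hecke_group p \<Longrightarrow> M ** N \<in> hecke_group p"
  using generate.eng[of M SL2R _ N] by (simp add: hecke_group_def)

lemma hecke_group_T [simp]: "hecke_T \<in> hecke_group p"
  using generate.incl[of hecke_T _ SL2R] by (simp add: hecke_group_def)

lemma hecke_group_S [simp]: "hecke_S p \<in> hecke_group p"
  using generate.incl[of "hecke_S p" _ SL2R] by (simp add: hecke_group_def)

lemma hecke_group_minus [simp, intro]: "M \<in> hecke_group p \<Longrightarrow> - M \<in> hecke_group p"
  using hecke_group_mult[OF uminus_one_in_hecke_group, of M] by simp

lemma hecke_group_adj [simp, intro]: "M \<in> hecke_group p \<Longrightarrow> adj2 M \<in> hecke_group p"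
  using group.generate_m_inv_closed[OF group_SL2R, of "{hecke_S p, hecke_T}" M]
    hecke_group_det[of M p] by (simp add: hecke_group_def)

section \<open>The elements V x built from the generators\<close>

locale hecke =
  fixes p :: nat
  assumes p_ge_3: "p \<ge> 3"
begin

abbreviation G where "G \<equiv> hecke_group p"

text \<open>For integers \<open>n\<close> these are the entries of the powers of \<open>U\<close>.\<close>
definition sn :: "real \<Rightarrow> real" where
  "sn x = sin (x * pi / real p) / sin (pi / real p)"

lemma sin_pos: "sin (pi / real p) > 0"
  using p_ge_3 by (intro sin_gt_zero) (auto simp: field_simps)

lemma sn_pos: "0 < x \<Longrightarrow> x < real p \<Longrightarrow> sn x > 0"
  unfolding sn_def using p_ge_3
  by (intro divide_pos_pos sin_pos sin_gt_zero) (auto simp: field_simps)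

lemma sn_0 [simp]: "sn 0 = 0" and sn_1 [simp]: "sn 1 = 1" and sn_p [simp]: "sn (real p) = 0"
  using sin_pos p_ge_3 by (auto simp: sn_def)

lemma sn_minus: "sn (- x) = - sn x"
  by (simp add: sn_def)

lemma sn_add_p: "sn (x + real p) = - sn x"
  using p_ge_3 by (simp add: sn_def add_divide_distrib distrib_right)

lemma sn_nonneg: "0 \<le> x \<Longrightarrow> x \<le> real p \<Longrightarrow> sn x \<ge> 0"
  using sn_pos[of x] by (cases "x = 0 \<or> x = real p") (auto intro: less_imp_le)

text \<open>By the addition theorem the products with cos (pi/p) cancel. Shifting x and y by 1
  yields all four entries of \<open>V_T_V\<close>.\<close>

lemma sn_product: "sn (x - 1) * sn y - sn x * sn (y + 1) = - sn (x + y)"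
proof -
  define t where "t = pi / real p"
  have eq: "sn u = sin (u * t) / sin t" for u
    by (simp add: sn_def t_def)
  have t0: "sin t \<noteq> 0" using sin_pos by (simp add: t_def)
  have 1: "sin ((x - 1) * t) = sin (x * t) * cos t - cos (x * t) * sin t"
    by (simp add: left_diff_distrib sin_diff)
  have 2: "sin ((y + 1) * t) = sin (y * t) * cos t + cos (y * t) * sin t"
    by (simp add: distrib_right sin_add)
  have 3: "sin ((x + y) * t) = sin (x * t) * cos (y * t) + cos (x * t) * sin (y * t)"
    by (simp add: distrib_right sin_add)
  have "(sin ((x - 1) * t) * sin (y * t) - sin (x * t) * sin ((y + 1) * t)) =
      - (sin t * sin ((x + y) * t))"
    unfolding 1 2 3 by (simp add: algebra_simps)
  then have "(sin ((x - 1) * t) * sin (y * t) - sin (x * t) * sin ((y + 1) * t)) / (sin t * sin t) =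
      - (sin t * sin ((x + y) * t)) / (sin t * sin t)"
    by (rule arg_cong)
  then show ?thesis unfolding eq using t0 by (simp add: diff_divide_distrib)
qed

text \<open>The product formula with x + y = -1.\<close>

lemma sn_det: "(sn x)\<^sup>2 = 1 + sn (x - 1) * sn (x + 1)"
proof -
  have "sn (x - 1) * sn (-x - 1) - sn x * sn (-x) = 1"
    using sn_product[of x "-x-1"] by (simp add: sn_minus)
  moreover have "sn (-x - 1) = - sn (x + 1)"
    using sn_minus[of "x+1"] by simp
  ultimately show ?thesis by (simp add: sn_minus power2_eq_square)
qed

lemma hecke_lambda_eq: "hecke_lambda p = sn 2"
  using sin_pos sin_double[of "pi / real p"] by (simp add: sn_def hecke_lambda_def field_simps)

text \<open>By \<open>hecke_U_pow\<close>, \<open>V (-j)\<close> is U^j T. A real index lets the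
  trigonometric identities apply without integrality. For p = 3, \<open>V 1\<close> and
  \<open>V 2\<close> are the two Farey matrices.\<close>

definition V :: "real \<Rightarrow> real^2^2" where
  "V x = mat2 (sn x) (sn (x - 1)) (sn (x + 1)) (sn x)"

lemma V_nth [simp]:
  "V x $ 1 $ 1 = sn x" "V x $ 1 $ 2 = sn (x - 1)" "V x $ 2 $ 1 = sn (x + 1)" "V x $ 2 $ 2 = sn x"
  by (simp_all add: V_def)

lemma V_det [simp]: "det (V x) = 1"
  using sn_det[of x] by (simp add: det_2 power2_eq_square)

text \<open>Up to sign \<open>V x ** hecke_T\<close> is a power of U for integer x, so left
  multiplication by it shifts the index by x.\<close>

lemma V_T_V: "V x ** hecke_T ** V y = - V (x + y)"
  using sn_product[of x y] sn_product[of x "y-1"] sn_product[of "x+1" y] sn_product[of "x+1" "y-1"]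
  by (simp add: mat2_eq_iff algebra_simps)

text \<open>In terms of U this is U^p = -I.\<close>

lemma V_add_p: "V (x + real p) = - V x"
  using sn_add_p[of "x-1"] sn_add_p[of x] sn_add_p[of "x+1"]
  by (simp add: mat2_eq_iff algebra_simps)

lemma V_0: "V 0 = hecke_T"
  by (simp add: mat2_eq_iff sn_minus)

lemma V_neg1: "V (-1) = - hecke_S p"
  using sn_minus[of 2] by (simp add: mat2_eq_iff sn_minus hecke_S_def hecke_lambda_eq)

lemma adj_V: "adj2 (V x) = hecke_T ** V (-x) ** hecke_T"
  using sn_minus[of "x-1"] sn_minus[of "x+1"] by (simp add: mat2_eq_iff sn_minus)

lemma adj_T [simp]: "adj2 hecke_T = - hecke_T"
  by (simp add: mat2_eq_iff)

lemma T_T_mult [simp]: "hecke_T ** (hecke_T ** M) = - (M :: real^2^2)"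
  by (simp add: mat2_eq_iff)

lemma hecke_U_pow: "(hecke_U p [^]\<^bsub>SL2R\<^esub> (j::nat)) ** hecke_T = V (- real j)"
proof (induction j)
  case 0
  show ?case by (simp add: V_0)
next
  case (Suc j)
  have U: "hecke_U p = - (V (-1) ** hecke_T)"
    by (simp add: hecke_U_def V_neg1)
  have dU: "hecke_U p \<in> carrier SL2R"
    by (simp add: hecke_U_def det_mult1)
  have "hecke_U p [^]\<^bsub>SL2R\<^esub> Suc j = hecke_U p ** (hecke_U p [^]\<^bsub>SL2R\<^esub> j)"
    using monoid.nat_pow_Suc2[OF group.is_monoid[OF group_SL2R] dU] by (simp only: SL2R_simps)
  then have "(hecke_U p [^]\<^bsub>SL2R\<^esub> Suc j) ** hecke_T = hecke_U p ** V (- real j)"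
    by (simp only: Suc.IH flip: matrix_mul_assoc)
  also have "\<dots> = V (- real (Suc j))"
    unfolding U matrix_mul_minus V_T_V by simp
  finally show ?case .
qed

end

section \<open>Matrices with nonnegative entries and the right half plane\<close>

definition nonneg_mat :: "real^2^2 \<Rightarrow> bool" where
  "nonneg_mat M \<longleftrightarrow> det M = 1 \<and> M$1$1 \<ge> 0 \<and> M$1$2 \<ge> 0 \<and> M$2$1 \<ge> 0 \<and> M$2$2 \<ge> 0"

lemma nonneg_mat_one [simp]: "nonneg_mat (mat 1)"
  by (simp add: nonneg_mat_def)

lemma nonneg_mat_mult: "nonneg_mat A \<Longrightarrow> nonneg_mat B \<Longrightarrow> nonneg_mat (A ** B)"
  by (simp add: nonneg_mat_def det_mult1)

lemma nonneg_mat_halfplane: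
  fixes z :: complex
  assumes M: "nonneg_mat M" and z: "Re z > 0"
  shows "aut_factor M z \<noteq> 0" "Re (moebius_map M z) > 0"
proof -
  define a b c d where abcd: "a = M$1$1" "b = M$1$2" "c = M$2$1" "d = M$2$2"
  have nn: "a \<ge> 0" "b \<ge> 0" "c \<ge> 0" "d \<ge> 0" and det: "a * d = 1 + b * c"
    using M det_eq_1_iff by (auto simp: nonneg_mat_def abcd)
  have "c > 0 \<or> d > 0"
    using nn det by (cases "c = 0"; cases "d = 0") auto
  then have *: "c * Re z + d > 0"
    using nn z by (auto intro: add_pos_nonneg add_nonneg_pos)
  moreover have "Re (aut_factor M z) = c * Re z + d"
    by (simp add: aut_factor_def abcd)
  ultimately show "aut_factor M z \<noteq> 0" by auto
  have "Re (moebius_map M z) = ((a * Re z + b) * (c * Re z + d) + (a * Im z) * (c * Im z)) /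
          ((c * Re z + d)\<^sup>2 + (c * Im z)\<^sup>2)"
    by (simp add: moebius_map_def abcd Re_divide)
  moreover have "(a * Re z + b) * (c * Re z + d) + (a * Im z) * (c * Im z) > 0"
  proof -
    \<comment> \<open>The coefficient of Re z is ad + bc, which the determinant turns into 1 +
      2bc.\<close>
    have "(a * Re z + b) * (c * Re z + d) + (a * Im z) * (c * Im z) =
          a * c * ((Re z)\<^sup>2 + (Im z)\<^sup>2) + (1 + 2 * (b * c)) * Re z + b * d"
      using arg_cong[OF det, of "\<lambda>x. x * Re z"] by (simp add: algebra_simps power2_eq_square)
    moreover have "a * c * ((Re z)\<^sup>2 + (Im z)\<^sup>2) \<ge> 0" "b * d \<ge> 0"
      using nn by (auto intro!: mult_nonneg_nonneg)
    moreover have "(1 + 2 * (b * c)) * Re z > 0"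
      using nn z by (intro mult_pos_pos add_pos_nonneg) auto
    ultimately show ?thesis by linarith
  qed
  moreover have "(c * Re z + d)\<^sup>2 + (c * Im z)\<^sup>2 > 0"
    using * by (intro add_pos_nonneg) auto
  ultimately show "Re (moebius_map M z) > 0"
    by simp
qed

lemma nonneg_mat_pos:
  fixes x :: real
  assumes "nonneg_mat M" "x > 0"
  shows "aut_factor M x \<noteq> 0" "moebius_map M x > 0"
  using nonneg_mat_halfplane[OF assms(1), of "of_real x"] assms(2)
  by (simp_all add: moebius_map_of_real)

context hecke
begin

lemma V_nonneg: "1 \<le> x \<Longrightarrow> x \<le> real p - 1 \<Longrightarrow> nonneg_mat (V x)"
  using sn_nonneg[of x] sn_nonneg[of "x-1"] sn_nonneg[of "x+1"] by (simp add: nonneg_mat_def)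

text \<open>In \<open>sn_det\<close> the product is nonnegative in this range. The bound 1, stronger
  than positivity, keeps the diagonals of words at least 1.\<close>

lemma sn_ge_1: "1 \<le> x \<Longrightarrow> x \<le> real p - 1 \<Longrightarrow> sn x \<ge> 1"
proof -
  assume x: "1 \<le> x" "x \<le> real p - 1"
  then have "sn (x - 1) * sn (x + 1) \<ge> 0" "sn x \<ge> 0"
    using sn_nonneg[of x] sn_nonneg[of "x-1"] sn_nonneg[of "x+1"] by (auto intro!: mult_nonneg_nonneg)
  then show ?thesis using sn_det[of x] by - (rule power2_le_imp_le, auto)
qed

lemma V_letter [simp]: "i \<in> {1..<p} \<Longrightarrow> nonneg_mat (V (real i))"
  by (rule V_nonneg) auto

lemma hecke_S_eq: "hecke_S p = V (real (p - 1))"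
  using V_add_p[of "-1"] p_ge_3 by (simp add: V_neg1 of_nat_diff)

lemma V_in_G [simp]: "V (real n) \<in> G"
proof (induction n)
  case (Suc n)
  have "V 1 = hecke_T ** adj2 (V (-1)) ** hecke_T"
    unfolding adj_V by (simp add: mat2_eq_iff)
  then have "V 1 \<in> G"
    unfolding V_neg1 by (auto intro!: hecke_group_minus hecke_group_mult hecke_group_adj)
  moreover have "V (real (Suc n)) = - (V (real n) ** hecke_T ** V 1)"
    by (simp add: V_T_V add.commute)
  ultimately show ?case using Suc.IH
    by (auto intro!: hecke_group_minus hecke_group_mult)
qed (simp add: V_0)

text \<open>Up to sign \<open>V j\<close> is \<open>V i\<close> T \<open>V (j - i)\<close>.
  Cancelling the injective \<open>V i\<close> would give z = -1/u with z and u both in the right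
  half plane, whereas T exchanges the half planes.\<close>

lemma V_disjoint_less:
  fixes z w :: complex
  assumes "1 \<le> i" "i < j" "j < p" and z: "Re z > 0" and w: "Re w > 0"
  shows "moebius_map (V (real i)) z \<noteq> moebius_map (V (real j)) w"
proof
  assume eq: "moebius_map (V (real i)) z = moebius_map (V (real j)) w"
  define k where "k = j - i"
  define u where "u = moebius_map (V (real k)) w"
  have k: "k \<in> {1..<p}" "real j = real i + real k"
    using assms by (auto simp: k_def)
  have u: "Re u > 0" and 1: "aut_factor (V (real k)) w \<noteq> 0"
    using nonneg_mat_halfplane[OF V_letter[OF k(1)] w] by (auto simp: u_def)
  have nz: "aut_factor (hecke_T ** V (real k)) w = u * aut_factor (V (real k)) w"
    using aut_factor_mult[OF 1, of hecke_T] by (simp add: u_def)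
  have j: "V (real j) = - (V (real i) ** (hecke_T ** V (real k)))"
    using V_T_V[of "real i" "real k"] by (simp add: k(2) matrix_mul_assoc)
  have nz': "aut_factor (hecke_T ** V (real k)) w \<noteq> 0"
    using nz 1 u by auto
  have "moebius_map (V (real j)) w = moebius_map (V (real i)) (moebius_map (hecke_T ** V (real k)) w)"
    unfolding j moebius_map_minus by (rule moebius_map_mult[OF nz'])
  moreover have "aut_factor (V (real j)) w \<noteq> 0"
    using nonneg_mat_halfplane(1)[OF V_letter w] assms by auto
  then have "aut_factor (V (real i)) (moebius_map (hecke_T ** V (real k)) w) \<noteq> 0"
    unfolding j aut_factor_minus aut_factor_mult[OF nz'] by auto
  moreover have "aut_factor (V (real i)) z \<noteq> 0"
    using nonneg_mat_halfplane[OF V_letter z] assms by auto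
  ultimately have "z = moebius_map (hecke_T ** V (real k)) w"
    using eq by - (rule moebius_map_inj[OF V_det, of "real i"], auto)
  also have "\<dots> = - 1 / u"
    by (simp add: moebius_map_mult[OF 1] moebius_map_T u_def)
  finally have "Re z = - (Re u / ((Re u)\<^sup>2 + (Im u)\<^sup>2))"
    by (simp add: Re_divide)
  moreover have "Re u / ((Re u)\<^sup>2 + (Im u)\<^sup>2) > 0"
    using u by (intro divide_pos_pos add_pos_nonneg) auto
  ultimately show False
    using z by simp
qed

lemma V_disjoint:
  fixes z w :: complex
  assumes "i \<in> {1..<p}" "j \<in> {1..<p}" "Re z > 0" "Re w > 0"
    and "moebius_map (V (real i)) z = moebius_map (V (real j)) w"
  shows "i = j" "z = w"
proof -
  show "i = j"
    using V_disjoint_less[of i j z w] V_disjoint_less[of j i w z] assms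
    by (metis atLeastLessThan_iff linorder_neqE_nat)
  then show "z = w"
    using assms moebius_map_inj[OF V_det] nonneg_mat_halfplane(1)[OF V_letter] by metis
qed

lemma V_disjoint_real:
  fixes x y :: real
  assumes "i \<in> {1..<p}" "j \<in> {1..<p}" "x > 0" "y > 0"
    and "moebius_map (V (real i)) x = moebius_map (V (real j)) y"
  shows "i = j" "x = y"
  using V_disjoint[of i j "of_real x" "of_real y"] assms by (simp_all add: moebius_map_of_real)

section \<open>Words in the letters V 1, ..., V (p-1)\<close>

definition is_word :: "nat list \<Rightarrow> bool" where
  "is_word xs \<longleftrightarrow> set xs \<subseteq> {1..<p}"

primrec word_mat :: "nat list \<Rightarrow> real^2^2" where
  "word_mat [] = mat 1"
| "word_mat (i # xs) = V (real i) ** word_mat xs"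

lemma is_word_simps [simp]:
  "is_word []" "is_word (i # xs) \<longleftrightarrow> i \<in> {1..<p} \<and> is_word xs"
  "is_word (xs @ ys) \<longleftrightarrow> is_word xs \<and> is_word ys"
  by (auto simp: is_word_def)

lemma word_mat_append: "word_mat (xs @ ys) = word_mat xs ** word_mat ys"
  by (induction xs) (simp_all add: matrix_mul_assoc)

lemma word_mat_in_G [simp]: "word_mat xs \<in> G"
  by (induction xs) auto

lemma word_mat_det [simp]: "det (word_mat xs) = 1"
  by (rule hecke_group_det[OF word_mat_in_G])

lemma word_mat_nonneg: "is_word xs \<Longrightarrow> nonneg_mat (word_mat xs)"
  by (induction xs) (auto intro!: nonneg_mat_mult)

text \<open>Prepending the letter i multiplies each diagonal entry by \<open>sn i\<close>, which is
  at least 1, and adds a nonnegative term.\<close>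

lemma word_mat_diag: "is_word xs \<Longrightarrow> word_mat xs $ 1 $ 1 \<ge> 1 \<and> word_mat xs $ 2 $ 2 \<ge> 1"
proof (induction xs)
  case (Cons i xs)
  have N: "nonneg_mat (word_mat xs)" "nonneg_mat (V (real i))"
    using Cons.prems word_mat_nonneg by auto
  have "sn (real i) \<ge> 1"
    using Cons.prems by (intro sn_ge_1) auto
  moreover have "sn (real i) * x \<ge> 1" if "x \<ge> 1" for x
    using mult_mono[OF \<open>sn (real i) \<ge> 1\<close> that] \<open>sn (real i) \<ge> 1\<close> by simp
  moreover have "sn (real i - 1) * (word_mat xs $ 2 $ 1) \<ge> 0" "sn (real i + 1) * (word_mat xs $ 1 $ 2) \<ge> 0"
    using N by (simp_all add: nonneg_mat_def)
  ultimately show ?case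
    using Cons by (simp add: add_increasing add_increasing2)
qed simp

text \<open>Separates nonempty words from the identity. A sum is needed: words in the letter p - 1
  alone are powers of S and have lower left entry 0.\<close>

lemma word_mat_offdiag:
  assumes "is_word xs" "xs \<noteq> []"
  shows "word_mat xs $ 1 $ 2 + word_mat xs $ 2 $ 1 > 0"
proof -
  obtain i ys where xs: "xs = i # ys" and i: "1 \<le> i" "i < p" and ys: "is_word ys"
    using assms by (cases xs) auto
  define a b where "a = sn (real i - 1)" and "b = sn (real i + 1)"
  have ge: "sn (real i) \<ge> 1"
    using i by (intro sn_ge_1) auto
  have nn: "a \<ge> 0" "b \<ge> 0"
    using sn_nonneg[of "real i - 1"] sn_nonneg[of "real i + 1"] i by (auto simp: a_def b_def)
  \<comment> \<open>a vanishes only for i = 1 and b only for i = p - 1, and these differ since p is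
    at least 3.\<close>
  have pos: "a + b > 0"
  proof (cases "i = 1")
    case True
    then have "b > 0" using sn_pos[of 2] p_ge_3 by (simp add: b_def)
    then show ?thesis using nn by simp
  next
    case False
    then have "a > 0" using sn_pos[of "real i - 1"] i by (simp add: a_def)
    then show ?thesis using nn by simp
  qed
  have N: "nonneg_mat (word_mat ys)" and D: "word_mat ys $ 1 $ 1 \<ge> 1" "word_mat ys $ 2 $ 2 \<ge> 1"
    using ys word_mat_nonneg word_mat_diag by auto
  have "a * (word_mat ys $ 2 $ 2) \<ge> a" "b * (word_mat ys $ 1 $ 1) \<ge> b"
    using D nn by (simp_all add: mult_le_cancel_left1)
  moreover have "sn (real i) * (word_mat ys $ 1 $ 2) \<ge> 0" "sn (real i) * (word_mat ys $ 2 $ 1) \<ge> 0"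
    using N ge by (simp_all add: nonneg_mat_def)
  ultimately show ?thesis
    using pos by (simp add: xs a_def b_def)
qed

lemma word_mat_pos:
  fixes x :: real
  assumes "is_word xs" "x > 0"
  shows "aut_factor (word_mat xs) x \<noteq> 0" "moebius_map (word_mat xs) x > 0"
  using nonneg_mat_pos[OF word_mat_nonneg[OF assms(1)] assms(2)] by auto

text \<open>Unique decoding: disjointness of the images forces equal first letters, and injectivity
  strips them until one word is exhausted.\<close>

lemma word_prefix:
  fixes x y :: real
  assumes "is_word xs" "is_word ys" "x > 0" "y > 0"
    and "moebius_map (word_mat xs) x = moebius_map (word_mat ys) y"
  shows "\<exists>zs. xs = ys @ zs \<and> moebius_map (word_mat zs) x = y \<or> ys = xs @ zs \<and> moebius_map (word_mat zs) y = x"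
  using assms
proof (induction xs arbitrary: ys)
  case (Cons i xs)
  note IH = this
  show ?case
  proof (cases ys)
    case Nil
    then show ?thesis using IH by simp
  next
    case (Cons j ys')
    have X: "aut_factor (word_mat xs) x \<noteq> 0" "moebius_map (word_mat xs) x > 0"
      "aut_factor (word_mat ys') y \<noteq> 0" "moebius_map (word_mat ys') y > 0"
      using word_mat_pos IH Cons by auto
    then have "moebius_map (V (real i)) (moebius_map (word_mat xs) x) =
      moebius_map (V (real j)) (moebius_map (word_mat ys') y)"
      using IH Cons by (simp add: moebius_map_mult)
    then have "i = j" "moebius_map (word_mat xs) x = moebius_map (word_mat ys') y"
      using V_disjoint_real[of i j] X IH Cons by auto
    then show ?thesis
      using IH(1)[of ys'] IH Cons by auto
  qed
qed auto

section \<open>Group elements acting on long words\<close>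

definition T_pow :: "bool \<Rightarrow> real^2^2" where
  "T_pow a = (if a then hecke_T else mat 1)"

text \<open>Left multiplication by an element of \<open>G\<close> changes only a bounded initial part of a long word.\<close>
definition reduces :: "real^2^2 \<Rightarrow> nat \<Rightarrow> bool" where
  "reduces N r \<longleftrightarrow> (\<forall>xs a. is_word xs \<longrightarrow> r \<le> length xs \<longrightarrow>
     (\<exists>ys b. is_word ys \<and> length xs \<le> length ys + r \<and>
        eq_sign (N ** (T_pow a ** word_mat xs)) (T_pow b ** word_mat ys)))"

lemma reducesD:
  assumes "reduces N r" "is_word xs" "r \<le> length xs"
  obtains ys b where "is_word ys" "length xs \<le> length ys + r"
    "eq_sign (N ** (T_pow a ** word_mat xs)) (T_pow b ** word_mat ys)"
  using assms unfolding reduces_def by blast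

lemma reduces_minus:
  assumes "reduces N r" shows "reduces (- N) r"
proof -
  have "eq_sign ((- N) ** A) B \<longleftrightarrow> eq_sign (N ** A) B" for A B :: "real^2^2"
    using minus_equation_iff[of "N ** A" B] by (auto simp: eq_sign_def)
  then show ?thesis
    using assms unfolding reduces_def by (simp only:)
qed

lemma reduces_mult:
  assumes A: "reduces A r" and B: "reduces B s"
  shows "reduces (A ** B) (r + s)"
  unfolding reduces_def
proof (intro allI impI)
  fix xs a assume xs: "is_word xs" "r + s \<le> length xs"
  then have "s \<le> length xs" by simp
  from reducesD[OF B xs(1) this, of a] obtain ys b where ys: "is_word ys" "length xs \<le> length ys + s"
    "eq_sign (B ** (T_pow a ** word_mat xs)) (T_pow b ** word_mat ys)" .
  then have "r \<le> length ys" using xs by simp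
  from reducesD[OF A ys(1) this, of b] obtain zs c where zs: "is_word zs" "length ys \<le> length zs + r"
    "eq_sign (A ** (T_pow b ** word_mat ys)) (T_pow c ** word_mat zs)" .
  have "eq_sign ((A ** B) ** (T_pow a ** word_mat xs)) (T_pow c ** word_mat zs)"
    using eq_sign_trans[OF eq_sign_mult[OF eq_sign_refl ys(3)] zs(3)] by (simp only: matrix_mul_assoc)
  then show "\<exists>ys b. is_word ys \<and> length xs \<le> length ys + (r + s) \<and>
      eq_sign (A ** B ** (T_pow a ** word_mat xs)) (T_pow b ** word_mat ys)"
    using zs ys by (intro exI[of _ zs] exI[of _ c]) auto
qed

lemma reduces_one: "reduces (mat 1) 0"
  unfolding reduces_def matrix_mul_lid using eq_sign_refl by fastforce

lemma reduces_T: "reduces hecke_T 0"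
  unfolding reduces_def
proof (intro allI impI)
  fix xs a assume "is_word xs"
  then show "\<exists>ys b. is_word ys \<and> length xs \<le> length ys + 0 \<and>
        eq_sign (hecke_T ** (T_pow a ** word_mat xs)) (T_pow b ** word_mat ys)"
    by (intro exI[of _ xs] exI[of _ "\<not> a"]) (auto simp: T_pow_def eq_sign_def)
qed

text \<open>Without a leading T the letter is simply prepended. With one, \<open>V i\<close> T
  \<open>V j\<close> merges into the index i + j modulo p. Only i + j = p loses a letter: the merged
  factor is then T itself.\<close>

lemma reduces_V:
  assumes i: "i \<in> {1..<p}"
  shows "reduces (V (real i)) 1"
  unfolding reduces_def
proof (intro allI impI)
  fix xs a assume xs: "is_word xs" "1 \<le> length xs"
  then obtain j xs' where j: "xs = j # xs'" "1 \<le> j" "j < p" "is_word xs'"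
    by (cases xs) auto
  show "\<exists>ys b. is_word ys \<and> length xs \<le> length ys + 1 \<and>
        eq_sign (V (real i) ** (T_pow a ** word_mat xs)) (T_pow b ** word_mat ys)"
  proof (cases a)
    case False
    then show ?thesis
      using xs i by (intro exI[of _ "i # xs"] exI[of _ False]) (auto simp: T_pow_def eq_sign_def)
  next
    case True
    have *: "V (real i) ** (T_pow a ** word_mat xs) = - (V (real i + real j) ** word_mat xs')"
      using True V_T_V[of "real i" "real j"]
      by (simp add: T_pow_def j matrix_mul_assoc)
    consider "i + j < p" | "i + j = p" | "i + j > p" by linarith
    then show ?thesis
    proof cases
      case 1
      then show ?thesis unfolding *
        using j i by (intro exI[of _ "(i + j) # xs'"] exI[of _ False]) (auto simp: T_pow_def eq_sign_def)
    next
      case 2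
      then have "real i + real j = 0 + real p" by linarith
      then have "V (real i + real j) = - hecke_T"
        using V_add_p[of 0] by (simp only: V_0)
      then show ?thesis unfolding *
        using j i by (intro exI[of _ "xs'"] exI[of _ True]) (auto simp: T_pow_def eq_sign_def)
    next
      case 3
      then have "real i + real j = real (i + j - p) + real p" by linarith
      then have "V (real i + real j) = - V (real (i + j - p))"
        using V_add_p by metis
      then show ?thesis unfolding *
        using j i 3 by (intro exI[of _ "(i + j - p) # xs'"] exI[of _ False]) (auto simp: T_pow_def eq_sign_def)
    qed
  qed
qed

lemma reduces_G: "N \<in> G \<Longrightarrow> \<exists>r. reduces N r"
proof (induction N rule: hecke_group_induct)
  case S
  have "p - 1 \<in> {1..<p}" using p_ge_3 by auto
  from reduces_V[OF this] show ?case
    unfolding hecke_S_eq by blast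
next
  case (inv M)
  \<comment> \<open>S is the letter p - 1, and its inverse is T \<open>V 1\<close> T up to
    sign.\<close>
  have "adj2 (hecke_S p) = - (hecke_T ** V (real 1) ** hecke_T)"
    using V_add_p[of "- real (p - 1)"] p_ge_3
    unfolding hecke_S_eq adj_V by (simp add: of_nat_diff)
  moreover have "reduces (V (real 1)) 1"
    using p_ge_3 by (intro reduces_V) auto
  then have "reduces (- (hecke_T ** V (real 1) ** hecke_T)) (0 + 1 + 0)"
    by (intro reduces_minus reduces_mult reduces_T)
  ultimately show ?case
    using inv reduces_minus[OF reduces_T] by auto
qed (use reduces_one reduces_T reduces_mult in blast)+

text \<open>The substitute for discreteness at infinity. Multiplying by S^r keeps the matrix upper
  triangular with the same diagonal and turns it into a word up to sign. The diagonal entries of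
  that word are at least 1 and have product 1.\<close>

lemma upper_triangular_in_G:
  assumes N: "N \<in> G" "N $ 2 $ 1 = 0"
  shows "N $ 1 $ 1 = N $ 2 $ 2" "(N $ 1 $ 1)\<^sup>2 = 1"
proof -
  obtain r where r: "reduces N r" using reduces_G[OF N(1)] by blast
  have S: "word_mat (replicate n (p - 1)) $ 1 $ 1 = 1 \<and> word_mat (replicate n (p - 1)) $ 2 $ 1 = 0 \<and>
     word_mat (replicate n (p - 1)) $ 2 $ 2 = 1" for n
  proof (induction n)
    case (Suc n)
    have "word_mat (replicate (Suc n) (p - 1)) = hecke_S p ** word_mat (replicate n (p - 1))"
      by (simp only: replicate_Suc word_mat.simps hecke_S_eq)
    then show ?case using Suc.IH by (simp add: hecke_S_def del: replicate_Suc)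
  qed simp
  define Y where "Y = N ** word_mat (replicate r (p - 1))"
  have Y: "Y $ 1 $ 1 = N $ 1 $ 1" "Y $ 2 $ 1 = 0" "Y $ 2 $ 2 = N $ 2 $ 2"
    using S[of r] N(2) by (auto simp: Y_def)
  have "is_word (replicate r (p - 1))"
    using p_ge_3 by (auto simp: is_word_def set_replicate_conv_if)
  from reducesD[OF r this, of False] obtain ys b where
    ys: "is_word ys" "Y = T_pow b ** word_mat ys \<or> Y = - (T_pow b ** word_mat ys)"
    unfolding Y_def T_pow_def if_False matrix_mul_lid length_replicate eq_sign_def by blast
  have d: "word_mat ys $ 1 $ 1 \<ge> 1" "word_mat ys $ 2 $ 2 \<ge> 1"
    using word_mat_diag ys by auto
  \<comment> \<open>A leading T would carry the upper left entry of the word, which is at least 1,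
    into the lower left corner.\<close>
  have "\<not> b"
    using ys(2) Y(2) d by (auto simp: T_pow_def)
  then have e: "Y = word_mat ys \<or> Y = - word_mat ys"
    using ys(2) by (auto simp: T_pow_def)
  then have "word_mat ys $ 1 $ 1 * word_mat ys $ 2 $ 2 = 1"
    using det_eq_1D[OF word_mat_det[of ys]] Y(2) by auto
  moreover have "word_mat ys $ 1 $ 1 * 1 \<le> word_mat ys $ 1 $ 1 * word_mat ys $ 2 $ 2"
    "1 * word_mat ys $ 2 $ 2 \<le> word_mat ys $ 1 $ 1 * word_mat ys $ 2 $ 2"
    using d by (intro mult_mono; simp)+
  ultimately have "word_mat ys $ 1 $ 1 = 1" "word_mat ys $ 2 $ 2 = 1"
    using d by simp_all
  then have "N $ 1 $ 1 = 1 \<and> N $ 2 $ 2 = 1 \<or> N $ 1 $ 1 = - 1 \<and> N $ 2 $ 2 = - 1"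
    using e unfolding Y(1,3)[symmetric] by auto
  then show "N $ 1 $ 1 = N $ 2 $ 2" "(N $ 1 $ 1)\<^sup>2 = 1"
    by auto
qed

end

section \<open>Fixed points and their stabilizers\<close>

lemma fixes_point_quadratic:
  assumes "fixes_point M x"
  shows "M$2$1 * x\<^sup>2 + (M$2$2 - M$1$1) * x - M$1$2 = 0"
proof -
  have "aut_factor M x \<noteq> 0" "(M$1$1 * x + M$1$2) / aut_factor M x = x"
    using assms by (auto simp: fixes_point_alt moebius_map_alt)
  then have "M$1$1 * x + M$1$2 = x * aut_factor M x"
    by (simp add: field_simps)
  then show ?thesis
    by (simp add: aut_factor_def algebra_simps power2_eq_square)
qed

lemma fixes_pointI:
  assumes "aut_factor M x \<noteq> 0" "M$2$1 * x\<^sup>2 + (M$2$2 - M$1$1) * x - M$1$2 = 0"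
  shows "fixes_point M x"
proof -
  have "M$1$1 * x + M$1$2 = x * aut_factor M x"
    using assms(2) by (simp add: aut_factor_def algebra_simps power2_eq_square)
  then show ?thesis
    using assms(1) by (simp add: fixes_point_alt moebius_map_alt)
qed

lemma trace2: "trace (M :: real^2^2) = M$1$1 + M$2$2"
  by (simp add: trace_def sum_2)

text \<open>At a fixed point the automorphy factor is the eigenvalue of M for the vector (x, 1);
  determinant 1 makes the other eigenvalue its reciprocal.\<close>

lemma trace_fixes_point:
  assumes "det M = 1" "fixes_point M x"
  shows "trace M = aut_factor M x + 1 / aut_factor M x"
proof -
  have nz: "aut_factor M x \<noteq> 0" using assms(2) by (simp add: fixes_point_alt)
  have q: "M$2$1 * (M$2$1 * x\<^sup>2 + (M$2$2 - M$1$1) * x - M$1$2) = 0"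
    using fixes_point_quadratic[OF assms(2)] by simp
  have "(M$1$1 - M$2$1 * x) * aut_factor M x =
      M$1$1 * M$2$2 - M$1$2 * M$2$1 - M$2$1 * (M$2$1 * x\<^sup>2 + (M$2$2 - M$1$1) * x - M$1$2)"
    by (simp add: aut_factor_def algebra_simps power2_eq_square)
  also have "\<dots> = 1"
    unfolding q using det_eq_1D[OF assms(1)] by simp
  finally have "1 / aut_factor M x = M$1$1 - M$2$1 * x"
    using nz by (simp add: field_simps)
  then show ?thesis by (simp add: trace2 aut_factor_def)
qed

lemma hyperbolic_aut_factor:
  assumes "det M = 1" "fixes_point M x" "\<bar>trace M\<bar> > 2"
  shows "\<bar>aut_factor M x\<bar> \<noteq> 1"
  using trace_fixes_point[OF assms(1,2)] assms(3) by (auto simp: abs_if split: if_splits)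

primrec mat_pow :: "real^2^2 \<Rightarrow> nat \<Rightarrow> real^2^2" where
  "mat_pow M 0 = mat 1"
| "mat_pow M (Suc n) = M ** mat_pow M n"

lemma mat_pow_add: "mat_pow M (m + n) = mat_pow M m ** mat_pow M n"
  by (induction m) (simp_all add: matrix_mul_assoc)

lemma det_mat_pow [simp]: "det M = 1 \<Longrightarrow> det (mat_pow M n) = 1"
  by (induction n) (simp_all add: det_mult1)

lemma mat_pow_in_hecke_group: "M \<in> hecke_group p \<Longrightarrow> mat_pow M n \<in> hecke_group p"
  by (induction n) auto

lemma mat_pow_fixes_point:
  assumes "fixes_point M x"
  shows "aut_factor (mat_pow M n) x = aut_factor M x ^ n \<and> fixes_point (mat_pow M n) x"
  using assms
  by (induction n) (simp_all add: fixes_point_alt aut_factor_mult moebius_map_mult)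

lemma fixes_point_mult:
  assumes "fixes_point A x" "fixes_point B x"
  shows "fixes_point (A ** B) x" "aut_factor (A ** B) x = aut_factor A x * aut_factor B x"
  using assms by (auto simp: fixes_point_alt aut_factor_mult moebius_map_mult)

lemma fixes_point_adj: "det M = 1 \<Longrightarrow> fixes_point M x \<Longrightarrow> fixes_point (adj2 M) x"
  using aut_factor_adj[of M x] moebius_map_adj[of M x] by (simp add: fixes_point_alt)

lemma fixes_point_minus [simp]: "fixes_point (- M) x \<longleftrightarrow> fixes_point M x"
  by (simp add: fixes_point_alt)

lemma eq_sign_fixes_point: "eq_sign A B \<Longrightarrow> fixes_point A x \<longleftrightarrow> fixes_point B x"
  by (auto simp: eq_sign_def)

lemma eq_sign_cancel_right:
  assumes "det C = 1" "eq_sign (A ** C) (B ** C)" shows "eq_sign A B"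
  using eq_sign_mult[OF assms(2) eq_sign_refl, of "adj2 C"] assms(1)
  by (simp flip: matrix_mul_assoc)

lemma mat_pow_commute: "mat_pow M m ** mat_pow M n = mat_pow M n ** mat_pow M m"
  by (simp add: add.commute flip: mat_pow_add)

text \<open>The pair of natural exponents m, n encodes the integer power n - m of M.\<close>

lemma generate_pm_iff:
  assumes d: "det M = 1" and dN: "det N = 1"
  shows "N \<in> generate SL2R {M, - mat 1} \<longleftrightarrow> (\<exists>m n. eq_sign (N ** mat_pow M m) (mat_pow M n))"
proof
  assume "N \<in> generate SL2R {M, - mat 1}"
  then show "\<exists>m n. eq_sign (N ** mat_pow M m) (mat_pow M n)"
  proof (induction N rule: generate.induct)
    case one
    show ?case by (intro exI[of _ 0]) simp
  next
    case (incl h)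
    then show ?case
    proof (elim insertE)
      assume "h = M" then show ?thesis by (intro exI[of _ 0] exI[of _ 1]) simp
    next
      assume "h = - mat 1" then show ?thesis by (intro exI[of _ 0]) (simp add: eq_sign_def)
    qed simp
  next
    case (inv h)
    then show ?case
    proof (elim insertE)
      assume "h = M" then show ?thesis using d by (intro exI[of _ 1] exI[of _ 0]) simp
    next
      assume "h = - mat 1"
      moreover have "adj2 (mat 1) = (mat 1 :: real^2^2)" by (simp add: mat2_eq_iff)
      ultimately show ?thesis by (intro exI[of _ 0]) (simp add: eq_sign_def)
    qed simp
  next
    case (eng A B)
    then obtain m n k l where 1: "eq_sign (A ** mat_pow M m) (mat_pow M n)"
      and 2: "eq_sign (B ** mat_pow M k) (mat_pow M l)" by blast
    have e1: "(A ** B) ** mat_pow M (k + m) = A ** ((B ** mat_pow M k) ** mat_pow M m)"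
      by (simp only: mat_pow_add matrix_mul_assoc)
    have e2: "eq_sign (A ** ((B ** mat_pow M k) ** mat_pow M m)) (A ** (mat_pow M l ** mat_pow M m))"
      by (rule eq_sign_mult[OF eq_sign_refl eq_sign_mult[OF 2 eq_sign_refl]])
    have e3: "A ** (mat_pow M l ** mat_pow M m) = (A ** mat_pow M m) ** mat_pow M l"
      unfolding mat_pow_commute[of M l m] by (simp only: matrix_mul_assoc)
    have e4: "eq_sign ((A ** mat_pow M m) ** mat_pow M l) (mat_pow M (n + l))"
      unfolding mat_pow_add by (rule eq_sign_mult[OF 1 eq_sign_refl])
    have "eq_sign ((A ** B) ** mat_pow M (k + m)) (mat_pow M (n + l))"
      unfolding e1 by (rule eq_sign_trans[OF e2]) (simp only: e3 e4)
    then show ?case unfolding SL2R_simps by blast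
  qed
next
  interpret SL: group SL2R by (rule group_SL2R)
  let ?H = "generate SL2R {M, - mat 1}"
  have sub: "subgroup ?H SL2R"
    using d by (intro SL.generate_is_subgroup) auto
  have M: "M \<in> ?H" and m1: "- mat 1 \<in> ?H"
    by (auto intro: generate.incl)
  have mult: "A ** B \<in> ?H" if "A \<in> ?H" "B \<in> ?H" for A B
    using subgroup.m_closed[OF sub that] by simp
  have pow: "mat_pow M n \<in> ?H" for n
  proof (induction n)
    case 0 show ?case using subgroup.one_closed[OF sub] by simp
  qed (auto intro: mult M)
  have inv: "adj2 (mat_pow M n) \<in> ?H" for n
    using subgroup.m_inv_closed[OF sub pow[of n]] d by simp
  assume "\<exists>m n. eq_sign (N ** mat_pow M m) (mat_pow M n)"
  then obtain m n where mn: "eq_sign (N ** mat_pow M m) (mat_pow M n)" by blast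
  have "(N ** mat_pow M m) ** adj2 (mat_pow M m) = N"
    unfolding matrix_mul_assoc[symmetric] using d by simp
  then have "eq_sign N (mat_pow M n ** adj2 (mat_pow M m))"
    using eq_sign_mult[OF mn eq_sign_refl[of "adj2 (mat_pow M m)"]] by simp
  moreover have "mat_pow M n ** adj2 (mat_pow M m) \<in> ?H" "- mat 1 ** (mat_pow M n ** adj2 (mat_pow M m)) \<in> ?H"
    by (intro mult pow inv m1)+
  ultimately show "N \<in> ?H" by (auto simp: eq_sign_def)
qed

text \<open>The real points outside the orbit of infinity. On them every group element acts without
  a vanishing denominator, so composition laws hold freely.\<close>

definition noncusp :: "nat \<Rightarrow> real \<Rightarrow> bool" where
  "noncusp p x \<longleftrightarrow> (\<forall>M\<in>hecke_group p. aut_factor M x \<noteq> 0)"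

lemma noncuspD: "noncusp p x \<Longrightarrow> M \<in> hecke_group p \<Longrightarrow> aut_factor M x \<noteq> 0"
  by (simp add: noncusp_def)

lemma noncusp_moebius:
  assumes "noncusp p x" "M \<in> hecke_group p"
  shows "noncusp p (moebius_map M x)"
  unfolding noncusp_def
proof
  fix N assume N: "N \<in> hecke_group p"
  then have "aut_factor (N ** M) x \<noteq> 0" "aut_factor M x \<noteq> 0"
    using assms by (auto simp: noncusp_def)
  then show "aut_factor N (moebius_map M x) \<noteq> 0"
    by (simp add: aut_factor_mult)
qed

lemma noncusp_nonzero: "noncusp p x \<Longrightarrow> x \<noteq> 0"
  using noncuspD[of p x hecke_T] by simp

text \<open>The generated group always lies in the stabilizer, so only the opposite inclusion
  remains as a condition.\<close>

lemma hecke_stabilizer_generator_iff: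
  assumes "M \<in> hecke_stabilizer p x"
  shows "stabilizer_generator p x M \<longleftrightarrow>
    (\<forall>N\<in>hecke_stabilizer p x. \<exists>m n. eq_sign (N ** mat_pow M m) (mat_pow M n))"
proof -
  have d: "det M = 1" and M: "fixes_point M x" "M \<in> hecke_group p"
    using assms hecke_group_det by (auto simp: hecke_stabilizer_def)
  have dS: "\<And>N. N \<in> hecke_stabilizer p x \<Longrightarrow> det N = 1"
    using hecke_group_det by (auto simp: hecke_stabilizer_def)
  have dG: "\<And>N. N \<in> generate SL2R {M, - mat 1} \<Longrightarrow> det N = 1"
    using group.generate_incl[OF group_SL2R, of "{M, - mat 1}"] d by auto
  have "generate SL2R {M, - mat 1} \<subseteq> hecke_stabilizer p x"
  proof
    fix N assume N: "N \<in> generate SL2R {M, - mat 1}"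
    then obtain m n where mn: "eq_sign (N ** mat_pow M m) (mat_pow M n)"
      using generate_pm_iff[OF d dG[OF N]] by blast
    have "(N ** mat_pow M m) ** adj2 (mat_pow M m) = N"
      unfolding matrix_mul_assoc[symmetric] using d by simp
    then have e: "eq_sign N (mat_pow M n ** adj2 (mat_pow M m))"
      using eq_sign_mult[OF mn eq_sign_refl[of "adj2 (mat_pow M m)"]] by simp
    have "fixes_point (mat_pow M n ** adj2 (mat_pow M m)) x"
      using M d by (intro fixes_point_mult fixes_point_adj) (auto simp: mat_pow_fixes_point)
    moreover have "mat_pow M n ** adj2 (mat_pow M m) \<in> hecke_group p"
      using M by (intro hecke_group_mult hecke_group_adj mat_pow_in_hecke_group)
    ultimately show "N \<in> hecke_stabilizer p x"
      using e eq_sign_fixes_point[OF e] by (auto simp: hecke_stabilizer_def eq_sign_def)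
  qed
  then have "stabilizer_generator p x M \<longleftrightarrow> hecke_stabilizer p x \<subseteq> generate SL2R {M, - mat 1}"
    using assms unfolding stabilizer_generator_def by blast
  also have "\<dots> \<longleftrightarrow> (\<forall>N\<in>hecke_stabilizer p x. \<exists>m n. eq_sign (N ** mat_pow M m) (mat_pow M n))"
    using generate_pm_iff[OF d dS] by blast
  finally show ?thesis .
qed

text \<open>The logarithm of the absolute automorphy factor at x is additive on the stabilizer. Its
  values a and b at the two generators are integer multiples of each other, and a is nonzero by
  hyperbolicity, so the integers s and t have product 1.\<close>

lemma stabilizer_generator_unique:
  assumes "stabilizer_generator p x A" "stabilizer_generator p x B" "\<bar>trace A\<bar> > 2"
  shows "eq_sign A B \<or> eq_sign A (adj2 B)"
proof -
  have S: "A \<in> hecke_stabilizer p x" "B \<in> hecke_stabilizer p x"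
    using assms by (auto simp: stabilizer_generator_def)
  then have f: "fixes_point A x" "fixes_point B x" and d: "det A = 1" "det B = 1"
    using hecke_group_det by (auto simp: hecke_stabilizer_def)
  obtain m n where mn: "eq_sign (A ** mat_pow B m) (mat_pow B n)"
    using assms(2) S hecke_stabilizer_generator_iff by blast
  obtain k l where kl: "eq_sign (B ** mat_pow A k) (mat_pow A l)"
    using assms(1) S hecke_stabilizer_generator_iff by blast
  define a b where "a = ln \<bar>aut_factor A x\<bar>" and "b = ln \<bar>aut_factor B x\<bar>"
  have nz: "aut_factor A x \<noteq> 0" "aut_factor B x \<noteq> 0"
    using f by (auto simp: fixes_point_alt)
  have "\<bar>aut_factor A x\<bar> * \<bar>aut_factor B x\<bar> ^ m = \<bar>aut_factor B x\<bar> ^ n"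
    using eq_sign_aut_factor[OF mn, of x] f
    by (simp add: fixes_point_mult mat_pow_fixes_point abs_mult power_abs)
  then have "ln (\<bar>aut_factor A x\<bar> * \<bar>aut_factor B x\<bar> ^ m) = ln (\<bar>aut_factor B x\<bar> ^ n)" by simp
  then have 1: "a + real m * b = real n * b"
    using nz by (simp add: ln_mult ln_realpow a_def b_def)
  have "\<bar>aut_factor B x\<bar> * \<bar>aut_factor A x\<bar> ^ k = \<bar>aut_factor A x\<bar> ^ l"
    using eq_sign_aut_factor[OF kl, of x] f
    by (simp add: fixes_point_mult mat_pow_fixes_point abs_mult power_abs)
  then have "ln (\<bar>aut_factor B x\<bar> * \<bar>aut_factor A x\<bar> ^ k) = ln (\<bar>aut_factor A x\<bar> ^ l)" by simp
  then have 2: "b + real k * a = real l * a"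
    using nz by (simp add: ln_mult ln_realpow a_def b_def)
  have a0: "a \<noteq> 0"
    using hyperbolic_aut_factor[OF d(1) f(1) assms(3)] nz by (simp add: a_def)
  define s t where "s = int n - int m" and "t = int l - int k"
  have "a = real_of_int s * b" "b = real_of_int t * a"
    using 1 2 by (simp_all add: s_def t_def algebra_simps)
  then have "a * real_of_int (s * t) = a * 1" by simp
  then have "s * t = 1" using a0 by (metis mult_cancel_left of_int_eq_1_iff)
  then have "s = 1 \<or> s = -1" by (simp add: zmult_eq_1_iff) auto
  then have "n = Suc m \<or> m = Suc n" by (auto simp: s_def)
  then show ?thesis
  proof
    assume "n = Suc m"
    then have "eq_sign A B"
      using mn eq_sign_cancel_right[of "mat_pow B m" A B] d by simp
    then show ?thesis ..
  next
    assume "m = Suc n"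
    then have "eq_sign (A ** B) (mat 1)"
      using mn eq_sign_cancel_right[of "mat_pow B n" "A ** B" "mat 1"] d by (simp add: matrix_mul_assoc)
    then have "eq_sign (A ** B ** adj2 B) (mat 1 ** adj2 B)"
      by (rule eq_sign_mult) simp
    then have "eq_sign A (adj2 B)"
      using d by (simp flip: matrix_mul_assoc)
    then show ?thesis ..
  qed
qed

lemma fixes_point_conj:
  assumes "det Y = 1" "aut_factor Y x \<noteq> 0" "fixes_point M x"
  shows "fixes_point (Y ** M ** adj2 Y) (moebius_map Y x)"
proof -
  have 1: "aut_factor (adj2 Y) (moebius_map Y x) \<noteq> 0" "moebius_map (adj2 Y) (moebius_map Y x) = x"
    using aut_factor_adj[OF assms(1,2)] moebius_map_adj[OF assms(1,2)] assms(2) by auto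
  have 2: "aut_factor M x \<noteq> 0" "moebius_map M x = x"
    using assms(3) by (auto simp: fixes_point_alt)
  have 3: "aut_factor (M ** adj2 Y) (moebius_map Y x) \<noteq> 0"
    using 1 2 by (simp add: aut_factor_mult)
  show ?thesis
    unfolding fixes_point_alt
    using 1 2 3 assms(2) by (simp add: aut_factor_mult moebius_map_mult flip: matrix_mul_assoc)
qed

lemma hecke_stabilizer_conj:
  assumes "noncusp p x" "Y \<in> hecke_group p"
  shows "N \<in> hecke_stabilizer p (moebius_map Y x) \<longleftrightarrow> adj2 Y ** N ** Y \<in> hecke_stabilizer p x"
proof
  have d: "det Y = 1" and nz: "aut_factor Y x \<noteq> 0"
    using assms hecke_group_det noncuspD by auto
  {
    assume "N \<in> hecke_stabilizer p (moebius_map Y x)"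
    then have N: "N \<in> hecke_group p" "fixes_point N (moebius_map Y x)"
      by (auto simp: hecke_stabilizer_def)
    have "fixes_point (adj2 Y ** N ** adj2 (adj2 Y)) (moebius_map (adj2 Y) (moebius_map Y x))"
      using aut_factor_adj[OF d nz] nz d by (intro fixes_point_conj N) auto
    then show "adj2 Y ** N ** Y \<in> hecke_stabilizer p x"
      using N assms moebius_map_adj[OF d nz] by (auto simp: hecke_stabilizer_def)
  next
    assume "adj2 Y ** N ** Y \<in> hecke_stabilizer p x"
    then have N: "adj2 Y ** N ** Y \<in> hecke_group p" "fixes_point (adj2 Y ** N ** Y) x"
      by (auto simp: hecke_stabilizer_def)
    have e: "Y ** (adj2 Y ** N ** Y) ** adj2 Y = N"
      using d by (simp add: matrix_mul_assoc) (simp flip: matrix_mul_assoc)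
    show "N \<in> hecke_stabilizer p (moebius_map Y x)"
      using fixes_point_conj[OF d nz N(2)] N(1) assms
      unfolding hecke_stabilizer_def e by (auto simp: e intro!: hecke_group_mult hecke_group_adj)
         (metis e hecke_group_adj hecke_group_mult)
  }
qed

lemma mat_pow_conj:
  assumes "det Y = 1"
  shows "mat_pow (Y ** M ** adj2 Y) n = Y ** mat_pow M n ** adj2 Y"
proof (induction n)
  case (Suc n)
  have "(Y ** M ** adj2 Y) ** (Y ** mat_pow M n ** adj2 Y) = Y ** M ** (adj2 Y ** Y) ** mat_pow M n ** adj2 Y"
    by (simp only: matrix_mul_assoc)
  then show ?case using Suc assms by (simp add: matrix_mul_assoc)
qed (use assms in simp)

lemma trace_conj: "det Y = 1 \<Longrightarrow> trace (Y ** M ** adj2 Y) = trace (M :: real^2^2)"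
  by (metis adj2_inverse(1) matrix_mul_assoc matrix_mul_lid trace_mul_sym)

lemma stabilizer_generator_conj:
  assumes x: "noncusp p x" and Y: "Y \<in> hecke_group p" and M: "stabilizer_generator p x M"
  shows "stabilizer_generator p (moebius_map Y x) (Y ** M ** adj2 Y)"
proof -
  have d: "det Y = 1" using Y hecke_group_det by auto
  have e: "adj2 Y ** (Y ** M ** adj2 Y) ** Y = M" for M
    using d by (simp add: matrix_mul_assoc) (simp flip: matrix_mul_assoc)
  have MS: "M \<in> hecke_stabilizer p x" using M by (simp add: stabilizer_generator_def)
  have S: "Y ** M ** adj2 Y \<in> hecke_stabilizer p (moebius_map Y x)"
    unfolding hecke_stabilizer_conj[OF x Y] e by (rule MS)
  show ?thesis
    unfolding hecke_stabilizer_generator_iff[OF S]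
  proof
    fix N assume N: "N \<in> hecke_stabilizer p (moebius_map Y x)"
    define K where "K = adj2 Y ** N ** Y"
    have NK: "N = Y ** K ** adj2 Y"
      using d by (simp add: K_def matrix_mul_assoc) (simp flip: matrix_mul_assoc)
    have "K \<in> hecke_stabilizer p x"
      using N unfolding K_def hecke_stabilizer_conj[OF x Y] .
    then obtain m n where mn: "eq_sign (K ** mat_pow M m) (mat_pow M n)"
      using M hecke_stabilizer_generator_iff[OF MS] by blast
    have "N ** mat_pow (Y ** M ** adj2 Y) m = Y ** K ** (adj2 Y ** Y) ** mat_pow M m ** adj2 Y"
      by (simp only: mat_pow_conj[OF d] NK matrix_mul_assoc)
    also have "\<dots> = Y ** (K ** mat_pow M m) ** adj2 Y"
      using d by (simp add: matrix_mul_assoc)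
    finally have "eq_sign (N ** mat_pow (Y ** M ** adj2 Y) m) (mat_pow (Y ** M ** adj2 Y) n)"
      using mn by (simp add: mat_pow_conj[OF d] eq_sign_mult)
    then show "\<exists>m n. eq_sign (N ** mat_pow (Y ** M ** adj2 Y) m) (mat_pow (Y ** M ** adj2 Y) n)"
      by blast
  qed
qed

section \<open>Expansions of points along words and their periods\<close>

context hecke
begin

text \<open>If \<open>V i\<close> sends x to a negative number, T makes it positive and
  \<open>V (j - i)\<close> keeps it so; up to sign this composite is \<open>V j\<close>. Applied to
  conjugates of poles, it singles out the letter that preserves a pole.\<close>

lemma V_negative_unique_less:
  assumes x: "noncusp p x" and ij: "1 \<le> i" "i < j" "j < p"
    and "moebius_map (V (real i)) x < 0" "moebius_map (V (real j)) x < 0"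
  shows False
proof -
  define k where "k = j - i"
  have k: "k \<in> {1..<p}" "real j = real k + real i"
    using ij by (auto simp: k_def)
  have j: "V (real j) = - (V (real k) ** (hecke_T ** V (real i)))"
    using V_T_V[of "real k" "real i"] by (simp add: k(2) matrix_mul_assoc)
  have 1: "aut_factor (V (real i)) x \<noteq> 0" "aut_factor (hecke_T ** V (real i)) x \<noteq> 0"
    using noncuspD[OF x] by auto
  have "moebius_map (V (real j)) x = moebius_map (V (real k)) (- 1 / moebius_map (V (real i)) x)"
    unfolding j using 1 by (simp add: moebius_map_mult moebius_map_T)
  moreover have "\<dots> > 0"
    using assms(5) by (intro nonneg_mat_pos V_letter k) (simp add: divide_pos_neg)
  ultimately show False
    using assms(6) by simp
qed

lemma V_negative_unique:
  assumes "noncusp p x" "i \<in> {1..<p}" "j \<in> {1..<p}"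
    and "moebius_map (V (real i)) x < 0" "moebius_map (V (real j)) x < 0"
  shows "i = j"
  using V_negative_unique_less[of x i j] V_negative_unique_less[of x j i] assms
  by (metis atLeastLessThan_iff linorder_neqE_nat)

text \<open>The images of the positive axis under consecutive letters are adjacent intervals whose
  endpoints are cusps or infinity.\<close>

lemma noncusp_expand:
  assumes x: "noncusp p x" "x > 0"
  shows "\<exists>i\<in>{1..<p}. \<exists>y>0. noncusp p y \<and> x = moebius_map (V (real i)) y"
proof -
  \<comment> \<open>\<open>V i\<close> maps the positive axis onto the interval from sn (i-1) / sn i
    to sn i / sn (i+1). The right end for i is the left end for i + 1, so the letter sought is the
    largest i whose left end lies below x.\<close>
  define A where "A = {i \<in> {1..<p}. sn (real i) * x > sn (real i - 1)}"
  have fin: "finite A" by (simp add: A_def)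
  have "1 \<in> A" using x p_ge_3 by (simp add: A_def)
  define i where "i = Max A"
  have iA: "i \<in> A" using Max_in[OF fin] \<open>1 \<in> A\<close> by (auto simp: i_def)
  then have i: "i \<in> {1..<p}" "sn (real i) * x > sn (real i - 1)" by (auto simp: A_def)
  have inG: "adj2 (V (real i)) \<in> G" by (simp add: hecke_group_adj)
  have nz: "aut_factor (adj2 (V (real i))) x \<noteq> 0"
    using noncuspD[OF x(1) inG] .
  have af: "aut_factor (adj2 (V (real i))) x = sn (real i) - sn (real i + 1) * x"
    by (simp add: aut_factor_def)
  have "aut_factor (adj2 (V (real i))) x > 0"
  \<comment> \<open>For the last letter the right end is infinity, as sn p = 0. For the others
    maximality gives a weak inequality, and \<open>nz\<close> makes it strict.\<close>
  proof (cases "i = p - 1")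
    case True
    then have "real i + 1 = real p" using p_ge_3 by auto
    then show ?thesis using sn_pos[of "real i"] i(1) by (simp add: af)
  next
    case False
    have "Suc i \<notin> A"
      using Max_ge[OF fin, of "Suc i"] by (auto simp: i_def)
    then have "sn (real i + 1) * x \<le> sn (real i)"
      using False i(1) by (auto simp: A_def add.commute)
    then show ?thesis using nz by (simp add: af)
  qed
  moreover have "moebius_map (adj2 (V (real i))) x =
      (sn (real i) * x - sn (real i - 1)) / aut_factor (adj2 (V (real i))) x"
    by (simp add: moebius_map_alt)
  ultimately have "moebius_map (adj2 (V (real i))) x > 0"
    using i(2) by simp
  moreover have "noncusp p (moebius_map (adj2 (V (real i))) x)"
    using noncusp_moebius[OF x(1) inG] .
  moreover have "moebius_map (V (real i)) (moebius_map (adj2 (V (real i))) x) = x"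
    using moebius_map_adj[of "adj2 (V (real i))" x] nz by simp
  ultimately show ?thesis
    using i(1) by (intro bexI[of _ i] exI[of _ "moebius_map (adj2 (V (real i))) x"]) auto
qed

lemma noncusp_expand_word:
  assumes x: "noncusp p x" "x > 0"
  shows "\<exists>xs y. is_word xs \<and> length xs = n \<and> y > 0 \<and> noncusp p y \<and> x = moebius_map (word_mat xs) y"
proof (induction n)
  case 0
  then show ?case using x by (intro exI[of _ "[]"] exI[of _ x]) auto
next
  case (Suc n)
  then obtain xs y where xs: "is_word xs" "length xs = n" "y > 0" "noncusp p y" "x = moebius_map (word_mat xs) y"
    by blast
  obtain i z where i: "i \<in> {1..<p}" "z > 0" "noncusp p z" "y = moebius_map (V (real i)) z"
    using noncusp_expand[OF xs(4,3)] by blast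
  have "x = moebius_map (word_mat (xs @ [i])) z"
    using noncuspD[OF i(3) V_in_G[of i]] xs(5) i(4) by (simp add: word_mat_append moebius_map_mult)
  then show ?case
    using xs i by (intro exI[of _ "xs @ [i]"] exI[of _ z]) auto
qed

text \<open>If N sent x to infinity, conjugating M by N would give an upper triangular element,
  whose trace has absolute value 2 by \<open>upper_triangular_in_G\<close>.\<close>

lemma hyperbolic_noncusp:
  assumes M: "M \<in> G" "\<bar>trace M\<bar> > 2" "fixes_point M x"
  shows "noncusp p x"
  unfolding noncusp_def
proof (intro ballI notI)
  fix N assume N: "N \<in> G" and 0: "aut_factor N x = 0"
  have dN: "det N = 1" using N hecke_group_det by auto
  define K where "K = N ** M ** adj2 N"
  have K: "K \<in> G" using N M by (auto simp: K_def)
  have tr: "trace K = trace M" using trace_conj[OF dN] by (simp add: K_def)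
  have d: "N$2$2 = - (N$2$1 * x)" using 0 by (simp add: aut_factor_def)
  \<comment> \<open>Once d is eliminated, the lower left entry becomes a multiple of the fixed point
    equation of M at x.\<close>
  have "K$2$1 = (N$2$1)\<^sup>2 * (M$2$1 * x\<^sup>2 + (M$2$2 - M$1$1) * x - M$1$2)"
    by (simp add: K_def d algebra_simps power2_eq_square)
  then have "K$2$1 = 0"
    using fixes_point_quadratic[OF M(3)] by simp
  from upper_triangular_in_G[OF K this] have "K$1$1 = K$2$2" "(K$1$1)\<^sup>2 = 1" .
  then have "\<bar>trace K\<bar> = 2"
    by (auto simp: trace2 power2_eq_1_iff)
  then show False using tr M(2) by simp
qed

text \<open>Stated for complex z because poles are not yet known to be real. If an off-diagonal
  entry vanished, the word would be z + b or z / (cz + 1), neither of which fixes a point with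
  positive real part. With b and c positive, a nonreal root would satisfy c |z|^2 + b = 0.\<close>

lemma word_fixed:
  fixes z :: complex
  assumes xs: "is_word xs" "xs \<noteq> []" and z: "Re z > 0" "moebius_map (word_mat xs) z = z"
  shows "word_mat xs $ 1 $ 2 > 0" "word_mat xs $ 2 $ 1 > 0" "trace (word_mat xs) > 2" "Im z = 0"
proof -
  define a b c d where abcd: "a = word_mat xs $ 1 $ 1" "b = word_mat xs $ 1 $ 2"
    "c = word_mat xs $ 2 $ 1" "d = word_mat xs $ 2 $ 2"
  have N: "nonneg_mat (word_mat xs)" using xs word_mat_nonneg by auto
  have nn: "b \<ge> 0" "c \<ge> 0" "a \<ge> 1" "d \<ge> 1" "b + c > 0"
    using N word_mat_diag[OF xs(1)] word_mat_offdiag[OF xs] by (auto simp: nonneg_mat_def abcd)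
  have det: "a * d = 1 + b * c"
    using det_eq_1D[OF word_mat_det[of xs]] by (simp add: abcd)
  have "aut_factor (word_mat xs) z \<noteq> 0"
    using nonneg_mat_halfplane[OF N z(1)] by auto
  then have eq: "of_real a * z + of_real b = z * (of_real c * z + of_real d)"
    using z(2) unfolding moebius_map_alt by (simp add: field_simps abcd aut_factor_def)
  have unit: "a = 1 \<and> d = 1" if "b * c = 0"
  proof -
    have "a * 1 \<le> a * d" "1 * d \<le> a * d"
      using nn by (intro mult_mono; simp)+
    then show ?thesis using det that nn by simp
  qed
  have c: "c > 0"
  proof (rule ccontr)
    assume "\<not> c > 0"
    then have "c = 0" using nn by simp
    moreover from this have "a = 1" "d = 1" using unit by auto
    ultimately show False using eq nn by simp
  qed
  have b: "b > 0"
  proof (rule ccontr)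
    assume "\<not> b > 0"
    then have "b = 0" using nn by simp
    moreover from this have "a = 1" "d = 1" using unit by auto
    ultimately have "z * (of_real c * z) = 0" using eq by (simp add: algebra_simps)
    then show False using c z by auto
  qed
  show "word_mat xs $ 1 $ 2 > 0" "word_mat xs $ 2 $ 1 > 0" using b c by (simp_all add: abcd)
  have "b * c > 0" using b c by simp
  then have "a \<noteq> 1 \<or> d \<noteq> 1" using det by auto
  then show "trace (word_mat xs) > 2" using nn by (auto simp: trace2 abcd)
  show "Im z = 0"
  proof (rule ccontr)
    assume y: "Im z \<noteq> 0"
    have re: "a * Re z + b = Re z * (c * Re z + d) - Im z * (c * Im z)"
      using arg_cong[OF eq, of Re] by simp
    have im: "a * Im z = Re z * (c * Im z) + Im z * (c * Re z + d)"
      using arg_cong[OF eq, of Im] by simp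
    have "Im z * a = Im z * (2 * c * Re z + d)"
      using im by (simp add: algebra_simps)
    then have "a = 2 * c * Re z + d" using y by simp
    then have "c * (Re z)\<^sup>2 + c * (Im z)\<^sup>2 + b = 0"
      using re by (simp add: algebra_simps power2_eq_square)
    moreover have "c * (Re z)\<^sup>2 \<ge> 0" "c * (Im z)\<^sup>2 \<ge> 0" using c by simp_all
    ultimately show False using b by linarith
  qed
qed

lemma word_fixed_real:
  assumes xs: "is_word xs" "xs \<noteq> []" and z: "z > 0" "moebius_map (word_mat xs) z = z"
  shows "word_mat xs $ 1 $ 2 > 0" "word_mat xs $ 2 $ 1 > 0" "trace (word_mat xs) > 2"
    "fixes_point (word_mat xs) z" "noncusp p z"
proof -
  show 1: "word_mat xs $ 1 $ 2 > 0" "word_mat xs $ 2 $ 1 > 0" "trace (word_mat xs) > 2"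
    using word_fixed[OF xs, of "of_real z"] z by (auto simp: moebius_map_of_real)
  show 2: "fixes_point (word_mat xs) z"
    using z word_mat_pos[OF xs(1) z(1)] by (auto simp: fixes_point_alt)
  show "noncusp p z"
    using 1 2 by (intro hyperbolic_noncusp[OF word_mat_in_G[of xs]]) auto
qed

text \<open>A leading T would make the image of y negative, so positivity leaves a word.\<close>

lemma reduces_pos:
  assumes N: "reduces N r" and xs: "is_word xs" "r \<le> length xs"
    and y: "y > 0" "moebius_map N (moebius_map (word_mat xs) y) > (0::real)"
  obtains ys where "is_word ys" "eq_sign (N ** word_mat xs) (word_mat ys)"
proof -
  from reducesD[OF N xs, of False] obtain ys b where ys: "is_word ys"
    "eq_sign (N ** word_mat xs) (T_pow b ** word_mat ys)"
    unfolding T_pow_def if_False matrix_mul_lid by blast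
  have pos: "moebius_map (N ** word_mat xs) y > 0"
    using y word_mat_pos[OF xs(1) y(1)] by (simp add: moebius_map_mult)
  have "\<not> b"
  proof
    assume b: "b"
    have "moebius_map (hecke_T ** word_mat ys) y < 0"
      using word_mat_pos[OF ys(1) y(1)] by (simp add: moebius_map_mult moebius_map_T)
    then show False
      using pos eq_sign_moebius[OF ys(2), of y] b by (simp add: T_pow_def)
  qed
  then show ?thesis
    using that ys by (simp add: T_pow_def)
qed

text \<open>The analogue of Lagrange's theorem on continued fractions: hyperbolic fixed points have
  eventually periodic expansions.\<close>

lemma hyperbolic_periodic:
  assumes M: "M \<in> G" "\<bar>trace M\<bar> > 2" "fixes_point M x" and x: "x > 0"
  obtains xs g ys where "is_word xs" "g > 0" "x = moebius_map (word_mat xs) g"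
    "is_word ys" "ys \<noteq> []" "moebius_map (word_mat ys) g = g"
proof -
  have nc: "noncusp p x" using hyperbolic_noncusp[OF M] .
  obtain r where r: "reduces M r" using reduces_G[OF M(1)] by blast
  obtain xs g where xs: "is_word xs" "length xs = r" "g > 0" "x = moebius_map (word_mat xs) g"
    using noncusp_expand_word[OF nc x] by blast
  have fx: "moebius_map M x = x" using M(3) by (simp add: fixes_point_alt)
  obtain ys where ys: "is_word ys" "eq_sign (M ** word_mat xs) (word_mat ys)"
    using reduces_pos[OF r xs(1) _ xs(3)] xs fx x by auto
  have nz: "aut_factor (word_mat xs) g \<noteq> 0" using word_mat_pos xs by auto
  have "moebius_map (word_mat ys) g = moebius_map (word_mat xs) g"
    using eq_sign_moebius[OF ys(2), of g] nz fx xs(4) by (simp add: moebius_map_mult)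
  \<comment> \<open>Since M fixes x, the words xs and ys send g to the same point. So one is a
    prefix of the other, and the excess is a period of g.\<close>
  from word_prefix[OF ys(1) xs(1) xs(3) xs(3) this]
  obtain zs where zs: "ys = xs @ zs \<or> xs = ys @ zs" "moebius_map (word_mat zs) g = g"
    by blast
  have wz: "is_word zs" using zs(1) xs ys by auto
  have "zs \<noteq> []"
  proof
    assume "zs = []"
    then have "eq_sign (M ** word_mat xs) (mat 1 ** word_mat xs)" using ys zs by auto
    then have "eq_sign M (mat 1)" by (rule eq_sign_cancel_right[rotated]) simp
    then show False using M(2) by (auto simp: eq_sign_def trace2)
  qed
  then show ?thesis using that[of xs g zs] xs wz zs by auto
qed

lemma word_mat_replicate: "word_mat (concat (replicate n xs)) = mat_pow (word_mat xs) n"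
  by (induction n) (simp_all add: word_mat_append)

lemma is_word_replicate: "is_word xs \<Longrightarrow> is_word (concat (replicate n xs))"
  by (induction n) auto

text \<open>Take a shortest nonempty word fixing g. By \<open>word_prefix\<close> every word fixing
  g is a repetition of it. Any N in the stabilizer becomes such a word up to sign after
  multiplication by enough periods.\<close>

lemma word_stabilizer_generator:
  assumes ys: "is_word ys" "ys \<noteq> []" and g: "g > 0" "moebius_map (word_mat ys) g = g"
  shows "\<exists>xs. is_word xs \<and> xs \<noteq> [] \<and> stabilizer_generator p g (word_mat xs)"
proof -
  define Q where "Q xs \<longleftrightarrow> is_word xs \<and> xs \<noteq> [] \<and> moebius_map (word_mat xs) g = g" for xs
  define xs where "xs = arg_min length Q"
  have Q: "Q xs" and min: "\<And>zs. Q zs \<Longrightarrow> length xs \<le> length zs"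
    using arg_min_nat_lemma[of Q ys length] ys g by (auto simp: xs_def Q_def)
  then have xs: "is_word xs" "xs \<noteq> []" "moebius_map (word_mat xs) g = g"
    by (auto simp: Q_def)
  have pow: "\<exists>n. zs = concat (replicate n xs)"
    if "is_word zs" "moebius_map (word_mat zs) g = g" for zs
    using that
  proof (induction zs rule: length_induct)
    case (1 zs)
    show ?case
    proof (cases "zs = []")
      case True
      then show ?thesis by (intro exI[of _ 0]) simp
    next
      case False
      then have "length xs \<le> length zs" using min 1 by (auto simp: Q_def)
      moreover obtain us where us: "zs = xs @ us \<and> moebius_map (word_mat us) g = g \<or> xs = zs @ us"
        using word_prefix[of zs xs g g] 1 xs g by auto
      ultimately have us': "zs = xs @ us" "moebius_map (word_mat us) g = g"
        using g by auto
      then have "length us < length zs" "is_word us" using xs 1 by auto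
      then obtain n where "us = concat (replicate n xs)" using 1 us' by blast
      then show ?thesis using us' by (intro exI[of _ "Suc n"]) simp
    qed
  qed
  have fx: "fixes_point (word_mat xs) g" using word_fixed_real(4)[OF xs(1,2) g(1) xs(3)] .
  have S: "word_mat xs \<in> hecke_stabilizer p g" using fx by (simp add: hecke_stabilizer_def)
  have "stabilizer_generator p g (word_mat xs)"
    unfolding hecke_stabilizer_generator_iff[OF S]
  proof
    fix N assume "N \<in> hecke_stabilizer p g"
    then have N: "N \<in> G" "moebius_map N g = g" by (auto simp: hecke_stabilizer_def fixes_point_alt)
    obtain r where r: "reduces N r" using reduces_G[OF N(1)] by blast
    define zs where "zs = concat (replicate r xs)"
    have zs: "is_word zs" "moebius_map (word_mat zs) g = g" "aut_factor (word_mat zs) g \<noteq> 0"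
      using is_word_replicate[OF xs(1)] mat_pow_fixes_point[OF fx, of r]
      by (auto simp: zs_def word_mat_replicate fixes_point_alt)
    have "length zs = r * length xs" by (simp add: zs_def length_concat sum_list_replicate)
    then have "length zs \<ge> r" using xs(2) by (cases xs) auto
    then obtain us where us: "is_word us" "eq_sign (N ** word_mat zs) (word_mat us)"
      using reduces_pos[OF r zs(1) _ g(1)] zs N g by auto
    have "moebius_map (word_mat us) g = g"
      using eq_sign_moebius[OF us(2), of g] zs N by (simp add: moebius_map_mult)
    then obtain n where "us = concat (replicate n xs)" using pow us by blast
    then show "\<exists>m n. eq_sign (N ** mat_pow (word_mat xs) m) (mat_pow (word_mat xs) n)"
      using us by (intro exI[of _ r] exI[of _ n]) (simp add: zs_def word_mat_replicate)
  qed
  then show ?thesis using xs by blast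
qed

text \<open>Every hyperbolic fixed point is equivalent to a positive purely periodic one; negative
  points are first moved by T.\<close>

lemma hyperbolic_fixed_pointsE:
  assumes "x \<in> hyperbolic_fixed_points p"
  obtains Y g ys where "Y \<in> G" "g > 0" "x = moebius_map Y g" "noncusp p g"
    "is_word ys" "ys \<noteq> []" "moebius_map (word_mat ys) g = g"
proof -
  obtain M where M: "M \<in> G" "\<bar>trace M\<bar> > 2" "fixes_point M x"
    using assms by (auto simp: hyperbolic_fixed_points_def hyperbolic_matrix_def)
  have nc: "noncusp p x" using hyperbolic_noncusp[OF M] .
  then have x0: "x \<noteq> 0" by (rule noncusp_nonzero)
  show ?thesis
  proof (cases "x > 0")
    case True
    obtain xs g ys where "is_word xs" "g > 0" "x = moebius_map (word_mat xs) g"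
      "is_word ys" "ys \<noteq> []" "moebius_map (word_mat ys) g = g"
      using hyperbolic_periodic[OF M True] .
    then show ?thesis
      using that[of "word_mat xs" g ys] word_fixed_real(5)[of ys g] by auto
  next
    case False
    define y where "y = moebius_map hecke_T x"
    have y: "y > 0" using False x0 by (simp add: y_def moebius_map_T divide_pos_neg)
    define M' where "M' = hecke_T ** M ** adj2 hecke_T"
    have M': "M' \<in> G" "\<bar>trace M'\<bar> > 2" "fixes_point M' y"
      using M trace_conj[of hecke_T M] fixes_point_conj[of hecke_T x M] x0
      unfolding M'_def y_def by (auto intro!: hecke_group_mult hecke_group_minus simp del: adj_T intro: hecke_group_adj)
    obtain xs g ys where xs: "is_word xs" "g > 0" "y = moebius_map (word_mat xs) g"
      "is_word ys" "ys \<noteq> []" "moebius_map (word_mat ys) g = g"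
      using hyperbolic_periodic[OF M' y] .
    then have "x = moebius_map (hecke_T ** word_mat xs) g"
      using word_mat_pos[of xs g] x0 by (simp add: moebius_map_mult moebius_map_T y_def field_simps flip: xs(3))
    then show ?thesis
      using that[of "hecke_T ** word_mat xs" g ys] word_fixed_real(5)[of ys g] xs by auto
  qed
qed

lemma hyperbolic_fixed_points_noncusp: "x \<in> hyperbolic_fixed_points p \<Longrightarrow> noncusp p x"
  using hyperbolic_noncusp by (auto simp: hyperbolic_fixed_points_def hyperbolic_matrix_def)

lemma stabilizer_generator_exists:
  assumes "x \<in> hyperbolic_fixed_points p"
  shows "\<exists>M. stabilizer_generator p x M \<and> \<bar>trace M\<bar> > 2"
proof -
  obtain Y g ys where g: "Y \<in> G" "g > 0" "x = moebius_map Y g" "noncusp p g"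
    "is_word ys" "ys \<noteq> []" "moebius_map (word_mat ys) g = g"
    using hyperbolic_fixed_pointsE[OF assms] .
  obtain xs where xs: "is_word xs" "xs \<noteq> []" "stabilizer_generator p g (word_mat xs)"
    using word_stabilizer_generator[OF g(5,6,2,7)] by blast
  then have "moebius_map (word_mat xs) g = g"
    by (auto simp: stabilizer_generator_def hecke_stabilizer_def fixes_point_alt)
  then have "trace (word_mat xs) > 2" using word_fixed_real(3)[OF xs(1,2) g(2)] by simp
  then show ?thesis
    using stabilizer_generator_conj[OF g(4,1) xs(3)] trace_conj[OF hecke_group_det[OF g(1)], of "word_mat xs"]
    by (auto simp: g(3))
qed

lemma hyperbolic_fixed_points_moebius:
  assumes x: "x \<in> hyperbolic_fixed_points p" and Y: "Y \<in> G"
  shows "moebius_map Y x \<in> hyperbolic_fixed_points p"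
proof -
  obtain M where M: "M \<in> G" "\<bar>trace M\<bar> > 2" "fixes_point M x"
    using assms by (auto simp: hyperbolic_fixed_points_def hyperbolic_matrix_def)
  have d: "det Y = 1" using Y hecke_group_det by auto
  have "fixes_point (Y ** M ** adj2 Y) (moebius_map Y x)"
    using fixes_point_conj[OF d _ M(3)] noncuspD[OF hyperbolic_fixed_points_noncusp[OF x] Y] by auto
  then show ?thesis
    using M Y trace_conj[OF d, of M] unfolding hyperbolic_fixed_points_def hyperbolic_matrix_def
    by (intro CollectI bexI[of _ "Y ** M ** adj2 Y"] conjI) auto
qed

end

section \<open>Ideals of \<open>\<int>[\<lambda>\<^sub>p]\<close>\<close>

abbreviation real_ring :: "real ring" where
  "real_ring \<equiv> ring_of_type_algebra"

lemma hecke_ring_ops: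
  "x \<otimes>\<^bsub>hecke_ring p\<^esub> y = x * y" "x \<oplus>\<^bsub>hecke_ring p\<^esub> y = x + y"
  "\<one>\<^bsub>hecke_ring p\<^esub> = 1" "\<zero>\<^bsub>hecke_ring p\<^esub> = 0"
  by (simp_all add: hecke_ring_def ring_of_type_algebra_def)

lemma real_ring_minus: "\<ominus>\<^bsub>real_ring\<^esub> x = - x"
proof -
  interpret R: ring real_ring by (rule ring_from_type_algebra)
  show ?thesis
    by (rule R.minus_equality) (simp_all add: ring_of_type_algebra_def)
qed

definition hecke_ints :: "nat \<Rightarrow> real set" where
  "hecke_ints p = carrier (hecke_ring p)"

lemma cring_hecke_ring: "cring (hecke_ring p)"
proof -
  interpret R: ring real_ring by (rule ring_from_type_algebra)
  have "ring (hecke_ring p)"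
    unfolding hecke_ring_def
    by (rule R.generate_ring_is_ring) (simp add: ring_of_type_algebra_def)
  then show ?thesis
    by (intro cring.intro monoid.monoid_comm_monoidI[OF ring.axioms(2)]) (auto simp: hecke_ring_ops)
qed

lemma hecke_ints_closed [simp, intro]:
  "1 \<in> hecke_ints p" "0 \<in> hecke_ints p" "hecke_lambda p \<in> hecke_ints p"
  "x \<in> hecke_ints p \<Longrightarrow> y \<in> hecke_ints p \<Longrightarrow> x + y \<in> hecke_ints p"
  "x \<in> hecke_ints p \<Longrightarrow> y \<in> hecke_ints p \<Longrightarrow> x * y \<in> hecke_ints p"
  "x \<in> hecke_ints p \<Longrightarrow> - x \<in> hecke_ints p"
proof -
  have eq: "hecke_ints p = generate_ring real_ring {hecke_lambda p}"
    by (simp add: hecke_ints_def hecke_ring_def)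
  show 1: "1 \<in> hecke_ints p"
    using generate_ring.one[of real_ring] by (simp add: eq) (simp add: ring_of_type_algebra_def)
  show add: "x \<in> hecke_ints p \<Longrightarrow> y \<in> hecke_ints p \<Longrightarrow> x + y \<in> hecke_ints p" for x y
    using generate_ring.eng_add[of x real_ring _ y] by (simp add: eq) (simp add: ring_of_type_algebra_def)
  show "x \<in> hecke_ints p \<Longrightarrow> y \<in> hecke_ints p \<Longrightarrow> x * y \<in> hecke_ints p"
    using generate_ring.eng_mult[of x real_ring _ y] by (simp add: eq) (simp add: ring_of_type_algebra_def)
  show m: "x \<in> hecke_ints p \<Longrightarrow> - x \<in> hecke_ints p" for x
    using generate_ring.a_inv[of x real_ring] by (simp add: eq real_ring_minus)
  show "0 \<in> hecke_ints p"
    using add[OF 1 m[OF 1]] by simp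
  show "hecke_lambda p \<in> hecke_ints p"
    unfolding eq by (rule generate_ring.incl) simp
qed

lemma hecke_ints_diff [simp, intro]:
  "x \<in> hecke_ints p \<Longrightarrow> y \<in> hecke_ints p \<Longrightarrow> x - y \<in> hecke_ints p"
  using hecke_ints_closed(4)[of x p "- y"] by simp

lemma hecke_ints_power [simp, intro]: "x \<in> hecke_ints p \<Longrightarrow> x ^ n \<in> hecke_ints p"
  by (induction n) auto

lemma hecke_ints_numeral [simp]: "2 \<in> hecke_ints p"
  using hecke_ints_closed(4)[of 1 p 1] by simp

text \<open>The ideal generated by three elements, written out. It makes sense for arbitrary real
  generators, so inclusions between such sets carry no membership side conditions.\<close>

definition span3 :: "nat \<Rightarrow> real \<Rightarrow> real \<Rightarrow> real \<Rightarrow> real set" where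
  "span3 p a b c = {r * a + s * b + t * c | r s t. r \<in> hecke_ints p \<and> s \<in> hecke_ints p \<and> t \<in> hecke_ints p}"

lemma span3I:
  "r \<in> hecke_ints p \<Longrightarrow> s \<in> hecke_ints p \<Longrightarrow> t \<in> hecke_ints p \<Longrightarrow> x = r * a + s * b + t * c \<Longrightarrow> x \<in> span3 p a b c"
  by (auto simp: span3_def)

lemma span3E:
  assumes "x \<in> span3 p a b c"
  obtains r s t where "r \<in> hecke_ints p" "s \<in> hecke_ints p" "t \<in> hecke_ints p" "x = r * a + s * b + t * c"
  using assms by (auto simp: span3_def)

lemma span3_add:
  assumes "x \<in> span3 p a b c" "y \<in> span3 p a b c"
  shows "x + y \<in> span3 p a b c"
proof -
  obtain r s t r' s' t' where "r \<in> hecke_ints p" "s \<in> hecke_ints p" "t \<in> hecke_ints p" "x = r * a + s * b + t * c"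
    "r' \<in> hecke_ints p" "s' \<in> hecke_ints p" "t' \<in> hecke_ints p" "y = r' * a + s' * b + t' * c"
    using assms span3E by metis
  then show ?thesis
    by (intro span3I[of "r + r'" p "s + s'" "t + t'"]) (auto simp: algebra_simps)
qed

lemma span3_mult:
  assumes "x \<in> span3 p a b c" "u \<in> hecke_ints p"
  shows "u * x \<in> span3 p a b c"
proof -
  obtain r s t where "r \<in> hecke_ints p" "s \<in> hecke_ints p" "t \<in> hecke_ints p" "x = r * a + s * b + t * c"
    using assms span3E by metis
  then show ?thesis using assms(2)
    by (intro span3I[of "u * r" p "u * s" "u * t"]) (auto simp: algebra_simps)
qed

lemma span3_mult_right:
  "x \<in> span3 p a b c \<Longrightarrow> u \<in> hecke_ints p \<Longrightarrow> x * u \<in> span3 p a b c"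
  using span3_mult[of x p a b c u] by (simp add: mult.commute)

lemma span3_subset:
  assumes "x \<in> span3 p a b c" "y \<in> span3 p a b c" "z \<in> span3 p a b c"
  shows "span3 p x y z \<subseteq> span3 p a b c"
proof
  fix w assume "w \<in> span3 p x y z"
  then obtain r s t where "r \<in> hecke_ints p" "s \<in> hecke_ints p" "t \<in> hecke_ints p" "w = r * x + s * y + t * z"
    by (rule span3E)
  then show "w \<in> span3 p a b c"
    using assms by (simp add: span3_add span3_mult)
qed

lemma span3_gens: "a \<in> span3 p a b c" "b \<in> span3 p a b c" "c \<in> span3 p a b c"
  by (rule span3I[of 1 p 0 0], simp_all) (rule span3I[of 0 p 1 0], simp_all, rule span3I[of 0 p 0 1], simp_all)

lemma span3_hecke_ints:
  "a \<in> hecke_ints p \<Longrightarrow> b \<in> hecke_ints p \<Longrightarrow> c \<in> hecke_ints p \<Longrightarrow> span3 p a b c \<subseteq> hecke_ints p"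
  by (auto elim!: span3E)

lemma Idl_eq_span3:
  assumes "a \<in> hecke_ints p" "b \<in> hecke_ints p" "c \<in> hecke_ints p"
  shows "Idl\<^bsub>hecke_ring p\<^esub> {a, b, c} = span3 p a b c"
proof -
  interpret R: cring "hecke_ring p" by (rule cring_hecke_ring)
  have sub: "span3 p a b c \<subseteq> carrier (hecke_ring p)"
    using span3_hecke_ints[OF assms] by (simp add: hecke_ints_def)
  have minus: "\<ominus>\<^bsub>hecke_ring p\<^esub> x = - x" if "x \<in> hecke_ints p" for x
    using that hecke_ints_closed(6)[OF that]
    by (intro R.minus_equality) (simp_all add: hecke_ring_ops hecke_ints_def)
  have "subgroup (span3 p a b c) (add_monoid (hecke_ring p))"
  proof (rule R.add.subgroupI)
    show "span3 p a b c \<noteq> {}" using span3_gens by blast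
    fix x assume x: "x \<in> span3 p a b c"
    then have "x \<in> hecke_ints p" using sub by (auto simp: hecke_ints_def)
    then show "\<ominus>\<^bsub>hecke_ring p\<^esub> x \<in> span3 p a b c"
      using span3_mult[OF x, of "-1"] minus by auto
  qed (use sub span3_add in \<open>auto simp: hecke_ring_ops\<close>)
  then have id: "ideal (span3 p a b c) (hecke_ring p)"
    by (intro idealI R.ring_axioms)
      (auto simp: hecke_ring_ops span3_mult span3_mult_right hecke_ints_def[symmetric])
  show ?thesis
  proof
    show "Idl\<^bsub>hecke_ring p\<^esub> {a, b, c} \<subseteq> span3 p a b c"
      using R.genideal_minimal[OF id] span3_gens by auto
    have carr: "{a, b, c} \<subseteq> carrier (hecke_ring p)" using assms by (simp add: hecke_ints_def)
    interpret I: ideal "Idl\<^bsub>hecke_ring p\<^esub> {a, b, c}" "hecke_ring p"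
      by (rule R.genideal_ideal[OF carr])
    have in3: "a \<in> Idl\<^bsub>hecke_ring p\<^esub> {a, b, c}" "b \<in> Idl\<^bsub>hecke_ring p\<^esub> {a, b, c}" "c \<in> Idl\<^bsub>hecke_ring p\<^esub> {a, b, c}"
      using R.genideal_self[OF carr] by auto
    show "span3 p a b c \<subseteq> Idl\<^bsub>hecke_ring p\<^esub> {a, b, c}"
    proof
      fix x assume "x \<in> span3 p a b c"
      then obtain r s t where r: "r \<in> hecke_ints p" "s \<in> hecke_ints p" "t \<in> hecke_ints p" "x = r * a + s * b + t * c"
        by (rule span3E)
      then have "r * a \<in> Idl\<^bsub>hecke_ring p\<^esub> {a, b, c}" "s * b \<in> Idl\<^bsub>hecke_ring p\<^esub> {a, b, c}" "t * c \<in> Idl\<^bsub>hecke_ring p\<^esub> {a, b, c}"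
        using I.I_l_closed[OF in3(1), of r] I.I_l_closed[OF in3(2), of s] I.I_l_closed[OF in3(3), of t]
        by (simp_all add: hecke_ring_ops hecke_ints_def)
      then have "r * a + s * b + t * c \<in> Idl\<^bsub>hecke_ring p\<^esub> {a, b, c}"
        using I.a_closed by (simp add: hecke_ring_ops)
      then show "x \<in> Idl\<^bsub>hecke_ring p\<^esub> {a, b, c}" using r by simp
    qed
  qed
qed

lemma PIdl_hecke_ring: "PIdl\<^bsub>hecke_ring p\<^esub> g = {r * g | r. r \<in> hecke_ints p}"
  by (simp add: cgenideal_def hecke_ring_ops hecke_ints_def)

text \<open>Some generator exists in a principal ideal domain, and h and -h generate the same ideal,
  so the choice of a positive one is not vacuous.\<close>

lemma ideal_generator:
  assumes abc: "a \<in> hecke_ints p" "b \<in> hecke_ints p" "c \<in> hecke_ints p" and nz: "a \<noteq> 0"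
  defines "g \<equiv> ideal_generator p (span3 p a b c)"
  shows "g > 0" "principal_domain (hecke_ring p) \<Longrightarrow> g \<in> hecke_ints p \<and> span3 p a b c = {r * g | r. r \<in> hecke_ints p}"
proof -
  have *: "g > 0 \<and> g \<in> hecke_ints p \<and> span3 p a b c = {r * g | r. r \<in> hecke_ints p}"
    if pid: "principal_domain (hecke_ring p)"
  proof -
    interpret R: principal_domain "hecke_ring p" by (rule pid)
    have "ideal (span3 p a b c) (hecke_ring p)"
      unfolding Idl_eq_span3[OF abc, symmetric]
      using abc by (intro R.genideal_ideal) (auto simp: hecke_ints_def)
    from R.exists_gen[OF this] obtain h where h: "h \<in> hecke_ints p" "span3 p a b c = {r * h | r. r \<in> hecke_ints p}"
      unfolding PIdl_hecke_ring hecke_ints_def by blast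
    have h0: "h \<noteq> 0" using h(2) span3_gens(1)[of a p b c] nz by auto
    have sub: "{r * h | r. r \<in> hecke_ints p} \<subseteq> {r * (- h) | r. r \<in> hecke_ints p}" for h
    proof
      fix x assume "x \<in> {r * h | r. r \<in> hecke_ints p}"
      then obtain r where "r \<in> hecke_ints p" "x = r * h" by blast
      then show "x \<in> {r * (- h) | r. r \<in> hecke_ints p}"
        by (intro CollectI exI[of _ "- r"]) simp
    qed
    have mh: "{r * h | r. r \<in> hecke_ints p} = {r * (- h) | r. r \<in> hecke_ints p}"
      using sub[of h] sub[of "- h"] unfolding minus_minus by (rule subset_antisym)
    have "\<exists>g. g \<in> carrier (hecke_ring p) \<and> g > 0 \<and> span3 p a b c = PIdl\<^bsub>hecke_ring p\<^esub> g"
      unfolding PIdl_hecke_ring hecke_ints_def[symmetric]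
    proof (cases "h > 0")
      case True then show "\<exists>g. g \<in> hecke_ints p \<and> g > 0 \<and> span3 p a b c = {r * g | r. r \<in> hecke_ints p}"
        using h by blast
    next
      case False then show "\<exists>g. g \<in> hecke_ints p \<and> g > 0 \<and> span3 p a b c = {r * g | r. r \<in> hecke_ints p}"
        using h h0 mh by (intro exI[of _ "- h"]) auto
    qed
    from someI_ex[OF this] show ?thesis
      using pid unfolding g_def ideal_generator_def PIdl_hecke_ring hecke_ints_def[symmetric] by simp
  qed
  then show "principal_domain (hecke_ring p) \<Longrightarrow> g \<in> hecke_ints p \<and> span3 p a b c = {r * g | r. r \<in> hecke_ints p}"
    by blast
  show "g > 0" using * by (cases "principal_domain (hecke_ring p)") (auto simp: g_def ideal_generator_def)
qed

lemma hecke_group_entries: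
  "M \<in> hecke_group p \<Longrightarrow> M$1$1 \<in> hecke_ints p \<and> M$1$2 \<in> hecke_ints p \<and> M$2$1 \<in> hecke_ints p \<and> M$2$2 \<in> hecke_ints p"
  by (induction M rule: hecke_group_induct) (auto simp: hecke_S_def)

section \<open>Hyperbolic forms\<close>

text \<open>The form of the fixed point equation: its roots are the fixed points of M.\<close>

definition form_of :: "real^2^2 \<Rightarrow> bqf" where
  "form_of M = BQF (M$2$1) (M$2$2 - M$1$1) (- (M$1$2))"

definition scale_form :: "real \<Rightarrow> bqf \<Rightarrow> bqf" where
  "scale_form r Q = BQF (r * coeff_A Q) (r * coeff_B Q) (r * coeff_C Q)"

lemma form_of_sel [simp]:
  "coeff_A (form_of M) = M$2$1" "coeff_B (form_of M) = M$2$2 - M$1$1" "coeff_C (form_of M) = - (M$1$2)"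
  by (simp_all add: form_of_def)

lemma scale_form_sel [simp]:
  "coeff_A (scale_form r Q) = r * coeff_A Q" "coeff_B (scale_form r Q) = r * coeff_B Q"
  "coeff_C (scale_form r Q) = r * coeff_C Q"
  by (simp_all add: scale_form_def)

text \<open>Conjugation of matrices is substitution in fixed point forms; hence the equivariance of
  the attached forms.\<close>

lemma form_of_conj: "form_of (adj2 Y ** M ** Y) = bqf_act (form_of M) Y"
  unfolding bqf_act_def Let_def form_of_def bqf.sel bqf.inject matrix_mult_nth2 adj2_nth power2_eq_square
  by (intro conjI) (simp_all only: ring_distribs mult_ac add_ac mult_2 mult_minus_left mult_minus_right
    diff_conv_add_uminus minus_add_distrib minus_minus add.right_inverse add_0_left add_0_right
    minus_add_cancel add_minus_cancel)

lemma bqf_act_scale: "bqf_act (scale_form r Q) Y = scale_form r (bqf_act Q Y)"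
  by (simp add: scale_form_def bqf_act_def Let_def algebra_simps)

lemma bqf_act_mult: "bqf_act (bqf_act Q A) B = bqf_act Q (A ** B)"
  unfolding bqf_act_def Let_def bqf.sel bqf.inject matrix_mult_nth2 power2_eq_square
  by (intro conjI) (simp_all only: ring_distribs mult_ac add_ac mult_2 mult_2_right)

lemma bqf_act_one [simp]: "bqf_act Q (mat 1) = Q"
  by (simp add: bqf_act_def)

definition form_ideal :: "nat \<Rightarrow> bqf \<Rightarrow> real set" where
  "form_ideal p Q = span3 p (coeff_A Q) (coeff_B Q) (coeff_C Q)"

lemma form_ideal_act_subset:
  assumes "Y \<in> hecke_group p"
  shows "form_ideal p (bqf_act Q Y) \<subseteq> form_ideal p Q"
proof -
  have e: "Y$1$1 \<in> hecke_ints p" "Y$1$2 \<in> hecke_ints p" "Y$2$1 \<in> hecke_ints p" "Y$2$2 \<in> hecke_ints p"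
    using hecke_group_entries[OF assms] by auto
  define a b c d where abcd: "a = Y$1$1" "b = Y$1$2" "c = Y$2$1" "d = Y$2$2"
  show ?thesis unfolding form_ideal_def
  proof (rule span3_subset)
    show "coeff_A (bqf_act Q Y) \<in> span3 p (coeff_A Q) (coeff_B Q) (coeff_C Q)"
      by (rule span3I[of "a\<^sup>2" p "a * c" "c\<^sup>2"]) (use e in \<open>simp_all add: bqf_act_def Let_def abcd mult_ac\<close>)
    show "coeff_B (bqf_act Q Y) \<in> span3 p (coeff_A Q) (coeff_B Q) (coeff_C Q)"
      by (rule span3I[of "2 * a * b" p "a * d + b * c" "2 * c * d"]) (use e in \<open>simp_all add: bqf_act_def Let_def abcd mult_ac\<close>)
    show "coeff_C (bqf_act Q Y) \<in> span3 p (coeff_A Q) (coeff_B Q) (coeff_C Q)"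
      by (rule span3I[of "b\<^sup>2" p "b * d" "d\<^sup>2"]) (use e in \<open>simp_all add: bqf_act_def Let_def abcd mult_ac\<close>)
  qed
qed

text \<open>Acting by the inverse supplies the second inclusion. Equivalent forms are therefore
  divided by the same chosen generator.\<close>

lemma form_ideal_act:
  assumes "Y \<in> hecke_group p"
  shows "form_ideal p (bqf_act Q Y) = form_ideal p Q"
proof
  show "form_ideal p (bqf_act Q Y) \<subseteq> form_ideal p Q" by (rule form_ideal_act_subset[OF assms])
  have "form_ideal p (bqf_act (bqf_act Q Y) (adj2 Y)) \<subseteq> form_ideal p (bqf_act Q Y)"
    using assms by (intro form_ideal_act_subset) auto
  then show "form_ideal p Q \<subseteq> form_ideal p (bqf_act Q Y)"
    using hecke_group_det[OF assms] by (simp add: bqf_act_mult)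
qed

lemma form_ideal_minus: "form_ideal p (scale_form (-1) Q) = form_ideal p Q"
proof -
  have *: "form_ideal p (scale_form (-1) Q) \<subseteq> form_ideal p Q" for Q
    unfolding form_ideal_def scale_form_sel
    using span3_mult[OF span3_gens(1), of "-1"] span3_mult[OF span3_gens(2), of "-1"] span3_mult[OF span3_gens(3), of "-1"]
    by (intro span3_subset) auto
  have "scale_form (-1) (scale_form (-1) Q) = Q" by (cases Q) (simp add: scale_form_def)
  then show ?thesis using *[of Q] *[of "scale_form (-1) Q"] by auto
qed

text \<open>A branch-free version of the attached form. Passing from M to -M or to the inverse flips
  both the sign factor and \<open>form_of M\<close>, so the result is the same for all generators of
  the stabilizer.\<close>

definition normalized_form :: "nat \<Rightarrow> real \<Rightarrow> real^2^2 \<Rightarrow> bqf" where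
  "normalized_form p x M =
     scale_form (sgn (aut_factor M x - 1 / aut_factor M x) / ideal_generator p (form_ideal p (form_of M))) (form_of M)"

lemma form_of_minus: "form_of (- M) = scale_form (-1) (form_of M)"
  by (simp add: form_of_def scale_form_def)

lemma form_of_adj: "form_of (adj2 M) = scale_form (-1) (form_of M)"
  by (simp add: form_of_def scale_form_def)

lemma normalized_form_minus: "normalized_form p x (- M) = normalized_form p x M"
  unfolding normalized_form_def form_of_minus form_ideal_minus
  by (simp add: scale_form_def sgn_if)

lemma normalized_form_adj:
  assumes "det M = 1" "fixes_point M x"
  shows "normalized_form p x (adj2 M) = normalized_form p x M"
proof -
  have "aut_factor (adj2 M) x = 1 / aut_factor M x"
    using aut_factor_adj[OF assms(1), of x] assms(2) by (simp add: fixes_point_alt)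
  then show ?thesis
    unfolding normalized_form_def form_of_adj form_ideal_minus
    by (simp add: scale_form_def sgn_if)
qed

lemma four_less_square:
  fixes t :: real
  assumes "\<bar>t\<bar> > 2"
  shows "t\<^sup>2 - 4 > 0"
proof -
  have "2 * 2 < \<bar>t\<bar> * \<bar>t\<bar>"
    using assms by (intro mult_strict_mono) auto
  then show ?thesis by (simp add: power2_eq_square)
qed

section \<open>The form attached to a hyperbolic fixed point\<close>

context hecke
begin

lemma hyperbolic_lower_left_nonzero:
  assumes "M \<in> G" "\<bar>trace M\<bar> > 2"
  shows "M$2$1 \<noteq> 0"
  using upper_triangular_in_G[OF assms(1)] assms(2) by (auto simp: trace2 power2_eq_1_iff)

lemma aut_factor_diff_inverse:
  assumes "det M = 1" "fixes_point M x"
  shows "aut_factor M x - 1 / aut_factor M x = 2 * M$2$1 * x + (M$2$2 - M$1$1)"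
  using trace_fixes_point[OF assms] by (simp add: trace2 aut_factor_def)

lemma aut_factor_diff_inverse_sq:
  assumes "det M = 1" "fixes_point M x"
  shows "(aut_factor M x - 1 / aut_factor M x)\<^sup>2 = (M$1$1 + M$2$2)\<^sup>2 - 4"
proof -
  have "aut_factor M x \<noteq> 0" using assms(2) by (simp add: fixes_point_alt)
  moreover have "M$1$1 + M$2$2 = aut_factor M x + 1 / aut_factor M x"
    using trace_fixes_point[OF assms] by (simp add: trace2)
  moreover have "(u - v)\<^sup>2 = (u + v)\<^sup>2 - 4 * (u * v)" for u v :: real
    by (simp add: power2_eq_square algebra_simps)
  ultimately show ?thesis by simp
qed

text \<open>A verbatim copy of the condition under \<open>THE\<close> in
  \<open>hyperbolic_form\<close>, so that \<open>hyperbolic_form_alt\<close> is mere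
  unfolding.\<close>

definition attached_form :: "real \<Rightarrow> real^2^2 \<Rightarrow> bqf \<Rightarrow> bool" where
  "attached_form x M Q \<longleftrightarrow>
     (let a = M$1$1; b = M$1$2; c = M$2$1; d = M$2$2;
        g = ideal_generator p (Idl\<^bsub>hecke_ring p\<^esub> {c, d - a, - b});
        s = sqrt ((a + d)\<^sup>2 - 4)
      in x = (a - d + s) / (2 * c) \<and> Q = BQF (c / g) ((d - a) / g) (- b / g) \<or>
         x = (a - d - s) / (2 * c) \<and> Q = BQF (- (c / g)) (- ((d - a) / g)) (- (- b / g)))"

lemma hyperbolic_form_alt:
  "hyperbolic_form p x = (THE Q. \<exists>M. stabilizer_generator p x M \<and> attached_form x M Q)"
  unfolding hyperbolic_form_def attached_form_def ..

text \<open>The two branches in the definition of \<open>hyperbolic_form\<close> are distinguished by the sign of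
  \<open>2c\<alpha> + d - a = j - 1/j\<close>, where \<open>j = c\<alpha> + d\<close>.\<close>
lemma attached_form_iff:
  assumes M: "M \<in> G" "\<bar>trace M\<bar> > 2" "fixes_point M x"
  shows "attached_form x M Q \<longleftrightarrow> Q = normalized_form p x M"
proof -
  define a b c d where abcd: "a = M$1$1" "b = M$1$2" "c = M$2$1" "d = M$2$2"
  define s where "s = sqrt ((a + d)\<^sup>2 - 4)"
  define g where "g = ideal_generator p (Idl\<^bsub>hecke_ring p\<^esub> {c, d - a, - b})"
  define w where "w = aut_factor M x - 1 / aut_factor M x"
  have dM: "det M = 1" using M hecke_group_det by auto
  have c: "c \<noteq> 0" using hyperbolic_lower_left_nonzero[OF M(1,2)] by (simp add: abcd)
  have e: "c \<in> hecke_ints p" "d - a \<in> hecke_ints p" "- b \<in> hecke_ints p"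
    using hecke_group_entries[OF M(1)] by (auto simp: abcd)
  have g: "g = ideal_generator p (form_ideal p (form_of M))"
    unfolding g_def Idl_eq_span3[OF e] by (simp add: form_ideal_def abcd)
  have w: "w = 2 * c * x + (d - a)" "w\<^sup>2 = (a + d)\<^sup>2 - 4"
    using aut_factor_diff_inverse[OF dM M(3)] aut_factor_diff_inverse_sq[OF dM M(3)]
    by (simp_all add: abcd w_def)
  have "w \<noteq> 0" using w(2) four_less_square[OF M(2)] by (auto simp: trace2 abcd)
  have s: "s = \<bar>w\<bar>" unfolding s_def w(2)[symmetric] by simp
  have div: "x = u / (2 * c) \<longleftrightarrow> 2 * c * x = u" for u
    using c by (auto simp: field_simps)
  have "2 * c * x = a - d + s \<longleftrightarrow> w = \<bar>w\<bar>" "2 * c * x = a - d - s \<longleftrightarrow> w = - \<bar>w\<bar>"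
    using w(1) s by (intro iffI; linarith)+
  then have x1: "x = (a - d + s) / (2 * c) \<longleftrightarrow> w > 0" "x = (a - d - s) / (2 * c) \<longleftrightarrow> w < 0"
    unfolding div using \<open>w \<noteq> 0\<close> by (auto simp: abs_if)
  have "normalized_form p x M = (if w > 0 then BQF (c / g) ((d - a) / g) (- b / g)
      else BQF (- (c / g)) (- ((d - a) / g)) (- (- b / g)))"
    using \<open>w \<noteq> 0\<close> unfolding normalized_form_def g[symmetric] w_def[symmetric]
    by (cases "w > 0") (simp_all add: scale_form_def form_of_def abcd flip: minus_divide_left)
  then show ?thesis
    unfolding attached_form_def Let_def abcd[symmetric] s_def[symmetric] g_def[symmetric] x1 using \<open>w \<noteq> 0\<close> by auto
qed

text \<open>Evaluates the \<open>THE\<close>: up to sign every generator is M or its inverse, and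
  all of them have the same normalized form.\<close>

lemma hyperbolic_form_eq:
  assumes M: "stabilizer_generator p x M" "\<bar>trace M\<bar> > 2"
  shows "hyperbolic_form p x = normalized_form p x M"
proof -
  have gen: "normalized_form p x N = normalized_form p x M \<and> N \<in> G \<and> \<bar>trace N\<bar> > 2 \<and> fixes_point N x"
    if N: "stabilizer_generator p x N" for N
  proof -
    have NG: "N \<in> G" "fixes_point N x" "det N = 1"
      using N hecke_group_det by (auto simp: stabilizer_generator_def hecke_stabilizer_def)
    have "M = N \<or> M = - N \<or> M = adj2 N \<or> M = - adj2 N"
      using stabilizer_generator_unique[OF M(1) N M(2)] by (auto simp: eq_sign_def)
    then show ?thesis
      using NG M(2) normalized_form_minus normalized_form_adj[OF NG(3,2)] by (auto simp: trace2)
  qed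
  have "attached_form x N Q \<longleftrightarrow> Q = normalized_form p x M" if "stabilizer_generator p x N" for N Q
    using gen[OF that] attached_form_iff[of N x Q] by simp
  then have "(\<exists>N. stabilizer_generator p x N \<and> attached_form x N Q) \<longleftrightarrow> Q = normalized_form p x M" for Q
    using M(1) by blast
  then show ?thesis
    unfolding hyperbolic_form_alt by simp
qed

lemma hyperbolicE:
  assumes "x \<in> hyperbolic_fixed_points p"
  obtains M where "stabilizer_generator p x M" "\<bar>trace M\<bar> > 2" "M \<in> G" "det M = 1" "fixes_point M x"
    "hyperbolic_form p x = normalized_form p x M"
proof -
  obtain M where M: "stabilizer_generator p x M" "\<bar>trace M\<bar> > 2"
    using stabilizer_generator_exists[OF assms] by blast
  then have "M \<in> G" "fixes_point M x"
    by (auto simp: stabilizer_generator_def hecke_stabilizer_def)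
  then show ?thesis using that M hyperbolic_form_eq[OF M] hecke_group_det by auto
qed

lemma form_generator:
  assumes "M \<in> G" "\<bar>trace M\<bar> > 2"
  shows "ideal_generator p (form_ideal p (form_of M)) > 0"
    "principal_domain (hecke_ring p) \<Longrightarrow> ideal_generator p (form_ideal p (form_of M)) \<in> hecke_ints p \<and>
      form_ideal p (form_of M) = {r * ideal_generator p (form_ideal p (form_of M)) | r. r \<in> hecke_ints p}"
proof -
  have e: "M$2$1 \<in> hecke_ints p" "M$2$2 - M$1$1 \<in> hecke_ints p" "- (M$1$2) \<in> hecke_ints p"
    using hecke_group_entries[OF assms(1)] by auto
  note * = ideal_generator[OF e hyperbolic_lower_left_nonzero[OF assms]]
  show "ideal_generator p (form_ideal p (form_of M)) > 0"
    "principal_domain (hecke_ring p) \<Longrightarrow> ideal_generator p (form_ideal p (form_of M)) \<in> hecke_ints p \<and>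
      form_ideal p (form_of M) = {r * ideal_generator p (form_ideal p (form_of M)) | r. r \<in> hecke_ints p}"
    unfolding form_ideal_def form_of_sel by (rule *)+
qed

lemma hyperbolic_form_props:
  assumes x: "x \<in> hyperbolic_fixed_points p"
  shows "coeff_A (hyperbolic_form p x) \<noteq> 0" "discriminant (hyperbolic_form p x) > 0"
    "2 * coeff_A (hyperbolic_form p x) * x + coeff_B (hyperbolic_form p x) = sqrt (discriminant (hyperbolic_form p x))"
    "coeff_A (hyperbolic_form p x) * x\<^sup>2 + coeff_B (hyperbolic_form p x) * x + coeff_C (hyperbolic_form p x) = 0"
proof -
  obtain M where M: "\<bar>trace M\<bar> > 2" "M \<in> G" "det M = 1" "fixes_point M x"
    "hyperbolic_form p x = normalized_form p x M"
    using hyperbolicE[OF x] by metis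
  define w where "w = aut_factor M x - 1 / aut_factor M x"
  define g where "g = ideal_generator p (form_ideal p (form_of M))"
  have g: "g > 0" using form_generator(1)[OF M(2,1)] by (simp add: g_def)
  have w: "w = 2 * M$2$1 * x + (M$2$2 - M$1$1)" "w\<^sup>2 = (M$1$1 + M$2$2)\<^sup>2 - 4"
    using aut_factor_diff_inverse[OF M(3,4)] aut_factor_diff_inverse_sq[OF M(3,4)] by (simp_all add: w_def)
  have w0: "w \<noteq> 0" using w(2) four_less_square[OF M(1)] by (auto simp: trace2)
  have c: "M$2$1 \<noteq> 0" using hyperbolic_lower_left_nonzero[OF M(2,1)] .
  have sel: "coeff_A (hyperbolic_form p x) = sgn w / g * M$2$1"
    "coeff_B (hyperbolic_form p x) = sgn w / g * (M$2$2 - M$1$1)"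
    "coeff_C (hyperbolic_form p x) = sgn w / g * - (M$1$2)"
    unfolding M(5) normalized_form_def g_def[symmetric] w_def[symmetric] by simp_all
  show "coeff_A (hyperbolic_form p x) \<noteq> 0" using w0 g c by (simp add: sel sgn_zero_iff)
  \<comment> \<open>Before scaling, the discriminant is trace^2 - 4 = (j + 1/j)^2 - 4, the square of
    w = j - 1/j.\<close>
  have "discriminant (hyperbolic_form p x) = (sgn w / g)\<^sup>2 * ((M$2$2 - M$1$1)\<^sup>2 + 4 * (M$2$1 * M$1$2))"
    unfolding discriminant_def sel by (simp add: power2_eq_square algebra_simps)
  also have "(M$2$2 - M$1$1)\<^sup>2 + 4 * (M$2$1 * M$1$2) = w\<^sup>2"
    unfolding w(2) using det_eq_1D[OF M(3)] by (simp add: power2_eq_square algebra_simps)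
  also have "(sgn w / g)\<^sup>2 * w\<^sup>2 = (\<bar>w\<bar> / g)\<^sup>2"
  proof -
    have "(sgn w)\<^sup>2 = 1" using w0 by (cases "w > 0") simp_all
    then show ?thesis by (simp add: power_divide)
  qed
  finally have D: "discriminant (hyperbolic_form p x) = (\<bar>w\<bar> / g)\<^sup>2" .
  then show "discriminant (hyperbolic_form p x) > 0" using w0 g by simp
  have "sgn w * w = \<bar>w\<bar>" by (simp add: sgn_if)
  then have "sgn w / g * (2 * M$2$1 * x + (M$2$2 - M$1$1)) = \<bar>w\<bar> / g" using w(1) by simp
  then show "2 * coeff_A (hyperbolic_form p x) * x + coeff_B (hyperbolic_form p x) = sqrt (discriminant (hyperbolic_form p x))"
    unfolding sel D using g by (simp add: algebra_simps)
  have "sgn w / g * (M$2$1 * x\<^sup>2 + (M$2$2 - M$1$1) * x - M$1$2) = 0"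
    using fixes_point_quadratic[OF M(4)] by simp
  then show "coeff_A (hyperbolic_form p x) * x\<^sup>2 + coeff_B (hyperbolic_form p x) * x + coeff_C (hyperbolic_form p x) = 0"
    unfolding sel by (simp add: algebra_simps)
qed

text \<open>Vieta's formulas for the roots x and x' of the attached form.\<close>

lemma conjugate_props:
  assumes x: "x \<in> hyperbolic_fixed_points p"
  defines "Q \<equiv> hyperbolic_form p x" and "x' \<equiv> hecke_conjugate p x"
  shows "coeff_A Q * (x - x') = sqrt (discriminant Q)" "coeff_B Q = - coeff_A Q * (x + x')"
    "coeff_C Q = coeff_A Q * (x * x')" "x' \<noteq> x" "eval_bqf Q z 1 = of_real (coeff_A Q) * ((z - of_real x) * (z - of_real x'))"
proof -
  note h = hyperbolic_form_props[OF x, folded Q_def]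
  have x': "2 * coeff_A Q * x' = - coeff_B Q - sqrt (discriminant Q)"
    using h(1) by (simp add: x'_def hecke_conjugate_def Q_def[symmetric])
  show 1: "coeff_A Q * (x - x') = sqrt (discriminant Q)" using x' h(3) by (simp add: algebra_simps)
  show 2: "coeff_B Q = - coeff_A Q * (x + x')" using x' h(3) by (simp add: algebra_simps)
  show 3: "coeff_C Q = coeff_A Q * (x * x')" using h(4) unfolding 2 by (simp add: algebra_simps power2_eq_square)
  show "x' \<noteq> x" using 1 h(2) by auto
  show "eval_bqf Q z 1 = of_real (coeff_A Q) * ((z - of_real x) * (z - of_real x'))"
    unfolding eval_bqf_def 2 3 by (simp add: algebra_simps power2_eq_square)
qed

text \<open>The attached form is a nonzero multiple of the fixed point form of M, so its roots are
  exactly the fixed points of M.\<close>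

lemma conjugate_fixes_point:
  assumes x: "x \<in> hyperbolic_fixed_points p" and M: "M \<in> G" "\<bar>trace M\<bar> > 2" "fixes_point M x"
    "hyperbolic_form p x = normalized_form p x M"
  shows "fixes_point M (hecke_conjugate p x)"
    "\<And>y. fixes_point M y \<Longrightarrow> y = x \<or> y = hecke_conjugate p x"
proof -
  define x' where "x' = hecke_conjugate p x"
  define r where "r = sgn (aut_factor M x - 1 / aut_factor M x) / ideal_generator p (form_ideal p (form_of M))"
  have sel: "coeff_A (hyperbolic_form p x) = r * M$2$1"
    "coeff_B (hyperbolic_form p x) = r * (M$2$2 - M$1$1)"
    "coeff_C (hyperbolic_form p x) = r * - (M$1$2)"
    unfolding M(4) normalized_form_def r_def[symmetric] by simp_all
  have r: "r \<noteq> 0" using hyperbolic_form_props(1)[OF x] by (auto simp: sel)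
  have dM: "det M = 1" using M hecke_group_det by auto
  have "r * (M$2$2 - M$1$1) = r * (- M$2$1 * (x + x'))" "r * - (M$1$2) = r * (M$2$1 * (x * x'))"
    using conjugate_props(2,3)[OF x] by (simp_all add: sel x'_def algebra_simps)
  then have e: "M$2$2 - M$1$1 = - M$2$1 * (x + x')" "- (M$1$2) = M$2$1 * (x * x')"
    by (simp_all only: mult_left_cancel[OF r])
  have "M$2$1 * y\<^sup>2 + (M$2$2 - M$1$1) * y + - (M$1$2) = M$2$1 * ((y - x) * (y - x'))" for y
    unfolding e by (simp add: algebra_simps power2_eq_square)
  then have q: "M$2$1 * y\<^sup>2 + (M$2$2 - M$1$1) * y - M$1$2 = M$2$1 * ((y - x) * (y - x'))" for y
    by simp
  have c: "M$2$1 \<noteq> 0" using hyperbolic_lower_left_nonzero[OF M(1,2)] .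
  show "y = x \<or> y = hecke_conjugate p x" if "fixes_point M y" for y
    using fixes_point_quadratic[OF that] c unfolding q x'_def by simp
  have d: "M$2$2 = M$1$1 - M$2$1 * (x + x')" "M$1$2 = - M$2$1 * (x * x')" using e by (simp_all add: algebra_simps)
  \<comment> \<open>The two factors are the two eigenvalues of M, with product det M.\<close>
  have "aut_factor M x * aut_factor M x' = 1"
    using det_eq_1D[OF dM] unfolding aut_factor_def d by (simp add: algebra_simps power2_eq_square)
  then have "aut_factor M x' \<noteq> 0" by auto
  then show "fixes_point M (hecke_conjugate p x)"
    unfolding x'_def[symmetric] by (rule fixes_pointI) (simp add: q)
qed

lemma conjugate_hyperbolic:
  assumes x: "x \<in> hyperbolic_fixed_points p"
  shows "hecke_conjugate p x \<in> hyperbolic_fixed_points p"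
proof -
  obtain M where M: "\<bar>trace M\<bar> > 2" "M \<in> G" "det M = 1" "fixes_point M x"
    "hyperbolic_form p x = normalized_form p x M"
    using hyperbolicE[OF x] by metis
  then show ?thesis
    using conjugate_fixes_point(1)[OF x M(2,1,4,5)]
    by (auto simp: hyperbolic_fixed_points_def hyperbolic_matrix_def)
qed

text \<open>Up to sign every element of the stabilizer is a quotient of powers of the generator,
  which fixes x'.\<close>

lemma stabilizer_fixes_conjugate:
  assumes x: "x \<in> hyperbolic_fixed_points p" and N: "N \<in> hecke_stabilizer p x"
  shows "fixes_point N (hecke_conjugate p x)"
proof -
  obtain M where M: "stabilizer_generator p x M" "\<bar>trace M\<bar> > 2" "M \<in> G" "det M = 1" "fixes_point M x"
    "hyperbolic_form p x = normalized_form p x M"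
    using hyperbolicE[OF x] .
  define x' where "x' = hecke_conjugate p x"
  have f: "fixes_point M x'" using conjugate_fixes_point(1)[OF x M(3,2,5,6)] by (simp add: x'_def)
  have NG: "N \<in> G" using N by (simp add: hecke_stabilizer_def)
  have nc: "noncusp p x'"
    using hyperbolic_fixed_points_noncusp[OF conjugate_hyperbolic[OF x]] by (simp add: x'_def)
  obtain m n where mn: "eq_sign (N ** mat_pow M m) (mat_pow M n)"
    using M(1) N hecke_stabilizer_generator_iff[of M p x] by (auto simp: stabilizer_generator_def)
  have "moebius_map N x' = moebius_map (N ** mat_pow M m) x'"
    using mat_pow_fixes_point[OF f, of m] moebius_map_mult[of "mat_pow M m" x' N] f by (simp add: fixes_point_alt)
  also have "\<dots> = x'"
    using eq_sign_moebius[OF mn, of x'] mat_pow_fixes_point[OF f, of n] by (simp add: fixes_point_alt)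
  finally show ?thesis using noncuspD[OF nc NG] by (simp add: fixes_point_alt x'_def)
qed

text \<open>Conjugation by Y carries a generator for x to one for Y x, and sign factor and ideal are
  unchanged. The conjugate of Y x must then be Y x', the other fixed point of the conjugated
  generator.\<close>

lemma hyperbolic_form_moebius:
  assumes x: "x \<in> hyperbolic_fixed_points p" and Y: "Y \<in> G"
  shows "hyperbolic_form p x = bqf_act (hyperbolic_form p (moebius_map Y x)) Y"
    "hecke_conjugate p (moebius_map Y x) = moebius_map Y (hecke_conjugate p x)"
proof -
  obtain M where M: "stabilizer_generator p x M" "\<bar>trace M\<bar> > 2" "M \<in> G" "det M = 1" "fixes_point M x"
    "hyperbolic_form p x = normalized_form p x M"
    using hyperbolicE[OF x] .
  define K where "K = Y ** M ** adj2 Y"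
  have dY: "det Y = 1" using Y hecke_group_det by auto
  have nc: "noncusp p x" using hyperbolic_fixed_points_noncusp[OF x] .
  have nz: "aut_factor Y x \<noteq> 0" using noncuspD[OF nc Y] .
  have K: "stabilizer_generator p (moebius_map Y x) K" "\<bar>trace K\<bar> > 2"
    using stabilizer_generator_conj[OF nc Y M(1)] M(2) trace_conj[OF dY] by (auto simp: K_def)
  have KG: "K \<in> G" using Y M by (simp add: K_def)
  have fK: "fixes_point K (moebius_map Y x)"
    using K by (simp add: stabilizer_generator_def hecke_stabilizer_def)
  have K': "hyperbolic_form p (moebius_map Y x) = normalized_form p (moebius_map Y x) K"
    using hyperbolic_form_eq[OF K] .
  have MK: "M = adj2 Y ** K ** Y"
    using dY by (simp add: K_def matrix_mul_assoc) (simp flip: matrix_mul_assoc)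
  \<comment> \<open>Both sides are the eigenvalue belonging to the fixed point, a conjugation
    invariant.\<close>
  have af: "aut_factor K (moebius_map Y x) = aut_factor M x"
  proof -
    have e: "aut_factor (adj2 Y) (moebius_map Y x) = 1 / aut_factor Y x" "moebius_map (adj2 Y) (moebius_map Y x) = x"
      using aut_factor_adj[OF dY nz] moebius_map_adj[OF dY nz] by auto
    have "aut_factor (M ** adj2 Y) (moebius_map Y x) = aut_factor M x / aut_factor Y x"
      using e nz by (simp add: aut_factor_mult)
    moreover have "aut_factor M x \<noteq> 0" "moebius_map M x = x" using M(5) by (auto simp: fixes_point_alt)
    ultimately show ?thesis
      unfolding K_def using e nz
      by (simp add: aut_factor_mult moebius_map_mult flip: matrix_mul_assoc)
  qed
  have fo: "form_of M = bqf_act (form_of K) Y"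
    unfolding MK by (rule form_of_conj)
  show "hyperbolic_form p x = bqf_act (hyperbolic_form p (moebius_map Y x)) Y"
    unfolding M(6) K' normalized_form_def af fo form_ideal_act[OF Y] bqf_act_scale ..
  have x': "hecke_conjugate p x \<in> hyperbolic_fixed_points p" using conjugate_hyperbolic[OF x] .
  have nz': "aut_factor Y (hecke_conjugate p x) \<noteq> 0"
    using noncuspD[OF hyperbolic_fixed_points_noncusp[OF x'] Y] .
  have "fixes_point M (hecke_conjugate p x)"
    using conjugate_fixes_point(1)[OF x M(3,2,5,6)] .
  then have "fixes_point K (moebius_map Y (hecke_conjugate p x))"
    unfolding K_def by (rule fixes_point_conj[OF dY nz'])
  moreover have "moebius_map Y (hecke_conjugate p x) \<noteq> moebius_map Y x"
    using moebius_map_inj[OF dY nz' nz] conjugate_props(4)[OF x] by blast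
  ultimately show "hecke_conjugate p (moebius_map Y x) = moebius_map Y (hecke_conjugate p x)"
    using conjugate_fixes_point(2)[OF hyperbolic_fixed_points_moebius[OF x Y] KG K(2) fK K'] by metis
qed

text \<open>Primitivity: the generator g is itself a combination of the coefficients, and dividing
  that combination by g represents 1.\<close>

lemma hyperbolic_form_in_lambda_bqfs:
  assumes x: "x \<in> hyperbolic_fixed_points p"
  shows "hyperbolic_form p x \<in> lambda_bqfs p"
proof -
  obtain M where M: "\<bar>trace M\<bar> > 2" "M \<in> G" "det M = 1" "fixes_point M x"
    "hyperbolic_form p x = normalized_form p x M"
    using hyperbolicE[OF x] by metis
  define w where "w = aut_factor M x - 1 / aut_factor M x"
  define g where "g = ideal_generator p (form_ideal p (form_of M))"
  define I where "I = form_ideal p (form_of M)"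
  note gen = form_generator[OF M(2,1), folded g_def I_def]
  define a b c where abc: "a = M$2$1" "b = M$2$2 - M$1$1" "c = - (M$1$2)"
  have e: "a \<in> hecke_ints p" "b \<in> hecke_ints p" "c \<in> hecke_ints p"
    using hecke_group_entries[OF M(2)] by (auto simp: abc)
  have I: "I = span3 p a b c" by (simp add: I_def form_ideal_def abc)
  have sel: "coeff_A (hyperbolic_form p x) = sgn w / g * a"
    "coeff_B (hyperbolic_form p x) = sgn w / g * b"
    "coeff_C (hyperbolic_form p x) = sgn w / g * c"
    unfolding M(5) normalized_form_def g_def[symmetric] w_def[symmetric] by (simp_all add: abc)
  have w0: "sgn w \<noteq> 0" using hyperbolic_form_props(1)[OF x] by (auto simp: sel)
  then have sw: "sgn w \<in> hecke_ints p" "sgn w * sgn w = 1"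
    using hecke_ints_closed(6)[of 1 p] by (auto simp: sgn_if split: if_splits)
  have cl: "sgn w / g * y \<in> hecke_ints p" if y: "y \<in> {a, b, c}" for y
  proof (cases "principal_domain (hecke_ring p)")
    case True
    have "y \<in> I" using y span3_gens[where p=p and a=a and b=b and c=c] by (auto simp: I)
    then obtain r where "r \<in> hecke_ints p" "y = r * g" using gen(2)[OF True] by auto
    then show ?thesis using sw gen(1) by simp
  next
    case False
    then have "g = 1" by (simp add: g_def ideal_generator_def)
    then show ?thesis using sw e y by auto
  qed
  have one: "1 \<in> span3 p (sgn w / g * a) (sgn w / g * b) (sgn w / g * c)" if P: "principal_domain (hecke_ring p)"
  proof -
    have "g \<in> I" using gen(2)[OF P] by (auto intro!: exI[of _ 1])
    then obtain r s t where r: "r \<in> hecke_ints p" "s \<in> hecke_ints p" "t \<in> hecke_ints p" "g = r * a + s * b + t * c"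
      unfolding I by (rule span3E)
    have "(sgn w * r) * (sgn w / g * a) + (sgn w * s) * (sgn w / g * b) + (sgn w * t) * (sgn w / g * c) =
      (sgn w * sgn w) * (r * a + s * b + t * c) / g"
      by (simp add: algebra_simps add_divide_distrib)
    also have "\<dots> = 1" using gen(1) sw r(4) by simp
    finally show ?thesis
      using sw r by (intro span3I[of "sgn w * r" p "sgn w * s" "sgn w * t"]) auto
  qed
  have span: "span3 p (sgn w / g * a) (sgn w / g * b) (sgn w / g * c) = hecke_ints p"
    if P: "principal_domain (hecke_ring p)"
  proof
    show "span3 p (sgn w / g * a) (sgn w / g * b) (sgn w / g * c) \<subseteq> hecke_ints p"
      by (intro span3_hecke_ints cl) auto
    show "hecke_ints p \<subseteq> span3 p (sgn w / g * a) (sgn w / g * b) (sgn w / g * c)"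
      using span3_mult[OF one[OF P]] by auto
  qed
  have clABC: "coeff_A (hyperbolic_form p x) \<in> hecke_ints p" "coeff_B (hyperbolic_form p x) \<in> hecke_ints p"
    "coeff_C (hyperbolic_form p x) \<in> hecke_ints p"
    unfolding sel using cl by blast+
  show ?thesis
    unfolding lambda_bqfs_def mem_Collect_eq Idl_eq_span3[OF clABC] using clABC hyperbolic_form_props(2)[OF x] span[folded sel]
    by (simp add: hecke_ints_def[symmetric])
qed

lemma equiv_bqf_equivalence: "equiv (lambda_bqfs p) (bqf_equivalence p)"
proof (rule equivI)
  show "bqf_equivalence p \<subseteq> lambda_bqfs p \<times> lambda_bqfs p" by (auto simp: bqf_equivalence_def)
  show "refl_on (lambda_bqfs p) (bqf_equivalence p)"
    by (auto simp: refl_on_def bqf_equivalence_def intro!: bexI[of _ "mat 1"])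
  show "sym (bqf_equivalence p)"
  proof (rule symI)
    fix Q R assume "(Q, R) \<in> bqf_equivalence p"
    then obtain Y where "Y \<in> G" "R = bqf_act Q Y" "Q \<in> lambda_bqfs p" "R \<in> lambda_bqfs p"
      by (auto simp: bqf_equivalence_def)
    moreover from this have "Q = bqf_act R (adj2 Y)"
      using hecke_group_det[of Y p] by (simp add: bqf_act_mult)
    ultimately show "(R, Q) \<in> bqf_equivalence p"
      unfolding bqf_equivalence_def by blast
  qed
  show "trans (bqf_equivalence p)"
  proof (rule transI)
    fix Q R S assume "(Q, R) \<in> bqf_equivalence p" "(R, S) \<in> bqf_equivalence p"
    then obtain Y Z where "Y \<in> G" "R = bqf_act Q Y" "Z \<in> G" "S = bqf_act R Z" "Q \<in> lambda_bqfs p" "S \<in> lambda_bqfs p"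
      by (auto simp: bqf_equivalence_def)
    moreover from this have "S = bqf_act Q (Y ** Z)" by (simp add: bqf_act_mult)
    ultimately show "(Q, S) \<in> bqf_equivalence p"
      unfolding bqf_equivalence_def by blast
  qed
qed

section \<open>Hyperbolic classes as orbits, and their cycles\<close>

definition form_class :: "real \<Rightarrow> bqf set" where
  "form_class x = bqf_equivalence p `` {hyperbolic_form p x}"

lemma hyperbolic_form_inj:
  assumes "x \<in> hyperbolic_fixed_points p" "y \<in> hyperbolic_fixed_points p"
    "hyperbolic_form p x = hyperbolic_form p y"
  shows "x = y"
  using hyperbolic_form_props[OF assms(1)] hyperbolic_form_props[OF assms(2)] assms(3)
  by (metis add_right_cancel mult_cancel_left mult_eq_0_iff zero_neq_numeral)

text \<open>Substituting Y into a form moves its root by the inverse of Y.\<close>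

lemma hyperbolic_form_act:
  assumes "x \<in> hyperbolic_fixed_points p" "Y \<in> G"
  shows "bqf_act (hyperbolic_form p x) Y = hyperbolic_form p (moebius_map (adj2 Y) x)"
proof -
  have d: "det Y = 1" using assms hecke_group_det by auto
  have nz: "aut_factor (adj2 Y) x \<noteq> 0"
    using noncuspD[OF hyperbolic_fixed_points_noncusp[OF assms(1)] hecke_group_adj[OF assms(2)]] .
  have "moebius_map Y (moebius_map (adj2 Y) x) = x"
    using moebius_map_adj[of "adj2 Y" x] d nz by simp
  then show ?thesis
    using hyperbolic_form_moebius(1)[OF hyperbolic_fixed_points_moebius[OF assms(1) hecke_group_adj[OF assms(2)]] assms(2)]
    by simp
qed

lemma hyperbolic_class_form_class:
  assumes "x \<in> hyperbolic_fixed_points p"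
  shows "hyperbolic_class p (form_class x)"
  unfolding hyperbolic_class_def
proof
  show "form_class x \<in> lambda_bqfs p // bqf_equivalence p"
    unfolding form_class_def by (rule quotientI[OF hyperbolic_form_in_lambda_bqfs[OF assms]])
  show "form_class x \<subseteq> hyperbolic_forms p"
    using hyperbolic_form_act[OF assms] hyperbolic_fixed_points_moebius[OF assms hecke_group_adj]
    by (auto simp: form_class_def bqf_equivalence_def hyperbolic_forms_def)
qed

lemma in_form_class_iff:
  assumes "x \<in> hyperbolic_fixed_points p" "y \<in> hyperbolic_fixed_points p"
  shows "hyperbolic_form p y \<in> form_class x \<longleftrightarrow> (\<exists>Y\<in>G. y = moebius_map Y x)"
proof
  assume "hyperbolic_form p y \<in> form_class x"
  then obtain Y where Y: "Y \<in> G" "hyperbolic_form p y = bqf_act (hyperbolic_form p x) Y"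
    by (auto simp: form_class_def bqf_equivalence_def)
  then have "y = moebius_map (adj2 Y) x"
    using hyperbolic_form_act[OF assms(1) Y(1)] hyperbolic_fixed_points_moebius[OF assms(1) hecke_group_adj[OF Y(1)]]
    by (intro hyperbolic_form_inj assms) auto
  then show "\<exists>Y\<in>G. y = moebius_map Y x" using Y by blast
next
  assume "\<exists>Y\<in>G. y = moebius_map Y x"
  then obtain Y where Y: "Y \<in> G" "y = moebius_map Y x" by blast
  then have "hyperbolic_form p y = bqf_act (hyperbolic_form p x) (adj2 Y)"
    using hyperbolic_form_act[OF assms(1) hecke_group_adj[OF Y(1)]] by simp
  then show "hyperbolic_form p y \<in> form_class x"
    using Y hyperbolic_form_in_lambda_bqfs assms unfolding form_class_def bqf_equivalence_def by blast
qed

lemma form_class_eq: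
  assumes "x \<in> hyperbolic_fixed_points p" "y \<in> hyperbolic_fixed_points p" "hyperbolic_form p y \<in> form_class x"
  shows "form_class y = form_class x"
  using equiv_class_eq[OF equiv_bqf_equivalence] assms(3) unfolding form_class_def by blast

lemma self_in_form_class:
  assumes "x \<in> hyperbolic_fixed_points p"
  shows "hyperbolic_form p x \<in> form_class x"
  using in_form_class_iff[OF assms assms] by (auto intro!: bexI[of _ "mat 1"])

text \<open>A (x - x') = sqrt D is positive, so A has the sign of x - x'; moreover C = A x x'. Hence
  A > 0 > C means that the roots have opposite signs and x is the larger one.\<close>

lemma simple_iff:
  assumes x: "x \<in> hyperbolic_fixed_points p"
  shows "simple_bqf (hyperbolic_form p x) \<longleftrightarrow> x > 0 \<and> hecke_conjugate p x < 0"
proof -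
  define A where "A = coeff_A (hyperbolic_form p x)"
  define x' where "x' = hecke_conjugate p x"
  have 1: "A * (x - x') > 0" "coeff_C (hyperbolic_form p x) = A * (x * x')"
    using conjugate_props(1,3)[OF x] hyperbolic_form_props(2)[OF x] by (auto simp: A_def x'_def)
  have "A > 0 \<and> A * (x * x') < 0 \<longleftrightarrow> x > x' \<and> x * x' < 0"
  proof (cases "A > 0")
    case True
    then show ?thesis using 1(1) by (simp add: zero_less_mult_iff mult_less_0_iff[of A])
  next
    case False
    then have "x - x' < 0" using 1(1) by (simp add: zero_less_mult_iff)
    then show ?thesis using False by simp
  qed
  also have "\<dots> \<longleftrightarrow> x > 0 \<and> x' < 0"
    unfolding mult_less_0_iff by (cases "x > 0"; cases "x' > 0") auto
  finally show ?thesis by (simp add: simple_bqf_def 1 A_def x'_def)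
qed

text \<open>Describes the cycle through the orbits of x and x', the shape required by
  \<open>orbit_pole\<close>.\<close>

lemma pole_cycle_form_class:
  assumes x: "x \<in> hyperbolic_fixed_points p"
  shows "y \<in> pole_cycle p (form_class x) \<longleftrightarrow>
    (\<exists>Y\<in>G. y = moebius_map Y x \<and> moebius_map Y x > 0 \<and> moebius_map Y (hecke_conjugate p x) < 0)"
proof -
  have "y \<in> pole_cycle p (form_class x) \<longleftrightarrow> y \<in> hyperbolic_fixed_points p \<and>
      (\<exists>Y\<in>G. y = moebius_map Y x) \<and> y > 0 \<and> hecke_conjugate p y < 0"
    unfolding pole_cycle_def mem_Collect_eq using in_form_class_iff[OF x, of y] simple_iff[of y] by blast
  also have "\<dots> \<longleftrightarrow> (\<exists>Y\<in>G. y = moebius_map Y x \<and> y > 0 \<and> hecke_conjugate p y < 0)"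
    using hyperbolic_fixed_points_moebius[OF x] by blast
  also have "\<dots> \<longleftrightarrow>
    (\<exists>Y\<in>G. y = moebius_map Y x \<and> moebius_map Y x > 0 \<and> moebius_map Y (hecke_conjugate p x) < 0)"
    by (rule bex_cong[OF refl]) (auto simp: hyperbolic_form_moebius(2)[OF x])
  finally show ?thesis .
qed

text \<open>The product of the two fixed points is minus the quotient of the off-diagonal entries of
  the word, both positive by \<open>word_fixed_real\<close>.\<close>

lemma word_fixed_conjugate_neg:
  assumes xs: "is_word xs" "xs \<noteq> []" and x: "x > 0" "moebius_map (word_mat xs) x = x"
  shows "x \<in> hyperbolic_fixed_points p" "hecke_conjugate p x < 0"
proof -
  note w = word_fixed_real[OF xs x]
  show h: "x \<in> hyperbolic_fixed_points p"
    unfolding hyperbolic_fixed_points_def hyperbolic_matrix_def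
    using w by (intro CollectI bexI[of _ "word_mat xs"] conjI) auto
  define x' where "x' = hecke_conjugate p x"
  have "fixes_point (word_mat xs) x'"
    unfolding x'_def using w(4) by (intro stabilizer_fixes_conjugate[OF h]) (simp add: hecke_stabilizer_def)
  note q = fixes_point_quadratic[OF this] fixes_point_quadratic[OF w(4)]
  define a b c where abc: "a = word_mat xs $ 2 $ 1" "b = word_mat xs $ 2 $ 2 - word_mat xs $ 1 $ 1" "c = word_mat xs $ 1 $ 2"
  have q1: "a * x\<^sup>2 + b * x = c" "a * x'\<^sup>2 + b * x' = c" using q by (simp_all add: abc)
  have "(x - x') * (a * (x + x') + b) = (a * x\<^sup>2 + b * x) - (a * x'\<^sup>2 + b * x')"
    by (simp add: algebra_simps power2_eq_square)
  also have "\<dots> = 0" using q1 by simp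
  finally have "a * (x + x') + b = 0" using conjugate_props(4)[OF h] by (auto simp: x'_def)
  then have b: "b = - a * (x + x')" by simp
  have "c = - (a * x) * x'" using q1(1) unfolding b by (simp add: algebra_simps power2_eq_square)
  moreover have "c > 0" "a > 0" using w by (auto simp: abc)
  ultimately have "(a * x) * x' < 0" "a * x > 0" using x(1) by simp_all
  then show "hecke_conjugate p x < 0"
    unfolding x'_def[symmetric] by (metis mult_less_0_iff not_less_iff_gr_or_eq)
qed

end

section \<open>Local behaviour of rational functions\<close>

text \<open>A finite limit in the punctured neighbourhood: for a rational function this says that a
  is not a pole, whatever the value at a.\<close>

definition regular :: "(complex \<Rightarrow> complex) \<Rightarrow> complex \<Rightarrow> bool" where
  "regular f a \<longleftrightarrow> (\<exists>l. (f \<longlongrightarrow> l) (at a))"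

lemma regularI: "(f \<longlongrightarrow> l) (at a) \<Longrightarrow> regular f a"
  by (auto simp: regular_def)

lemma regular_add: "regular f a \<Longrightarrow> regular g a \<Longrightarrow> regular (\<lambda>z. f z + g z) a"
  unfolding regular_def by (blast intro: tendsto_add)

lemma regular_diff: "regular f a \<Longrightarrow> regular g a \<Longrightarrow> regular (\<lambda>z. f z - g z) a"
  unfolding regular_def by (blast intro: tendsto_diff)

lemma regular_mult: "regular f a \<Longrightarrow> regular g a \<Longrightarrow> regular (\<lambda>z. f z * g z) a"
  unfolding regular_def by (blast intro: tendsto_mult)

lemma regular_minus: "regular f a \<Longrightarrow> regular (\<lambda>z. - f z) a"
  unfolding regular_def by (blast intro: tendsto_minus)

lemma regular_cmult: "regular f a \<Longrightarrow> regular (\<lambda>z. c * f z) a"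
  by (rule regular_mult) (auto simp: regular_def)

lemma regular_sum: "(\<And>i. i \<in> A \<Longrightarrow> regular (f i) a) \<Longrightarrow> regular (\<lambda>z. \<Sum>i\<in>A. f i z) a"
proof (induction A rule: infinite_finite_induct)
  case (insert x F)
  then have "regular (\<lambda>z. f x z + (\<Sum>i\<in>F. f i z)) a" by (intro regular_add) auto
  then show ?case using insert by simp
qed (auto simp: regular_def)

lemma regular_isCont: "isCont f a \<Longrightarrow> regular f a"
  unfolding regular_def isCont_def by blast

lemma regular_cong:
  assumes "\<forall>\<^sub>F z in at a. f z = g z" "regular f a"
  shows "regular g a"
  using assms unfolding regular_def by (metis Lim_transform_eventually)

lemma eventually_at_cofinite: "eventually P cofinite \<Longrightarrow> eventually P (at (a :: complex))"
proof -
  assume "eventually P cofinite"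
  then have "finite ({z. \<not> P z} - {a})" by (simp add: eventually_cofinite)
  then have "open (- ({z. \<not> P z} - {a}))" by (intro open_Compl finite_imp_closed)
  then show ?thesis
    unfolding eventually_at_topological by (intro exI[of _ "- ({z. \<not> P z} - {a})"]) auto
qed

lemma eventually_at_infinity_cofinite: "eventually P cofinite \<Longrightarrow> eventually P (at_infinity :: complex filter)"
proof -
  assume "eventually P cofinite"
  then have "finite {z. \<not> P z}" by (simp add: eventually_cofinite)
  then have "bounded {z. \<not> P z}" by (rule finite_imp_bounded)
  then obtain B where B: "\<And>z. \<not> P z \<Longrightarrow> norm z \<le> B" unfolding bounded_iff by blast
  show ?thesis unfolding eventually_at_infinity
    by (rule exI[of _ "B + 1"]) (use B in force)
qed

lemma eventually_aut_factor_nonzero: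
  fixes a :: complex
  assumes "aut_factor M a \<noteq> 0"
  shows "\<forall>\<^sub>F z in at a. aut_factor M z \<noteq> 0"
proof -
  have "(aut_factor M \<longlongrightarrow> aut_factor M a) (at a)"
    unfolding aut_factor_def by (intro tendsto_intros)
  then show ?thesis using assms by (rule tendsto_imp_eventually_ne)
qed

lemma filterlim_moebius_map:
  fixes a :: complex
  assumes "det M = 1" "aut_factor M a \<noteq> 0"
  shows "filterlim (moebius_map M) (at (moebius_map M a)) (at a)"
  unfolding filterlim_at
proof
  have "(moebius_map M \<longlongrightarrow> moebius_map M a) (at a)"
    using assms(2) unfolding moebius_map_alt aut_factor_def by (intro tendsto_intros)
  moreover have "\<forall>\<^sub>F z in at a. z \<noteq> a"
    by (simp add: eventually_at_filter)
  then have "\<forall>\<^sub>F z in at a. moebius_map M z \<in> UNIV \<and> moebius_map M z \<noteq> moebius_map M a"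
    using eventually_aut_factor_nonzero[OF assms(2)]
  proof eventually_elim
    case (elim z)
    then show ?case using moebius_map_inj[OF assms(1) elim(2) assms(2)] by blast
  qed
  ultimately show "(moebius_map M \<longlongrightarrow> moebius_map M a) (at a)"
    "\<forall>\<^sub>F z in at a. moebius_map M z \<in> UNIV \<and> moebius_map M z \<noteq> moebius_map M a" .
qed

lemma slash_alt: "slash k f M z = f (moebius_map M z) / aut_factor M z ^ (2 * k)"
  by (simp add: slash_def aut_factor_def)

lemma regular_slash:
  assumes "det M = 1" "aut_factor M a \<noteq> 0" "regular f (moebius_map M a)"
  shows "regular (slash k f M) a"
proof -
  obtain l where "(f \<longlongrightarrow> l) (at (moebius_map M a))" using assms(3) by (auto simp: regular_def)
  then have 1: "((\<lambda>z. f (moebius_map M z)) \<longlongrightarrow> l) (at a)"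
    by (rule filterlim_compose[OF _ filterlim_moebius_map[OF assms(1,2)]])
  have 2: "(aut_factor M \<longlongrightarrow> aut_factor M a) (at a)"
    unfolding aut_factor_def by (intro tendsto_intros)
  have "(slash k f M \<longlongrightarrow> l / aut_factor M a ^ (2 * k)) (at a)"
    unfolding slash_alt using assms(2) by (intro tendsto_divide tendsto_power 1 2) auto
  then show ?thesis by (rule regularI)
qed

lemma rational_functionI:
  "Q \<noteq> 0 \<Longrightarrow> (\<And>z. poly Q z \<noteq> 0 \<Longrightarrow> f z = poly P z / poly Q z) \<Longrightarrow> rational_function f"
  unfolding rational_function_def by blast

lemma rational_add:
  assumes "rational_function f" "rational_function g"
  shows "rational_function (\<lambda>z. f z + g z)"
proof -
  obtain P Q R S where "Q \<noteq> 0" "\<forall>z. poly Q z \<noteq> 0 \<longrightarrow> f z = poly P z / poly Q z"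
    "S \<noteq> 0" "\<forall>z. poly S z \<noteq> 0 \<longrightarrow> g z = poly R z / poly S z"
    using assms unfolding rational_function_def by blast
  then show ?thesis
    by (intro rational_functionI[of "Q * S" _ "P * S + R * Q"]) (auto simp: field_simps)
qed

lemma rational_mult:
  assumes "rational_function f" "rational_function g"
  shows "rational_function (\<lambda>z. f z * g z)"
proof -
  obtain P Q R S where "Q \<noteq> 0" "\<forall>z. poly Q z \<noteq> 0 \<longrightarrow> f z = poly P z / poly Q z"
    "S \<noteq> 0" "\<forall>z. poly S z \<noteq> 0 \<longrightarrow> g z = poly R z / poly S z"
    using assms unfolding rational_function_def by blast
  then show ?thesis
    by (intro rational_functionI[of "Q * S" _ "P * R"]) auto
qed

lemma rational_poly: "rational_function (poly P)"
  by (rule rational_functionI[of 1 _ P]) auto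

lemma rational_const: "rational_function (\<lambda>_. c)"
  by (rule rational_functionI[of 1 _ "[:c:]"]) auto

lemma rational_diff:
  assumes "rational_function f" "rational_function g"
  shows "rational_function (\<lambda>z. f z - g z)"
  using rational_add[OF assms(1) rational_mult[OF rational_const[of "-1"] assms(2)]] by simp

lemma rational_sum: "(\<And>i. i \<in> A \<Longrightarrow> rational_function (f i)) \<Longrightarrow> rational_function (\<lambda>z. \<Sum>i\<in>A. f i z)"
proof (induction A rule: infinite_finite_induct)
  case (insert x F)
  then have "rational_function (\<lambda>z. f x z + (\<Sum>i\<in>F. f i z))" by (intro rational_add) auto
  then show ?case using insert by simp
qed (auto simp: rational_const)

lemma rational_poly_inverse: "rational_function (\<lambda>z. poly P (1 / (z - a)))"
proof (induction P)
  case 0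
  show ?case by (simp add: rational_const)
next
  case (pCons c P)
  have "rational_function (\<lambda>z. 1 / (z - a))"
    by (rule rational_functionI[of "[:- a, 1:]" _ 1]) auto
  then have "rational_function (\<lambda>z. c + 1 / (z - a) * poly P (1 / (z - a)))"
    by (intro rational_add rational_mult rational_const pCons)
  then show ?case by simp
qed

lemma rational_finitely_nonregular:
  assumes "rational_function f"
  shows "finite {a. \<not> regular f a}"
proof -
  obtain P Q where Q: "Q \<noteq> 0" "\<And>z. poly Q z \<noteq> 0 \<Longrightarrow> f z = poly P z / poly Q z"
    using assms unfolding rational_function_def by blast
  have "regular f a" if "poly Q a \<noteq> 0" for a
  proof (rule regular_cong)
    show "regular (\<lambda>z. poly P z / poly Q z) a"
      using that by (intro regular_isCont continuous_intros) auto
    have "\<forall>\<^sub>F z in cofinite. poly Q z \<noteq> 0"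
      using poly_roots_finite[OF Q(1)] by (simp add: eventually_cofinite)
    then have "\<forall>\<^sub>F z in at a. poly Q z \<noteq> 0" by (rule eventually_at_cofinite)
    then show "\<forall>\<^sub>F z in at a. poly P z / poly Q z = f z"
      by eventually_elim (simp add: Q(2))
  qed
  then have "{a. \<not> regular f a} \<subseteq> {a. poly Q a = 0}" by auto
  then show ?thesis using poly_roots_finite[OF Q(1)] finite_subset by blast
qed

text \<open>At a root of Q the finite limit of P/Q forces P to vanish too. Cancelling the common
  linear factor lowers the degree of Q.\<close>

lemma regular_quotient_poly:
  fixes P Q :: "complex poly"
  assumes "Q \<noteq> 0" "\<And>a. regular (\<lambda>z. poly P z / poly Q z) a"
  shows "\<exists>R. \<forall>z. poly Q z \<noteq> 0 \<longrightarrow> poly P z / poly Q z = poly R z"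
  using assms
proof (induction "Polynomial.degree Q" arbitrary: P Q rule: less_induct)
  case less
  show ?case
  proof (cases "Polynomial.degree Q = 0")
    case True
    then obtain c where "Q = [:c:]" by (meson degree_eq_zeroE)
    then show ?thesis
      by (intro exI[of _ "[:1 / c:] * P"]) simp
  next
    case False
    then have "\<not> constant (poly Q)" by (simp add: constant_degree)
    then obtain a where a: "poly Q a = 0" using fundamental_theorem_of_algebra by blast
    obtain l where l: "((\<lambda>z. poly P z / poly Q z) \<longlongrightarrow> l) (at a)"
      using less.prems(2)[of a] by (auto simp: regular_def)
    have cof: "\<forall>\<^sub>F z in cofinite. poly Q z \<noteq> 0"
      using poly_roots_finite[OF less.prems(1)] by (simp add: eventually_cofinite)
    have Pa: "(poly P \<longlongrightarrow> poly P a) (at a)" and Qa: "(poly Q \<longlongrightarrow> 0) (at a)"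
      using poly_isCont[of a P] poly_isCont[of a Q] a by (auto simp: isCont_def)
    have "((\<lambda>z. poly P z / poly Q z * poly Q z) \<longlongrightarrow> l * 0) (at a)"
      by (rule tendsto_mult[OF l Qa])
    moreover have "\<forall>\<^sub>F z in at a. poly P z / poly Q z * poly Q z = poly P z"
      using eventually_at_cofinite[OF cof] by eventually_elim simp
    ultimately have "(poly P \<longlongrightarrow> l * 0) (at a)"
      by (rule Lim_transform_eventually)
    then have "poly P a = 0"
      using tendsto_unique[OF _ Pa] by auto
    then obtain P' where P': "P = [:- a, 1:] * P'" by (auto simp: poly_eq_0_iff_dvd)
    obtain Q' where Q': "Q = [:- a, 1:] * Q'" using a by (auto simp: poly_eq_0_iff_dvd)
    have Q'0: "Q' \<noteq> 0" using Q' less.prems by auto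
    have deg: "Polynomial.degree Q' < Polynomial.degree Q"
      unfolding Q' using Q'0 by (subst degree_mult_eq) auto
    have fac: "poly P z = (z - a) * poly P' z" "poly Q z = (z - a) * poly Q' z" for z
      by (simp_all add: P' Q' algebra_simps)
    have quot: "poly P z / poly Q z = poly P' z / poly Q' z" if "poly Q z \<noteq> 0" for z
      using that unfolding fac by (intro mult_divide_mult_cancel_left) auto
    have "regular (\<lambda>z. poly P' z / poly Q' z) b" for b
    proof (rule regular_cong[OF _ less.prems(2)[of b]])
      have "\<forall>\<^sub>F z in at b. poly Q z \<noteq> 0" using eventually_at_cofinite[OF cof] .
      then show "\<forall>\<^sub>F z in at b. poly P z / poly Q z = poly P' z / poly Q' z"
        by eventually_elim (rule quot)
    qed
    from less.hyps[OF deg Q'0 this] obtain R where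
      R: "\<And>z. poly Q' z \<noteq> 0 \<Longrightarrow> poly P' z / poly Q' z = poly R z" by blast
    show ?thesis
    proof (intro exI[of _ R] allI impI)
      fix z assume z: "poly Q z \<noteq> 0"
      then have "poly Q' z \<noteq> 0" unfolding fac by simp
      then show "poly P z / poly Q z = poly R z" using quot[OF z] R by simp
    qed
  qed
qed

lemma rational_regular_imp_poly:
  assumes "rational_function f" "\<And>a. regular f a"
  shows "\<exists>R. \<forall>\<^sub>F z in cofinite. f z = poly R z"
proof -
  obtain P Q where Q: "Q \<noteq> 0" "\<And>z. poly Q z \<noteq> 0 \<Longrightarrow> f z = poly P z / poly Q z"
    using assms(1) unfolding rational_function_def by blast
  have cof: "\<forall>\<^sub>F z in cofinite. poly Q z \<noteq> 0"
    using poly_roots_finite[OF Q(1)] by (simp add: eventually_cofinite)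
  have "regular (\<lambda>z. poly P z / poly Q z) a" for a
  proof (rule regular_cong[OF _ assms(2)[of a]])
    show "\<forall>\<^sub>F z in at a. f z = poly P z / poly Q z"
      using eventually_at_cofinite[OF cof] by eventually_elim (simp add: Q)
  qed
  from regular_quotient_poly[OF Q(1) this] obtain R where
    R: "\<And>z. poly Q z \<noteq> 0 \<Longrightarrow> poly P z / poly Q z = poly R z" by blast
  have "\<forall>\<^sub>F z in cofinite. f z = poly R z"
    using cof by eventually_elim (simp add: Q R)
  then show ?thesis by blast
qed

text \<open>Local form \<open>(z - a)\<^sup>n u(z)\<close>, with the integer exponent split as \<open>n = i - j\<close>.\<close>
lemma rational_local_form:
  assumes "rational_function f"
  shows "(\<forall>\<^sub>F z in at a. f z = 0) \<or>
    (\<exists>i j u c. c \<noteq> 0 \<and> (u \<longlongrightarrow> c) (at a) \<and> (\<forall>\<^sub>F z in at a. f z = (z - a) ^ i / (z - a) ^ j * u z))"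
proof -
  obtain P Q where Q: "Q \<noteq> 0" "\<And>z. poly Q z \<noteq> 0 \<Longrightarrow> f z = poly P z / poly Q z"
    using assms(1) unfolding rational_function_def by blast
  have cof: "\<forall>\<^sub>F z in cofinite. poly Q z \<noteq> 0"
    using poly_roots_finite[OF Q(1)] by (simp add: eventually_cofinite)
  have ev: "\<forall>\<^sub>F z in at a. f z = poly P z / poly Q z"
    using eventually_at_cofinite[OF cof] by eventually_elim (simp add: Q)
  show ?thesis
  proof (cases "P = 0")
    case True
    then show ?thesis using ev by simp
  next
    case False
    have nz: "poly R a \<noteq> 0" if "\<not> [:- a, 1:] dvd R" for R
      using that by (simp add: poly_eq_0_iff_dvd)
    obtain P' where P': "P = [:- a, 1:] ^ Polynomial.order a P * P'" "poly P' a \<noteq> 0"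
      using order_decomp[OF False, of a] nz by blast
    obtain Q' where Q': "Q = [:- a, 1:] ^ Polynomial.order a Q * Q'" "poly Q' a \<noteq> 0"
      using order_decomp[OF Q(1), of a] nz by blast
    have "((\<lambda>z. poly P' z / poly Q' z) \<longlongrightarrow> poly P' a / poly Q' a) (at a)"
      using Q'(2) by (intro tendsto_divide isContD poly_isCont)
    moreover have "poly P z / poly Q z = (z - a) ^ Polynomial.order a P / (z - a) ^ Polynomial.order a Q * (poly P' z / poly Q' z)" for z
      by (subst P'(1), subst Q'(1)) (simp add: poly_power)
    then have "\<forall>\<^sub>F z in at a. f z = (z - a) ^ Polynomial.order a P / (z - a) ^ Polynomial.order a Q * (poly P' z / poly Q' z)"
      using ev by simp
    ultimately show ?thesis
      using P'(2) Q'(2)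
      by (intro disjI2 exI[of _ "Polynomial.order a P"] exI[of _ "Polynomial.order a Q"] exI[of _ "\<lambda>z. poly P' z / poly Q' z"]
          exI[of _ "poly P' a / poly Q' a"]) auto
  qed
qed

section \<open>Principal parts\<close>

text \<open>Gives the coefficients of a principal part as a Laurent series, so that they can be
  subtracted from those of the function.\<close>

lemma poly_inverse_laurent:
  "\<exists>G. (\<lambda>w. poly P (1 / w)) has_laurent_expansion G \<and>
       (\<forall>n. fls_nth G n = (if n \<le> 0 then Polynomial.coeff P (nat (- n)) else 0))"
proof (induction P)
  case 0
  show ?case by (intro exI[of _ 0]) simp
next
  case (pCons c P)
  then obtain G where G: "(\<lambda>w. poly P (1 / w)) has_laurent_expansion G"
    "\<And>n. fls_nth G n = (if n \<le> 0 then Polynomial.coeff P (nat (- n)) else 0)" by blast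
  have "(\<lambda>w. c + inverse w * poly P (1 / w)) has_laurent_expansion (fls_const c + fls_X_inv * G)"
    by (intro laurent_expansion_intros G)
  moreover have "fls_nth (fls_const c + fls_X_inv * G) n = (if n \<le> 0 then Polynomial.coeff (pCons c P) (nat (- n)) else 0)" for n
  proof (cases "n < 0")
    case True
    then have "nat (- n) = Suc (nat (- (n + 1)))" by simp
    then show ?thesis using True by (simp add: fls_X_inv_times_conv_shift G(2) fls_const_nth)
  next
    case False
    then show ?thesis by (auto simp: fls_X_inv_times_conv_shift G(2) fls_const_nth)
  qed
  ultimately show ?case
    by (intro exI[of _ "fls_const c + fls_X_inv * G"]) (simp add: inverse_eq_divide)
qed

lemma regular_diff_principal_part:
  assumes "f meromorphic_on {a}"
  shows "regular (\<lambda>z. f z - principal_part a f z) a"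
proof -
  define F where "F = laurent_expansion f a"
  have F: "(\<lambda>w. f (a + w)) has_laurent_expansion F"
    using assms not_essential_has_laurent_expansion unfolding meromorphic_at_iff F_def by blast
  obtain G where G: "(\<lambda>w. poly (fls_prpart F) (1 / w)) has_laurent_expansion G"
    "\<And>n. fls_nth G n = (if n \<le> 0 then Polynomial.coeff (fls_prpart F) (nat (- n)) else 0)"
    using poly_inverse_laurent by blast
  have "(\<lambda>w. f (a + w) - poly (fls_prpart F) (1 / w)) has_laurent_expansion (F - G)"
    by (intro laurent_expansion_intros F G)
  then have L: "(\<lambda>w. (\<lambda>z. f z - principal_part a f z) (a + w)) has_laurent_expansion (F - G)"
    by (simp add: principal_part_def F_def)
  have "fls_subdegree (F - G) \<ge> 0"
  proof (cases "F - G = 0")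
    case False
    then show ?thesis
      by (intro fls_subdegree_geI) (auto simp: G(2))
  qed simp
  from has_laurent_expansion_imp_tendsto[OF L this] show ?thesis by (rule regularI)
qed

lemma principal_part_rational: "rational_function (principal_part a f)"
  unfolding principal_part_def by (rule rational_poly_inverse)

lemma principal_part_regular: "z \<noteq> a \<Longrightarrow> regular (principal_part a f) z"
  unfolding principal_part_def by (intro regular_isCont continuous_intros) auto

lemma principal_part_at_infinity: "(principal_part a f \<longlongrightarrow> 0) at_infinity"
proof -
  have "filterlim (\<lambda>z::complex. - a + z) at_infinity at_infinity"
    by (intro tendsto_add_filterlim_at_infinity[OF tendsto_const] filterlim_ident)
  then have "((\<lambda>z::complex. 1 / (z - a)) \<longlongrightarrow> 0) at_infinity"
    by (intro tendsto_divide_0[OF tendsto_const]) simp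
  moreover have "isCont (poly (fls_prpart (laurent_expansion f a))) 0" by (rule poly_isCont)
  ultimately have "((\<lambda>z. poly (fls_prpart (laurent_expansion f a)) (1 / (z - a))) \<longlongrightarrow>
      poly (fls_prpart (laurent_expansion f a)) 0) at_infinity"
    by (rule isCont_tendsto_compose[rotated])
  \<comment> \<open>\<open>fls_prpart\<close> collects negative exponents only, so its constant
    coefficient is 0.\<close>
  moreover have "poly (fls_prpart (laurent_expansion f a)) 0 = 0"
    by (simp add: poly_0_coeff_0)
  ultimately show ?thesis by (simp add: principal_part_def [abs_def])
qed

section \<open>The invariant function with poles at a conjugate pair\<close>

definition pole_fun :: "nat \<Rightarrow> real \<Rightarrow> real \<Rightarrow> complex \<Rightarrow> complex" where
  "pole_fun k x x' z = of_real ((x - x') ^ k) / ((z - of_real x) ^ k * (z - of_real x') ^ k)"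

lemma pole_fun_meromorphic: "pole_fun k x x' meromorphic_on {a}"
  unfolding pole_fun_def [abs_def] by (intro meromorphic_intros)

text \<open>By \<open>moebius_map_diff\<close> the factors at x and x' cancel between numerator and
  denominator, leaving \<open>aut_factor M z\<close> to the power 2k, which slashing divides
  out.\<close>

lemma pole_fun_moebius:
  assumes "det M = 1" "aut_factor M x \<noteq> 0" "aut_factor M x' \<noteq> 0" "aut_factor M z \<noteq> 0"
  shows "slash k (pole_fun k (moebius_map M x) (moebius_map M x')) M z = pole_fun k x x' z"
proof -
  have e: "moebius_map M z - of_real (moebius_map M y) = (z - of_real y) / (aut_factor M z * of_real (aut_factor M y))"
    if "aut_factor M y \<noteq> 0" for y
    using moebius_map_diff[OF assms(1) assms(4), of "of_real y"] that
    by (simp add: moebius_map_of_real aut_factor_of_real)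
  define u v w where "u = aut_factor M z" and "v = complex_of_real (aut_factor M x)"
    and "w = complex_of_real (aut_factor M x')"
  have nz: "u \<noteq> 0" "v \<noteq> 0" "w \<noteq> 0" using assms by (auto simp: u_def v_def w_def)
  have d: "of_real ((moebius_map M x - moebius_map M x') ^ k) = of_real ((x - x') ^ k) / (v * w) ^ k"
    unfolding moebius_map_diff[OF assms(1-3)] by (simp add: v_def w_def power_divide)
  show ?thesis
    unfolding slash_alt pole_fun_def e[OF assms(2)] e[OF assms(3)] d u_def[symmetric] v_def[symmetric] w_def[symmetric]
    using nz by (simp add: power_divide power_mult_distrib mult_2 power_add)
qed

section \<open>Poles of a rational period function\<close>

lemma slash_minus [simp]: "slash k f (- M) z = slash k f M z"
  by (simp add: slash_alt)

lemma slash_slash: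
  assumes "aut_factor B z \<noteq> 0"
  shows "slash k (slash k f A) B z = slash k f (A ** B) z"
  using assms by (simp add: slash_alt aut_factor_mult moebius_map_mult power_mult_distrib)

text \<open>With n = i - j, h starts with c (z - x)^n and h o M with c mu^n (z - x)^n, where mu =
  1/j(x)^2 is the multiplier. If n < k, the hypothesis on the difference forces mu^n = 1, so n = 0
  because |mu| differs from 1.\<close>

lemma power_ratio_dichotomy:
  fixes h u r :: "complex \<Rightarrow> complex" and x :: real
  assumes M: "det M = 1" "fixes_point M x" "\<bar>trace M\<bar> > 2"
    and u: "c \<noteq> 0" "(u \<longlongrightarrow> c) (at (of_real x))"
    and h: "\<forall>\<^sub>F z in at (of_real x). h z = (z - of_real x) ^ i / (z - of_real x) ^ j * u z"
    and r: "(r \<longlongrightarrow> l) (at (of_real x))"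
    and hr: "\<forall>\<^sub>F z in at (of_real x). h z - h (moebius_map M z) = (z - of_real x) ^ k * r z"
  shows "i = j \<or> i \<ge> j + k"
proof (rule ccontr)
  assume neg: "\<not> (i = j \<or> i \<ge> j + k)"
  define a where "a = complex_of_real x"
  define J where "J = complex_of_real (aut_factor M x)"
  define \<mu> where "\<mu> = 1 / (J * J)"
  have fx: "aut_factor M x \<noteq> 0" "moebius_map M x = x" using M(2) by (auto simp: fixes_point_alt)
  have nz: "aut_factor M a \<noteq> 0" and Ma: "moebius_map M a = a" and Ja: "aut_factor M a = J" "J \<noteq> 0"
    using fx by (auto simp: a_def moebius_map_of_real J_def aut_factor_of_real)
  have lim: "filterlim (moebius_map M) (at a) (at a)"
    using filterlim_moebius_map[OF M(1) nz] by (simp add: Ma)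
  define \<rho> where "\<rho> z = (moebius_map M z - a) / (z - a)" for z
  have jz: "\<forall>\<^sub>F z in at a. aut_factor M z \<noteq> 0" by (rule eventually_aut_factor_nonzero[OF nz])
  have ne: "\<forall>\<^sub>F z in at a. z \<noteq> a" by (simp add: eventually_at_filter)
  have rho: "(\<rho> \<longlongrightarrow> \<mu>) (at a)"
  proof (rule Lim_transform_eventually)
    have "(aut_factor M \<longlongrightarrow> J) (at a)"
      unfolding Ja(1)[symmetric] aut_factor_def by (intro tendsto_intros)
    then show "((\<lambda>z. 1 / (aut_factor M z * J)) \<longlongrightarrow> \<mu>) (at a)"
      unfolding \<mu>_def using Ja(2) by (intro tendsto_intros) auto
    show "\<forall>\<^sub>F z in at a. 1 / (aut_factor M z * J) = \<rho> z"
      using jz ne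
    proof eventually_elim
      case (elim z)
      have "moebius_map M z - a = (z - a) / (aut_factor M z * J)"
        using moebius_map_diff[OF M(1) elim(1) nz] by (simp add: Ma Ja)
      then show ?case using elim by (simp add: \<rho>_def)
    qed
  qed
  have mu: "\<mu> \<noteq> 0" "norm \<mu> \<noteq> 1"
  proof -
    show "\<mu> \<noteq> 0" using Ja by (simp add: \<mu>_def)
    have "norm J \<noteq> 1" "norm J \<ge> 0" using hyperbolic_aut_factor[OF M] by (simp_all add: J_def)
    then have "norm J * norm J \<noteq> 1" by (metis abs_of_nonneg abs_square_eq_1 power2_eq_square)
    then show "norm \<mu> \<noteq> 1" by (simp add: \<mu>_def norm_divide norm_mult)
  qed
  have h': "\<forall>\<^sub>F z in at a. h (moebius_map M z) = (moebius_map M z - a) ^ i / (moebius_map M z - a) ^ j * u (moebius_map M z)"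
    using h lim unfolding a_def[symmetric] by (rule eventually_compose_filterlim)
  have u': "((\<lambda>z. u (moebius_map M z)) \<longlongrightarrow> c) (at a)"
    using u(2) lim unfolding a_def[symmetric] by (rule filterlim_compose)
  have L1: "((\<lambda>z. u z - \<rho> z ^ i / \<rho> z ^ j * u (moebius_map M z)) \<longlongrightarrow> c - \<mu> ^ i / \<mu> ^ j * c) (at a)"
    using u(2) u' rho mu(1) unfolding a_def[symmetric] by (intro tendsto_intros) auto
  \<comment> \<open>Dividing the difference by (z - x)^(i - j) leaves (z - x)^m r, and m > 0 makes
    this tend to 0.\<close>
  define m where "m = k + j - i"
  have m: "m > 0" "k + j = m + i" using neg by (auto simp: m_def)
  have "((\<lambda>z. (z - a) ^ m * r z) \<longlongrightarrow> (a - a) ^ m * l) (at a)"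
    using r unfolding a_def[symmetric] by (intro tendsto_intros)
  then have L2: "((\<lambda>z. (z - a) ^ m * r z) \<longlongrightarrow> 0) (at a)" using m by (simp add: zero_power)
  have inj: "\<forall>\<^sub>F z in at a. moebius_map M z \<noteq> a"
    using lim by (auto simp: filterlim_at)
  have "\<forall>\<^sub>F z in at a. (z - a) ^ m * r z = u z - \<rho> z ^ i / \<rho> z ^ j * u (moebius_map M z)"
    using h h' hr ne inj unfolding a_def[symmetric]
  proof eventually_elim
    case (elim z)
    define y w where "y = z - a" and "w = moebius_map M z - a"
    have yw: "y \<noteq> 0" "w \<noteq> 0" using elim by (auto simp: y_def w_def)
    have "y ^ i * (y ^ m * r z) = y ^ j * (y ^ k * r z)"
      by (metis (no_types) m(2) mult.assoc add.commute power_add)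
    also have "y ^ k * r z = y ^ i / y ^ j * u z - w ^ i / w ^ j * u (moebius_map M z)"
      using elim by (simp add: y_def w_def)
    finally have *: "y ^ i * (y ^ m * r z) = y ^ j * (y ^ i / y ^ j * u z - w ^ i / w ^ j * u (moebius_map M z))" .
    have "y ^ m * r z = (y ^ j / y ^ i) * (y ^ i / y ^ j * u z - w ^ i / w ^ j * u (moebius_map M z))"
      using yw * by (simp add: nonzero_eq_divide_eq mult.commute)
    also have "\<dots> = u z - (w / y) ^ i / (w / y) ^ j * u (moebius_map M z)"
      using yw by (simp add: right_diff_distrib power_divide)
    finally show ?case by (simp add: y_def w_def \<rho>_def)
  qed
  from Lim_transform_eventually[OF L2 this] have "c - \<mu> ^ i / \<mu> ^ j * c = 0"
    using tendsto_unique[OF _ L1] by auto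
  then have "\<mu> ^ i = \<mu> ^ j" using u(1) mu(1) by (simp add: field_simps)
  then have "norm \<mu> ^ i = norm \<mu> ^ j" by (metis norm_power)
  moreover have "norm \<mu> > 0" using mu by simp
  ultimately have "i = j" using mu(2) power_inject_exp'[of "norm \<mu>" i j] by auto
  then show False using neg by simp
qed

text \<open>The dichotomy is applied twice, to h and then to h - c with c the limit of h.\<close>

lemma rational_invariant_constant:
  fixes h r :: "complex \<Rightarrow> complex" and x :: real
  assumes M: "det M = 1" "fixes_point M x" "\<bar>trace M\<bar> > 2"
    and h: "rational_function h" and r: "regular r (of_real x)"
    and hr: "\<forall>\<^sub>F z in at (of_real x). h z - h (moebius_map M z) = (z - of_real x) ^ k * r z"
  shows "\<exists>C g. regular g (of_real x) \<and> (\<forall>\<^sub>F z in at (of_real x). h z - C = (z - of_real x) ^ k * g z)"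
proof -
  define a where "a = complex_of_real x"
  obtain l where l: "(r \<longlongrightarrow> l) (at a)" using r by (auto simp: regular_def a_def)
  have ne: "\<forall>\<^sub>F z in at a. z \<noteq> a" by (simp add: eventually_at_filter)
  have large: "\<exists>g. regular g a \<and> (\<forall>\<^sub>F z in at a. f z = (z - a) ^ k * g z)"
    if "i \<ge> j + k" "(u \<longlongrightarrow> c) (at a)" "\<forall>\<^sub>F z in at a. f z = (z - a) ^ i / (z - a) ^ j * u z"
    for f u i j and c :: complex
  proof (intro exI[of _ "\<lambda>z. (z - a) ^ (i - j - k) * u z"] conjI)
    have "((\<lambda>z. (z - a) ^ (i - j - k) * u z) \<longlongrightarrow> (a - a) ^ (i - j - k) * c) (at a)"
      using that(2) by (intro tendsto_intros)
    then show "regular (\<lambda>z. (z - a) ^ (i - j - k) * u z) a" by (rule regularI)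
    have i: "i = j + (k + (i - j - k))" using that(1) by simp
    show "\<forall>\<^sub>F z in at a. f z = (z - a) ^ k * ((z - a) ^ (i - j - k) * u z)"
      using that(3) ne
    proof eventually_elim
      case (elim z)
      have "(z - a) ^ i = (z - a) ^ j * ((z - a) ^ k * (z - a) ^ (i - j - k))"
        by (subst i) (simp only: power_add)
      then show ?case using elim by simp
    qed
  qed
  have dich: "(\<exists>g. regular g a \<and> (\<forall>\<^sub>F z in at a. f z = (z - a) ^ k * g z)) \<or>
      (\<exists>c. c \<noteq> 0 \<and> (f \<longlongrightarrow> c) (at a))"
    if f: "rational_function f" "\<forall>\<^sub>F z in at a. f z - f (moebius_map M z) = (z - a) ^ k * r z" for f
    using rational_local_form[OF f(1), of a]
  proof
    assume "\<forall>\<^sub>F z in at a. f z = 0"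
    then show ?thesis by (intro disjI1 exI[of _ "\<lambda>_. 0"]) (auto simp: regular_def)
  next
    assume "\<exists>i j u c. c \<noteq> 0 \<and> (u \<longlongrightarrow> c) (at a) \<and> (\<forall>\<^sub>F z in at a. f z = (z - a) ^ i / (z - a) ^ j * u z)"
    then obtain i j u c where u: "c \<noteq> 0" "(u \<longlongrightarrow> c) (at a)"
      "\<forall>\<^sub>F z in at a. f z = (z - a) ^ i / (z - a) ^ j * u z" by blast
    have "i = j \<or> i \<ge> j + k"
      using power_ratio_dichotomy[OF M u(1) u(2,3)[unfolded a_def] l[unfolded a_def] f(2)[unfolded a_def]] .
    then show ?thesis
    proof
      assume "i \<ge> j + k"
      then show ?thesis using large[OF _ u(2,3)] by blast
    next
      assume "i = j"
      from u(3) ne have "\<forall>\<^sub>F z in at a. u z = f z"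
        by eventually_elim (use \<open>i = j\<close> in simp)
      then show ?thesis using Lim_transform_eventually[OF u(2)] u(1) by blast
    qed
  qed
  have "\<exists>C g. regular g a \<and> (\<forall>\<^sub>F z in at a. h z - C = (z - a) ^ k * g z)"
    using dich[OF h hr[folded a_def]]
  proof
    assume "\<exists>g. regular g a \<and> (\<forall>\<^sub>F z in at a. h z = (z - a) ^ k * g z)"
    then show ?thesis by (intro exI[of _ 0]) simp
  next
    assume "\<exists>c. c \<noteq> 0 \<and> (h \<longlongrightarrow> c) (at a)"
    then obtain c where "(h \<longlongrightarrow> c) (at a)" by blast
    then have lim: "((\<lambda>z. h z - c) \<longlongrightarrow> 0) (at a)" by (rule LIM_zero)
    have "rational_function (\<lambda>z. h z - c)" by (intro rational_diff h rational_const)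
    moreover have "\<forall>\<^sub>F z in at a. (h z - c) - (h (moebius_map M z) - c) = (z - a) ^ k * r z"
      using hr by (simp add: a_def)
    ultimately have "(\<exists>g. regular g a \<and> (\<forall>\<^sub>F z in at a. h z - c = (z - a) ^ k * g z)) \<or>
        (\<exists>d. d \<noteq> 0 \<and> ((\<lambda>z. h z - c) \<longlongrightarrow> d) (at a))"
      by (rule dich)
    \<comment> \<open>h - c tends to 0, which excludes a nonzero limit and leaves order at least
      k.\<close>
    then show ?thesis using tendsto_unique[OF trivial_limit_at lim] by blast
  qed
  then show ?thesis by (simp add: a_def)
qed

lemma pole_fun_not_regular:
  assumes "k \<ge> 1" "x \<noteq> x'"
  shows "\<not> regular (pole_fun k x x') (of_real x)"
proof
  define a where "a = complex_of_real x"
  assume "regular (pole_fun k x x') (of_real x)"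
  then obtain l where l: "(pole_fun k x x' \<longlongrightarrow> l) (at a)" by (auto simp: regular_def a_def)
  have "((\<lambda>z. pole_fun k x x' z * ((z - a) ^ k * (z - of_real x') ^ k)) \<longlongrightarrow> l * ((a - a) ^ k * (a - of_real x') ^ k)) (at a)"
    using l by (intro tendsto_intros)
  moreover have "\<forall>\<^sub>F z in at a. pole_fun k x x' z * ((z - a) ^ k * (z - of_real x') ^ k) = of_real ((x - x') ^ k)"
  proof -
    have "\<forall>\<^sub>F z in at a. z \<notin> {a, of_real x'}"
      by (intro eventually_at_cofinite) (simp add: eventually_cofinite)
    then show ?thesis by eventually_elim (simp add: pole_fun_def a_def)
  qed
  ultimately have "((\<lambda>z. of_real ((x - x') ^ k) :: complex) \<longlongrightarrow> 0) (at a)"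
    using assms(1) by (auto simp: zero_power dest: Lim_transform_eventually)
  then have "of_real ((x - x') ^ k) = (0::complex)"
    using tendsto_unique[OF _ tendsto_const] by (metis trivial_limit_at)
  then show False using assms(2) by simp
qed

lemma pole_fun_times_power_regular:
  assumes "x \<noteq> x'"
  shows "regular (\<lambda>z. pole_fun k x x' z * (z - of_real x) ^ k) (of_real x)"
proof (rule regular_cong)
  show "regular (\<lambda>z. of_real ((x - x') ^ k) / (z - of_real x') ^ k) (of_real x)"
    using assms by (intro regular_isCont continuous_intros) auto
  have "\<forall>\<^sub>F z in at (complex_of_real x). z \<noteq> of_real x" by (simp add: eventually_at_filter)
  then show "\<forall>\<^sub>F z in at (complex_of_real x). of_real ((x - x') ^ k) / (z - of_real x') ^ k =
      pole_fun k x x' z * (z - of_real x) ^ k"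
    by eventually_elim (simp add: pole_fun_def)
qed

text \<open>Divide q by the invariant function F: h - h o M equals (q - slash)/F, and 1/F vanishes
  to order k at x. So h agrees with a constant C to order k; multiplying back by F gives the
  claim.\<close>

lemma slash_invariant_pole:
  fixes q :: "complex \<Rightarrow> complex"
  assumes M: "det M = 1" "fixes_point M x" "fixes_point M x'" "\<bar>trace M\<bar> > 2" and x: "x \<noteq> x'"
    and q: "rational_function q" and r: "regular (\<lambda>z. q z - slash k q M z) (of_real x)"
  shows "\<exists>C. regular (\<lambda>z. q z - C * pole_fun k x x' z) (of_real x)"
proof -
  define a where "a = complex_of_real x"
  define F where "F = pole_fun k x x'"
  \<comment> \<open>1/F is a polynomial, which keeps q/F rational. Division by zero being 0, the
    identity with 1/F holds at the roots as well.\<close>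
  define E where "E = poly ([:1 / of_real ((x - x') ^ k):] * [:- a, 1:] ^ k * [:- of_real x', 1:] ^ k)"
  have E: "E z = 1 / F z" for z
    by (simp add: E_def F_def pole_fun_def poly_power a_def)
  define h where "h z = q z * E z" for z
  have rh: "rational_function h"
    unfolding h_def [abs_def] E_def by (intro rational_mult q rational_poly)
  have fx: "aut_factor M x \<noteq> 0" "moebius_map M x = x" "aut_factor M x' \<noteq> 0" "moebius_map M x' = x'"
    using M(2,3) by (auto simp: fixes_point_alt)
  have jz: "\<forall>\<^sub>F z in at a. aut_factor M z \<noteq> 0"
    using fx by (intro eventually_aut_factor_nonzero) (simp add: a_def)
  have ne: "\<forall>\<^sub>F z in at a. z \<notin> {a, of_real x'}"
    by (intro eventually_at_cofinite) (simp add: eventually_cofinite)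
  define r where "r z = (q z - slash k q M z) * ((z - of_real x') ^ k / of_real ((x - x') ^ k))" for z
  have "regular (\<lambda>z. (z - of_real x') ^ k / of_real ((x - x') ^ k)) a"
    using x by (intro regular_isCont continuous_intros) auto
  then have rr: "regular r a"
    unfolding r_def [abs_def] using r by (intro regular_mult) (simp_all add: a_def)
  have hr: "\<forall>\<^sub>F z in at a. h z - h (moebius_map M z) = (z - a) ^ k * r z"
    using jz
  proof eventually_elim
    case (elim z)
    have "F z = F (moebius_map M z) / aut_factor M z ^ (2 * k)"
      using pole_fun_moebius[OF M(1) fx(1,3) elim, of k] by (simp add: fx slash_alt F_def)
    then have "E (moebius_map M z) = E z / aut_factor M z ^ (2 * k)"
      using elim by (simp add: E)
    then have "h z - h (moebius_map M z) = (q z - slash k q M z) * E z"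
      by (simp add: h_def slash_alt left_diff_distrib)
    then show ?case by (simp add: r_def E F_def pole_fun_def a_def mult_ac)
  qed
  obtain C g where g: "regular g a" "\<forall>\<^sub>F z in at a. h z - C = (z - a) ^ k * g z"
    using rational_invariant_constant[OF M(1,2,4) rh rr[unfolded a_def] hr[unfolded a_def]] unfolding a_def by blast
  have "regular (\<lambda>z. q z - C * F z) a"
  proof (rule regular_cong)
    show "regular (\<lambda>z. F z * (z - a) ^ k * g z) a"
      unfolding F_def a_def by (rule regular_mult[OF pole_fun_times_power_regular[OF x] g(1)[unfolded a_def]])
    show "\<forall>\<^sub>F z in at a. F z * (z - a) ^ k * g z = q z - C * F z"
      using g(2) ne
    proof eventually_elim
      case (elim z)
      have "F z \<noteq> 0" using elim(2) x by (simp add: F_def pole_fun_def a_def)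
      then have "h z * F z = q z" by (simp add: h_def E)
      then have "q z - C * F z = (h z - C) * F z" by (simp add: left_diff_distrib)
      also have "\<dots> = (z - a) ^ k * g z * F z" by (simp only: elim(1))
      finally show ?case by (simp add: mult_ac)
    qed
  qed
  then show ?thesis unfolding F_def a_def by blast
qed

section \<open>Cycles of poles in the right half plane\<close>

locale rpf = hecke +
  fixes k :: nat and q :: "complex \<Rightarrow> complex"
  assumes k_pos: "k \<ge> 1" and rpf: "rational_period_function p k q"
begin

lemma q_rational: "rational_function q"
  using rpf by (simp add: rational_period_function_def)

lemma q_slash_T: "\<forall>\<^sub>F z in cofinite. q z = - slash k q hecke_T z"
  using rpf unfolding rational_period_function_def
  by (elim conjE eventually_mono) (simp add: eq_neg_iff_add_eq_0)

lemma eventually_cofinite_T: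
  fixes Q :: "complex \<Rightarrow> bool"
  assumes "\<forall>\<^sub>F z in cofinite. Q z"
  shows "\<forall>\<^sub>F z in cofinite. Q (moebius_map hecke_T z)"
proof -
  have "{z. \<not> Q (moebius_map hecke_T z)} \<subseteq> insert 0 ((\<lambda>w. - 1 / w) ` {w. \<not> Q w})"
  proof
    fix z assume "z \<in> {z. \<not> Q (moebius_map hecke_T z)}"
    then have "- 1 / z \<in> {w. \<not> Q w}" by (simp add: moebius_map_T)
    moreover have "z = - 1 / (- 1 / z)" by simp
    ultimately show "z \<in> insert 0 ((\<lambda>w. - 1 / w) ` {w. \<not> Q w})" by blast
  qed
  then show ?thesis
    using assms finite_subset unfolding eventually_cofinite by blast
qed

lemma q_sum_V: "\<forall>\<^sub>F z in cofinite. q z = (\<Sum>i\<in>{1..<p}. slash k q (V (real i)) z)"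
proof -
  have "\<forall>\<^sub>F z in cofinite. q z + (\<Sum>j=1..p-1. slash k q (hecke_U p [^]\<^bsub>SL2R\<^esub> j) z) = 0"
    using rpf by (simp add: rational_period_function_def)
  \<comment> \<open>Substituting T z and dividing by z^(2k) below amounts to slashing the second
    relation with T.\<close>
  from eventually_cofinite_T[OF this]
  have 1: "\<forall>\<^sub>F z in cofinite. q (moebius_map hecke_T z) +
      (\<Sum>j=1..p-1. slash k q (hecke_U p [^]\<^bsub>SL2R\<^esub> j) (moebius_map hecke_T z)) = 0" .
  have 2: "\<forall>\<^sub>F z in cofinite. z \<noteq> (0::complex)" by (simp add: eventually_cofinite)
  show ?thesis using 1 2 q_slash_T
  proof eventually_elim
    case (elim z)
    have s: "slash k q (hecke_U p [^]\<^bsub>SL2R\<^esub> j) (moebius_map hecke_T z) / z ^ (2 * k) =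
        slash k q (V (real (p - j))) z" if "j \<in> {1..p-1}" for j
    proof -
      have "slash k q (hecke_U p [^]\<^bsub>SL2R\<^esub> j) (moebius_map hecke_T z) / z ^ (2 * k) =
          slash k (slash k q (hecke_U p [^]\<^bsub>SL2R\<^esub> j)) hecke_T z"
        by (simp add: slash_alt[of k "slash k q _"])
      also have "\<dots> = slash k q (V (- real j)) z"
        using elim(2) by (simp add: slash_slash hecke_U_pow)
      also have "V (- real j) = - V (real (p - j))"
      proof -
        have "real (p - j) = - real j + real p" using that by auto
        then have "V (real (p - j)) = - V (- real j)" by (simp only: V_add_p)
        then show ?thesis by simp
      qed
      finally show ?thesis by simp
    qed
    have "q (moebius_map hecke_T z) / z ^ (2 * k) +
      (\<Sum>j=1..p-1. slash k q (hecke_U p [^]\<^bsub>SL2R\<^esub> j) (moebius_map hecke_T z) / z ^ (2 * k)) = 0 / z ^ (2 * k)"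
      unfolding elim(1)[symmetric] add_divide_distrib sum_divide_distrib ..
    also have "(\<Sum>j=1..p-1. slash k q (hecke_U p [^]\<^bsub>SL2R\<^esub> j) (moebius_map hecke_T z) / z ^ (2 * k)) =
        (\<Sum>j=1..p-1. slash k q (V (real (p - j))) z)"
      by (rule sum.cong[OF refl s])
    also have "\<dots> = (\<Sum>i\<in>{1..<p}. slash k q (V (real i)) z)"
      by (rule sum.reindex_bij_witness[of _ "\<lambda>i. p - i" "\<lambda>j. p - j"]) auto
    finally show ?case using elim(3) by (simp add: slash_alt add_eq_0_iff)
  qed
qed

definition poles :: "complex set" where
  "poles = {a. Re a > 0 \<and> \<not> regular q a}"

lemma finite_poles: "finite poles"
  using rational_finitely_nonregular[OF q_rational] by (rule finite_subset[rotated]) (auto simp: poles_def)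

lemma V_halfplane: "i \<in> {1..<p} \<Longrightarrow> Re z > 0 \<Longrightarrow> aut_factor (V (real i)) z \<noteq> 0 \<and> Re (moebius_map (V (real i)) z) > 0"
  using nonneg_mat_halfplane[OF V_letter] by blast

text \<open>Stated for arbitrary a because it also serves on the imaginary axis.\<close>

lemma q_regular_step:
  assumes "\<And>i. i \<in> {1..<p} \<Longrightarrow> aut_factor (V (real i)) a \<noteq> 0 \<and> regular q (moebius_map (V (real i)) a)"
  shows "regular q a"
proof (rule regular_cong)
  show "\<forall>\<^sub>F z in at a. (\<Sum>i\<in>{1..<p}. slash k q (V (real i)) z) = q z"
    using eventually_at_cofinite[OF q_sum_V] by eventually_elim simp
  show "regular (\<lambda>z. \<Sum>i\<in>{1..<p}. slash k q (V (real i)) z) a"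
    using assms by (intro regular_sum regular_slash) auto
qed

lemma poles_step:
  assumes "a \<in> poles"
  shows "\<exists>i\<in>{1..<p}. moebius_map (V (real i)) a \<in> poles"
proof (rule ccontr)
  assume neg: "\<not> (\<exists>i\<in>{1..<p}. moebius_map (V (real i)) a \<in> poles)"
  have "regular q a"
  proof (rule q_regular_step)
    fix i assume i: "i \<in> {1..<p}"
    with neg show "aut_factor (V (real i)) a \<noteq> 0 \<and> regular q (moebius_map (V (real i)) a)"
      using V_halfplane[OF i, of a] assms by (auto simp: poles_def)
  qed
  then show False using assms by (simp add: poles_def)
qed

definition letter :: "complex \<Rightarrow> nat" where
  "letter a = (SOME i. i \<in> {1..<p} \<and> moebius_map (V (real i)) a \<in> poles)"

definition shift :: "complex \<Rightarrow> complex" where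
  "shift a = moebius_map (V (real (letter a))) a"

lemma letter: "a \<in> poles \<Longrightarrow> letter a \<in> {1..<p} \<and> shift a \<in> poles"
  unfolding shift_def letter_def by (rule someI_ex) (use poles_step in blast)

text \<open>Disjoint images of the letters make the map injective, and a finite set leaves room only
  for a bijection.\<close>

lemma shift_bij: "bij_betw shift poles poles"
proof -
  have "inj_on shift poles"
  proof (rule inj_onI)
    fix a b assume "a \<in> poles" "b \<in> poles" "shift a = shift b"
    then show "a = b"
      using V_disjoint(2)[of "letter a" "letter b" a b] letter by (auto simp: shift_def poles_def)
  qed
  then show ?thesis
    using endo_inj_surj[OF finite_poles] letter by (auto simp: bij_betw_def)
qed

text \<open>By surjectivity the second pole is the shift of some b; disjointness then forces b = a
  and the same letter.\<close>

lemma letter_unique: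
  assumes "a \<in> poles" "i \<in> {1..<p}" "moebius_map (V (real i)) a \<in> poles"
  shows "i = letter a"
proof -
  obtain b where b: "b \<in> poles" "moebius_map (V (real i)) a = shift b"
    using shift_bij assms(3) by (metis bij_betw_imp_surj_on imageE)
  have "i = letter b \<and> a = b"
    using V_disjoint[of i "letter b" a b] letter[OF b(1)] assms b by (auto simp: shift_def poles_def)
  then show ?thesis by blast
qed

lemma q_diff_slash_letter:
  assumes a: "a \<in> poles"
  shows "regular (\<lambda>z. q z - slash k q (V (real (letter a))) z) a"
proof (rule regular_cong)
  have l: "letter a \<in> {1..<p}" using letter[OF a] by blast
  show "\<forall>\<^sub>F z in at a. (\<Sum>i\<in>{1..<p} - {letter a}. slash k q (V (real i)) z) =
      q z - slash k q (V (real (letter a))) z"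
    using eventually_at_cofinite[OF q_sum_V]
    by eventually_elim (use l in \<open>simp add: sum_diff1\<close>)
  show "regular (\<lambda>z. \<Sum>i\<in>{1..<p} - {letter a}. slash k q (V (real i)) z) a"
  proof (intro regular_sum regular_slash)
    fix i assume i: "i \<in> {1..<p} - {letter a}"
    then show "aut_factor (V (real i)) a \<noteq> 0" using V_halfplane a by (auto simp: poles_def)
    show "regular q (moebius_map (V (real i)) a)"
      using letter_unique[OF a, of i] i V_halfplane[of i a] a by (auto simp: poles_def)
  qed simp
qed

text \<open>The differences telescope: for W the word so far, (q - q | W) + (q - q | V) | W = q - q
  | VW, so the new letter is put in front.\<close>

lemma shift_word:
  assumes a: "a \<in> poles"
  shows "\<exists>xs. is_word xs \<and> length xs = n \<and> (shift ^^ n) a = moebius_map (word_mat xs) a \<and> (shift ^^ n) a \<in> poles \<and>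
    regular (\<lambda>z. q z - slash k q (word_mat xs) z) a"
proof (induction n)
  case 0
  have "regular (\<lambda>z. q z - slash k q (word_mat []) z) a"
    by (rule regular_cong[of "\<lambda>_. 0"]) (auto simp: slash_alt regular_def)
  then show ?case using a by (intro exI[of _ "[]"]) simp
next
  case (Suc n)
  define b where "b = (shift ^^ n) a"
  obtain xs where xs: "is_word xs" "length xs = n" "b = moebius_map (word_mat xs) a" "b \<in> poles"
    "regular (\<lambda>z. q z - slash k q (word_mat xs) z) a"
    using Suc.IH by (auto simp: b_def)
  define i where "i = letter b"
  have i: "i \<in> {1..<p}" "shift b \<in> poles" using letter[OF xs(4)] by (auto simp: i_def)
  have nz: "aut_factor (word_mat xs) a \<noteq> 0"
    using nonneg_mat_halfplane(1)[OF word_mat_nonneg[OF xs(1)]] a by (simp add: poles_def)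
  have "regular (\<lambda>z. q z - slash k q (V (real i)) z) (moebius_map (word_mat xs) a)"
    using q_diff_slash_letter[OF xs(4)] by (simp add: i_def flip: xs(3))
  then have "regular (slash k (\<lambda>z. q z - slash k q (V (real i)) z) (word_mat xs)) a"
    by (rule regular_slash[OF word_mat_det nz])
  then have "regular (\<lambda>z. (q z - slash k q (word_mat xs) z) +
      slash k (\<lambda>z. q z - slash k q (V (real i)) z) (word_mat xs) z) a"
    by (intro regular_add xs(5))
  moreover have "\<forall>\<^sub>F z in at a. (q z - slash k q (word_mat xs) z) +
      slash k (\<lambda>z. q z - slash k q (V (real i)) z) (word_mat xs) z = q z - slash k q (word_mat (i # xs)) z"
    using eventually_aut_factor_nonzero[OF nz]
  proof eventually_elim
    case (elim z)
    have "slash k (\<lambda>z. q z - slash k q (V (real i)) z) (word_mat xs) z =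
        slash k q (word_mat xs) z - slash k (slash k q (V (real i))) (word_mat xs) z"
      by (simp add: slash_alt[of _ _ "word_mat xs"] diff_divide_distrib)
    then show ?case using elim by (simp add: slash_slash)
  qed
  ultimately have "regular (\<lambda>z. q z - slash k q (word_mat (i # xs)) z) a"
    by (rule regular_cong[rotated])
  moreover have "(shift ^^ Suc n) a = moebius_map (word_mat (i # xs)) a"
    using nz by (simp add: moebius_map_mult shift_def i_def b_def[symmetric] flip: xs(3))
  ultimately show ?case
    using xs i by (intro exI[of _ "i # xs"]) (simp add: b_def[symmetric])
qed

lemma pole_periodic:
  assumes a: "a \<in> poles"
  obtains xs where "is_word xs" "xs \<noteq> []" "moebius_map (word_mat xs) a = a"
    "regular (\<lambda>z. q z - slash k q (word_mat xs) z) a"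
proof -
  have inP: "(shift ^^ n) a \<in> poles" for n using shift_word[OF a] by blast
  have "\<not> inj (\<lambda>n. (shift ^^ n) a)"
  proof
    assume "inj (\<lambda>n. (shift ^^ n) a)"
    then have "infinite (range (\<lambda>n. (shift ^^ n) a))" by (rule range_inj_infinite)
    moreover have "range (\<lambda>n. (shift ^^ n) a) \<subseteq> poles" using inP by auto
    ultimately show False using finite_subset finite_poles by auto
  qed
  then obtain m n where mn: "m < n" "(shift ^^ m) a = (shift ^^ n) a"
  proof -
    obtain i j where "i \<noteq> j" "(shift ^^ i) a = (shift ^^ j) a"
      using \<open>\<not> inj (\<lambda>n. (shift ^^ n) a)\<close> unfolding inj_def by blast
    then show ?thesis
      using that[of i j] that[of j i] by (cases "i < j") auto
  qed
  then have "(shift ^^ m) a = (shift ^^ m) ((shift ^^ (n - m)) a)"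
    using funpow_add[of m "n - m" shift] by simp
  \<comment> \<open>Injectivity cancels the preperiod, so a itself is periodic.\<close>
  moreover have "inj_on (shift ^^ m) poles"
    using bij_betw_funpow[OF shift_bij, of m] by (rule bij_betw_imp_inj_on)
  ultimately have per: "a = (shift ^^ (n - m)) a"
    using inP[of "n - m"] a inj_onD by metis
  obtain xs where xs: "is_word xs" "length xs = n - m" "(shift ^^ (n - m)) a = moebius_map (word_mat xs) a"
    "regular (\<lambda>z. q z - slash k q (word_mat xs) z) a"
    using shift_word[OF a] by blast
  have "xs \<noteq> []" using xs(2) mn by auto
  then show ?thesis using that xs per by metis
qed

end

section \<open>Coefficients at the real poles\<close>

context rpf
begin

definition real_poles :: "real set" where
  "real_poles = {x. x > 0 \<and> \<not> regular q (of_real x)}"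

lemma finite_real_poles: "finite real_poles"
proof -
  have "of_real ` real_poles \<subseteq> poles" by (auto simp: real_poles_def poles_def)
  then have "finite (complex_of_real ` real_poles)" using finite_poles finite_subset by blast
  then show ?thesis by (rule finite_imageD) (simp add: inj_on_def)
qed

lemma poles_real:
  assumes "a \<in> poles" obtains x where "x \<in> real_poles" "a = of_real x"
proof -
  obtain xs where xs: "is_word xs" "xs \<noteq> []" "moebius_map (word_mat xs) a = a"
    using pole_periodic[OF assms] by blast
  have Re: "Re a > 0" using assms by (simp add: poles_def)
  have "Im a = 0" using word_fixed(4)[OF xs(1,2) Re xs(3)] .
  then have "a = of_real (Re a)" by (simp add: complex_eq_iff)
  then show ?thesis using that[of "Re a"] assms Re by (simp add: real_poles_def poles_def)
qed

lemma real_poles_in_poles: "x \<in> real_poles \<Longrightarrow> of_real x \<in> poles"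
  by (simp add: real_poles_def poles_def)

abbreviation local_form :: "real \<Rightarrow> complex \<Rightarrow> complex" where
  "local_form x \<equiv> pole_fun k x (hecke_conjugate p x)"

lemma real_pole_props:
  assumes x: "x \<in> real_poles"
  shows "x \<in> hyperbolic_fixed_points p" "x > 0" "hecke_conjugate p x < 0"
    "\<exists>C. regular (\<lambda>z. q z - C * local_form x z) (of_real x)"
    "\<exists>xs. is_word xs \<and> xs \<noteq> [] \<and> moebius_map (word_mat xs) x = x"
proof -
  obtain xs where xs: "is_word xs" "xs \<noteq> []" "moebius_map (word_mat xs) (complex_of_real x) = of_real x"
    "regular (\<lambda>z. q z - slash k q (word_mat xs) z) (of_real x)"
    using pole_periodic[OF real_poles_in_poles[OF x]] .
  show x0: "x > 0" using x by (simp add: real_poles_def)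
  have fx: "moebius_map (word_mat xs) x = x" using xs(3) by (simp add: moebius_map_of_real)
  note w = word_fixed_real[OF xs(1,2) x0 fx]
  show h: "x \<in> hyperbolic_fixed_points p" and "hecke_conjugate p x < 0"
    using word_fixed_conjugate_neg[OF xs(1,2) x0 fx] by auto
  have "fixes_point (word_mat xs) (hecke_conjugate p x)"
    using w(4) by (intro stabilizer_fixes_conjugate[OF h]) (simp add: hecke_stabilizer_def)
  then show "\<exists>C. regular (\<lambda>z. q z - C * local_form x z) (of_real x)"
    using w conjugate_props(4)[OF h] xs(4)
    by (intro slash_invariant_pole[OF word_mat_det _ _ _ _ q_rational]) auto
  show "\<exists>xs. is_word xs \<and> xs \<noteq> [] \<and> moebius_map (word_mat xs) x = x"
    using xs fx by blast
qed

definition pole_coeff :: "real \<Rightarrow> complex" where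
  "pole_coeff x = (SOME C. regular (\<lambda>z. q z - C * local_form x z) (of_real x))"

lemma pole_coeff: "x \<in> real_poles \<Longrightarrow> regular (\<lambda>z. q z - pole_coeff x * local_form x z) (of_real x)"
  unfolding pole_coeff_def by (rule someI_ex) (rule real_pole_props(4))

lemma pole_coeff_unique:
  assumes x: "x \<in> real_poles" and C: "regular (\<lambda>z. q z - C * local_form x z) (of_real x)"
  shows "C = pole_coeff x"
proof (rule ccontr)
  assume ne: "C \<noteq> pole_coeff x"
  have "regular (\<lambda>z. 1 / (C - pole_coeff x) * ((q z - pole_coeff x * local_form x z) - (q z - C * local_form x z))) (of_real x)"
    by (intro regular_cmult regular_diff pole_coeff x C)
  moreover have "(\<lambda>z. 1 / (C - pole_coeff x) * ((q z - pole_coeff x * local_form x z) - (q z - C * local_form x z))) = local_form x"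
  proof
    fix z
    have "(q z - pole_coeff x * local_form x z) - (q z - C * local_form x z) = (C - pole_coeff x) * local_form x z"
      by (simp add: algebra_simps)
    then show "1 / (C - pole_coeff x) * ((q z - pole_coeff x * local_form x z) - (q z - C * local_form x z)) = local_form x z"
      using ne by simp
  qed
  ultimately show False
    using pole_fun_not_regular[OF k_pos, of x "hecke_conjugate p x"] conjugate_props(4)[OF real_pole_props(1)[OF x]] by auto
qed

text \<open>Slashing the local expansion at V x with V gives one at x with the same coefficient, as
  \<open>pole_fun\<close> is invariant. For the pole-preserving letter, q - q | V is regular at
  x.\<close>

lemma pole_coeff_step:
  assumes x: "x \<in> real_poles" and i: "i \<in> {1..<p}" and y: "moebius_map (V (real i)) x \<in> real_poles"
  shows "pole_coeff (moebius_map (V (real i)) x) = pole_coeff x"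
proof (rule pole_coeff_unique[OF x])
  define M where "M = V (real i)"
  define y where "y = moebius_map M x"
  define a where "a = complex_of_real x"
  have yP: "y \<in> real_poles" using y by (simp add: y_def M_def)
  note h = real_pole_props(1)[OF x]
  have MG: "M \<in> G" and dM: "det M = 1" by (simp_all add: M_def)
  have Ma: "moebius_map M a = of_real y" by (simp add: a_def y_def moebius_map_of_real)
  have nz: "aut_factor M x \<noteq> 0" "aut_factor M (hecke_conjugate p x) \<noteq> 0"
    using noncuspD[OF hyperbolic_fixed_points_noncusp[OF h] MG]
      noncuspD[OF hyperbolic_fixed_points_noncusp[OF conjugate_hyperbolic[OF h]] MG] .
  then have nza: "aut_factor M a \<noteq> 0" by (simp add: a_def)
  have y': "hecke_conjugate p y = moebius_map M (hecke_conjugate p x)"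
    unfolding y_def by (rule hyperbolic_form_moebius(2)[OF h MG])
  have "a \<in> poles" using real_poles_in_poles[OF x] by (simp add: a_def)
  moreover have "moebius_map M a \<in> poles" unfolding Ma by (rule real_poles_in_poles[OF yP])
  ultimately have "i = letter a" using i by (intro letter_unique) (auto simp: M_def)
  then have 1: "regular (\<lambda>z. q z - slash k q M z) a"
    using q_diff_slash_letter[OF \<open>a \<in> poles\<close>] by (simp add: M_def)
  have "regular (\<lambda>z. q z - pole_coeff y * local_form y z) (moebius_map M a)"
    unfolding Ma by (rule pole_coeff[OF yP])
  then have "regular (slash k (\<lambda>z. q z - pole_coeff y * local_form y z) M) a"
    by (rule regular_slash[OF dM nza])
  from regular_add[OF 1 this]
  have "regular (\<lambda>z. (q z - slash k q M z) + slash k (\<lambda>z. q z - pole_coeff y * local_form y z) M z) a" .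
  moreover have "\<forall>\<^sub>F z in at a. (q z - slash k q M z) + slash k (\<lambda>z. q z - pole_coeff y * local_form y z) M z =
      q z - pole_coeff y * local_form x z"
    using eventually_aut_factor_nonzero[OF nza]
  proof eventually_elim
    case (elim z)
    have "slash k (\<lambda>z. q z - pole_coeff y * local_form y z) M z =
        slash k q M z - pole_coeff y * slash k (local_form y) M z"
      by (simp add: slash_alt diff_divide_distrib)
    also have "slash k (local_form y) M z = local_form x z"
      unfolding y' unfolding y_def by (rule pole_fun_moebius[OF dM nz elim])
    finally show ?case by simp
  qed
  ultimately show "regular (\<lambda>z. q z - pole_coeff (moebius_map (V (real i)) x) * local_form x z) (of_real x)"
    unfolding a_def[symmetric] M_def[symmetric] y_def[symmetric] by (rule regular_cong[rotated])
qed

text \<open>Induction from the right, since the last letter acts first. A negative final conjugate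
  forces that letter to be the one carrying x to a pole.\<close>

lemma word_pole:
  assumes "x \<in> real_poles" "is_word xs" "moebius_map (word_mat xs) (hecke_conjugate p x) < 0"
  shows "moebius_map (word_mat xs) x \<in> real_poles \<and> pole_coeff (moebius_map (word_mat xs) x) = pole_coeff x"
  using assms
proof (induction xs arbitrary: x rule: rev_induct)
  case (snoc i xs)
  define x' where "x' = hecke_conjugate p x"
  note h = real_pole_props[OF snoc.prems(1)]
  have i: "i \<in> {1..<p}" "is_word xs" using snoc.prems by auto
  have nc: "noncusp p x" "noncusp p x'"
    using hyperbolic_fixed_points_noncusp h(1) conjugate_hyperbolic by (auto simp: x'_def)
  have m: "moebius_map (word_mat (xs @ [i])) y = moebius_map (word_mat xs) (moebius_map (V (real i)) y)"
    if "noncusp p y" for y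
    using noncuspD[OF that V_in_G[of i]] by (simp add: word_mat_append moebius_map_mult)
  \<comment> \<open>The rest of the word keeps positive points positive, so the conjugate must
    already be negative here.\<close>
  have neg: "moebius_map (V (real i)) x' < 0"
  proof (rule ccontr)
    assume "\<not> moebius_map (V (real i)) x' < 0"
    moreover have "moebius_map (V (real i)) x' \<noteq> 0"
      using noncusp_nonzero[OF noncusp_moebius[OF nc(2) V_in_G[of i]]] .
    ultimately have "moebius_map (word_mat xs) (moebius_map (V (real i)) x') > 0"
      using word_mat_pos(2)[OF i(2)] by simp
    then show False using snoc.prems(3) m[OF nc(2)] by (simp add: x'_def)
  qed
  define l where "l = letter (of_real x)"
  have l: "l \<in> {1..<p}" "moebius_map (V (real l)) (complex_of_real x) \<in> poles"
    using letter[OF real_poles_in_poles[OF snoc.prems(1)]] by (auto simp: l_def shift_def)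
  then have lP: "moebius_map (V (real l)) x \<in> real_poles"
    by (simp add: moebius_map_of_real poles_def real_poles_def)
  \<comment> \<open>The conjugate of the pole reached by the letter l is negative as well, and at
    most one letter makes x' negative.\<close>
  have "moebius_map (V (real l)) x' < 0"
    using real_pole_props(3)[OF lP] hyperbolic_form_moebius(2)[OF h(1) V_in_G[of l]] by (simp add: x'_def)
  then have il: "i = l" using V_negative_unique[OF nc(2) i(1) l(1) neg] by blast
  have iP: "moebius_map (V (real i)) x \<in> real_poles" using lP il by simp
  have conj: "hecke_conjugate p (moebius_map (V (real i)) x) = moebius_map (V (real i)) x'"
    unfolding x'_def by (rule hyperbolic_form_moebius(2)[OF h(1) V_in_G])
  have "moebius_map (word_mat xs) (hecke_conjugate p (moebius_map (V (real i)) x)) < 0"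
    using snoc.prems(3) m[OF nc(2)] unfolding conj x'_def by simp
  from snoc.IH[OF iP i(2) this] show ?case
    using pole_coeff_step[OF snoc.prems(1) i(1) iP] m[OF nc(1)] by simp
qed simp

text \<open>Precomposing Y with r periods W changes neither Y x nor Y x', since W fixes both points.
  The product is then a word up to sign, to which \<open>word_pole\<close> applies.\<close>

lemma orbit_pole:
  assumes x: "x \<in> real_poles" and Y: "Y \<in> G" "moebius_map Y x > 0" "moebius_map Y (hecke_conjugate p x) < 0"
  shows "moebius_map Y x \<in> real_poles \<and> pole_coeff (moebius_map Y x) = pole_coeff x"
proof -
  note h = real_pole_props[OF x]
  define x' where "x' = hecke_conjugate p x"
  obtain xs where xs: "is_word xs" "xs \<noteq> []" "moebius_map (word_mat xs) x = x" using h(5) by blast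
  obtain r where r: "reduces Y r" using reduces_G[OF Y(1)] by blast
  define W where "W = word_mat xs"
  have f: "fixes_point W x" using word_fixed_real(4)[OF xs(1,2) h(2) xs(3)] by (simp add: W_def)
  then have f': "fixes_point W x'"
    unfolding x'_def by (intro stabilizer_fixes_conjugate[OF h(1)]) (simp add: hecke_stabilizer_def W_def)
  define zs where "zs = concat (replicate r xs)"
  have zs: "is_word zs" "word_mat zs = mat_pow W r"
    using is_word_replicate[OF xs(1)] by (simp_all add: zs_def W_def word_mat_replicate)
  have "length zs = r * length xs" by (simp add: zs_def length_concat sum_list_replicate)
  then have len: "length zs \<ge> r" using xs(2) by (cases xs) auto
  have fz: "fixes_point (mat_pow W r) x" "fixes_point (mat_pow W r) x'"
    using mat_pow_fixes_point[OF f, of r] mat_pow_fixes_point[OF f', of r] by auto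
  then obtain ys where ys: "is_word ys" "eq_sign (Y ** mat_pow W r) (word_mat ys)"
    using reduces_pos[OF r zs(1) len h(2)] Y(2) by (auto simp: zs(2) fixes_point_alt)
  have m: "moebius_map (word_mat ys) y = moebius_map Y y" if "fixes_point (mat_pow W r) y" for y :: real
  proof -
    have nz: "aut_factor (mat_pow W r) y \<noteq> 0" and e: "moebius_map (mat_pow W r) y = y"
      using that by (auto simp: fixes_point_alt)
    show ?thesis
      using eq_sign_moebius[OF ys(2), of y] unfolding moebius_map_mult[OF nz] e by simp
  qed
  have "moebius_map (word_mat ys) (hecke_conjugate p x) < 0"
    using Y(3) m[OF fz(2)] by (simp add: x'_def)
  from word_pole[OF x ys(1) this] show ?thesis using m[OF fz(1)] by simp
qed

lemma pole_cycle_real_pole: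
  assumes x: "x \<in> real_poles"
  shows "pole_cycle p (form_class x) = {y \<in> real_poles. form_class y = form_class x}"
    "y \<in> pole_cycle p (form_class x) \<Longrightarrow> pole_coeff y = pole_coeff x"
proof -
  note h = real_pole_props[OF x]
  have sub: "y \<in> real_poles \<and> pole_coeff y = pole_coeff x \<and> form_class y = form_class x"
    if y: "y \<in> pole_cycle p (form_class x)" for y
  proof -
    obtain Y where Y: "Y \<in> G" "y = moebius_map Y x" "moebius_map Y x > 0" "moebius_map Y (hecke_conjugate p x) < 0"
      using y unfolding pole_cycle_form_class[OF h(1)] by blast
    have "y \<in> hyperbolic_fixed_points p" "hyperbolic_form p y \<in> form_class x"
      using y by (auto simp: pole_cycle_def)
    then show ?thesis
      using orbit_pole[OF x Y(1,3,4)] form_class_eq[OF h(1)] by (simp add: Y(2))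
  qed
  show "y \<in> pole_cycle p (form_class x) \<Longrightarrow> pole_coeff y = pole_coeff x" using sub by blast
  show "pole_cycle p (form_class x) = {y \<in> real_poles. form_class y = form_class x}"
  proof (intro equalityI subsetI)
    fix y assume "y \<in> pole_cycle p (form_class x)"
    then show "y \<in> {y \<in> real_poles. form_class y = form_class x}" using sub by blast
  next
    fix y assume y: "y \<in> {y \<in> real_poles. form_class y = form_class x}"
    then have hy: "y \<in> hyperbolic_fixed_points p" "y > 0" "hecke_conjugate p y < 0"
      using real_pole_props[of y] by auto
    then show "y \<in> pole_cycle p (form_class x)"
      using y self_in_form_class[OF hy(1)] simple_iff[OF hy(1)] by (simp add: pole_cycle_def)
  qed
qed

section \<open>Behaviour on the rest of the Riemann sphere\<close>

lemma q_regular_T: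
  assumes "a \<noteq> 0" "regular q (- 1 / a)"
  shows "regular q a"
proof (rule regular_cong)
  show "\<forall>\<^sub>F z in at a. - slash k q hecke_T z = q z"
    using eventually_at_cofinite[OF q_slash_T] by eventually_elim simp
  show "regular (\<lambda>z. - slash k q hecke_T z) a"
    using assms by (intro regular_minus regular_slash) (simp_all add: moebius_map_T)
qed

text \<open>Each letter maps the punctured imaginary axis into the open right half plane, where all
  poles are real. The image is not real, because the inverse letter is a real matrix and a is not
  real.\<close>

lemma q_regular_imaginary:
  assumes "Re a = 0" "a \<noteq> 0"
  shows "regular q a"
proof (rule q_regular_step)
  fix i assume i: "i \<in> {1..<p}"
  define M where "M = V (real i)"
  have M: "nonneg_mat M" "M$1$1 > 0" "M$2$2 > 0"
    using i sn_pos[of "real i"] by (auto simp: M_def)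
  define y where "y = Im a"
  have y: "y \<noteq> 0" using assms by (auto simp: y_def complex_eq_iff)
  have ReM: "Re (aut_factor M a) = M$2$2" by (simp add: aut_factor_def assms)
  have nz: "aut_factor M a \<noteq> 0" using ReM M(3) by auto
  have "Re (moebius_map M a) = ((M$1$1 * y) * (M$2$1 * y) + M$1$2 * M$2$2) / ((M$2$2)\<^sup>2 + (M$2$1 * y)\<^sup>2)"
    by (simp add: moebius_map_def Re_divide assms y_def)
  moreover have "(M$1$1 * y) * (M$2$1 * y) + M$1$2 * M$2$2 > 0"
  proof -
    have "word_mat [i] $ 1 $ 2 + word_mat [i] $ 2 $ 1 > 0" using i by (intro word_mat_offdiag) auto
    then have pos: "M$1$2 + M$2$1 > 0" by (simp add: M_def)
    have e: "(M$1$1 * y) * (M$2$1 * y) = (M$1$1 * y\<^sup>2) * M$2$1" by (simp add: power2_eq_square)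
    have nn: "M$1$2 \<ge> 0" "M$2$1 \<ge> 0" using M(1) by (auto simp: nonneg_mat_def)
    show ?thesis unfolding e
    proof (cases "M$1$2 > 0")
      case True
      then show "M$1$1 * y\<^sup>2 * M$2$1 + M$1$2 * M$2$2 > 0"
        using M(2) y nn \<open>M$1$2 > 0\<close> M(3) by (intro add_nonneg_pos mult_nonneg_nonneg mult_pos_pos) auto
    next
      case False
      then have "M$2$1 > 0" using nn pos by simp
      then show "M$1$1 * y\<^sup>2 * M$2$1 + M$1$2 * M$2$2 > 0"
        using M(2) y nn M(3) by (intro add_pos_nonneg mult_nonneg_nonneg mult_pos_pos) auto
    qed
  qed
  moreover have "(M$2$2)\<^sup>2 + (M$2$1 * y)\<^sup>2 > 0" using M(3) by (intro add_pos_nonneg) auto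
  ultimately have pos: "Re (moebius_map M a) > 0" by simp
  have "regular q (moebius_map M a)"
  proof (rule ccontr)
    assume "\<not> regular q (moebius_map M a)"
    then have "moebius_map M a \<in> poles" using pos by (simp add: poles_def)
    then obtain x where x: "moebius_map M a = of_real x" using poles_real by blast
    have "det M = 1" using M(1) by (simp add: nonneg_mat_def)
    then have "a = of_real (moebius_map (adj2 M) x)"
      using moebius_map_adj[OF _ nz] x by (simp add: moebius_map_of_real)
    then have "Im a = 0" by (metis Im_complex_of_real)
    then show False using y by (simp add: y_def)
  qed
  then show "aut_factor (V (real i)) a \<noteq> 0 \<and> regular q (moebius_map (V (real i)) a)"
    using nz by (simp add: M_def)
qed

lemma aut_factor_at_infinity:
  assumes "M$2$1 \<noteq> 0"
  shows "filterlim (aut_factor M) (at_infinity :: complex filter) at_infinity"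
proof -
  have "filterlim (\<lambda>z::complex. of_real (M$2$1) * z) at_infinity at_infinity"
    using assms by (intro tendsto_mult_filterlim_at_infinity[OF tendsto_const] filterlim_ident) simp
  then have "filterlim (\<lambda>z::complex. of_real (M$2$2) + of_real (M$2$1) * z) at_infinity at_infinity"
    by (rule tendsto_add_filterlim_at_infinity[OF tendsto_const])
  then show ?thesis by (simp add: aut_factor_def [abs_def] add.commute)
qed

text \<open>M z tends to the image of infinity, where f is regular, while the denominator tends to
  infinity.\<close>

lemma slash_at_infinity:
  fixes f :: "complex \<Rightarrow> complex"
  assumes M: "det M = 1" "M$2$1 \<noteq> 0" and f: "regular f (of_real (M$1$1 / M$2$1))"
  shows "(slash k f M \<longlongrightarrow> 0) at_infinity"
proof -
  define a where "a = complex_of_real (M$1$1 / M$2$1)"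
  obtain l where l: "(f \<longlongrightarrow> l) (at a)" using f by (auto simp: regular_def a_def)
  note af = aut_factor_at_infinity[OF M(2)]
  have nz: "\<forall>\<^sub>F z in at_infinity. aut_factor M z \<noteq> (0::complex)"
    using af by (rule filterlim_at_infinity_imp_eventually_ne)
  have d: "complex_of_real (M$1$1) * of_real (M$2$2) = 1 + of_real (M$1$2) * of_real (M$2$1)"
    using arg_cong[OF det_eq_1D[OF M(1)], of complex_of_real] by simp
  have e: "\<forall>\<^sub>F z in at_infinity. moebius_map M z = a - 1 / (of_real (M$2$1) * aut_factor M z)"
    using nz
  proof eventually_elim
    case (elim z)
    define c where "c = complex_of_real (M$2$1)"
    have c: "c \<noteq> 0" using M(2) by (simp add: c_def)
    have "c * (of_real (M$1$1) * z + of_real (M$1$2)) = of_real (M$1$1) * aut_factor M z - 1"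
      using d by (simp add: aut_factor_def c_def algebra_simps)
    then have "of_real (M$1$1) * z + of_real (M$1$2) = (of_real (M$1$1) * aut_factor M z - 1) / c"
      using c by (simp add: nonzero_eq_divide_eq mult.commute)
    then have "moebius_map M z = (of_real (M$1$1) * aut_factor M z - 1) / c / aut_factor M z"
      unfolding moebius_map_alt by (rule arg_cong)
    also have "\<dots> = a - 1 / (c * aut_factor M z)"
      using elim c by (simp add: a_def c_def diff_divide_distrib)
    finally show ?case by (simp add: c_def)
  qed
  have "((\<lambda>z. a - 1 / (of_real (M$2$1) * aut_factor M z)) \<longlongrightarrow> a - 0) at_infinity"
    using M(2) by (intro tendsto_diff tendsto_const tendsto_divide_0[OF tendsto_const]
        tendsto_mult_filterlim_at_infinity[OF tendsto_const] af) auto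
  then have "(moebius_map M \<longlongrightarrow> a) at_infinity"
    using e by (auto elim!: Lim_transform_eventually eventually_mono)
  \<comment> \<open>The limit of f is known only in the punctured neighbourhood, so the value a has
    to be avoided.\<close>
  moreover have "\<forall>\<^sub>F z in at_infinity. moebius_map M z \<noteq> a"
    using e nz by eventually_elim (use M(2) in simp)
  ultimately have lim: "filterlim (moebius_map M) (at a) at_infinity"
    by (simp add: filterlim_at)
  have "((\<lambda>z. f (moebius_map M z)) \<longlongrightarrow> l) at_infinity"
    by (rule filterlim_compose[OF l lim])
  moreover have "filterlim (\<lambda>z. aut_factor M z ^ (2 * k)) (at_infinity :: complex filter) at_infinity"
    using k_pos by (intro filterlim_power_at_infinity[THEN filterlim_compose] af) auto
  ultimately show ?thesis
    unfolding slash_alt [abs_def] by (rule tendsto_divide_0)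
qed

lemma q_shift_at_infinity: "((\<lambda>z. q z - q (z + of_real (hecke_lambda p))) \<longlongrightarrow> 0) at_infinity"
proof (rule Lim_transform_eventually)
  show "((\<lambda>z. \<Sum>i\<in>{1..<p} - {p - 1}. slash k q (V (real i)) z) \<longlongrightarrow> 0) at_infinity"
  proof (rule tendsto_null_sum)
    fix i assume i: "i \<in> {1..<p} - {p - 1}"
    define M where "M = V (real i)"
    have pos: "M$1$1 > 0" "M$2$1 > 0"
      using i sn_pos[of "real i"] sn_pos[of "real i + 1"] by (auto simp: M_def)
    have "regular q (of_real (M$1$1 / M$2$1))"
    proof (rule ccontr)
      assume "\<not> regular q (of_real (M$1$1 / M$2$1))"
      then have "M$1$1 / M$2$1 \<in> real_poles" using pos by (simp add: real_poles_def)
      then have "noncusp p (M$1$1 / M$2$1)"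
        using real_pole_props(1) hyperbolic_fixed_points_noncusp by blast
      \<comment> \<open>The inverse of M sends this point to infinity, so it is a cusp, while poles
        are not cusps.\<close>
      moreover have "adj2 M \<in> G" by (simp add: M_def)
      ultimately have "aut_factor (adj2 M) (M$1$1 / M$2$1) \<noteq> 0" by (rule noncuspD)
      then show False using pos by (simp add: aut_factor_def)
    qed
    then have "(slash k q M \<longlongrightarrow> 0) at_infinity"
      using pos by (intro slash_at_infinity) (auto simp: M_def)
    then show "(slash k q (V (real i)) \<longlongrightarrow> 0) at_infinity" by (simp add: M_def)
  qed
  show "\<forall>\<^sub>F z in at_infinity. (\<Sum>i\<in>{1..<p} - {p - 1}. slash k q (V (real i)) z) = q z - q (z + of_real (hecke_lambda p))"
    using eventually_at_infinity_cofinite[OF q_sum_V]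
  proof eventually_elim
    case (elim z)
    have "slash k q (V (real (p - 1))) z = q (z + of_real (hecke_lambda p))"
      unfolding hecke_S_eq[symmetric] by (simp add: slash_def moebius_map_def hecke_S_def)
    then show ?case
      using elim p_ge_3 sum_diff1[of "{1..<p}" "\<lambda>i. slash k q (V (real i)) z" "p - 1"] by simp
  qed
qed

end

section \<open>Limits at infinity of rational functions\<close>

lemma poly_tendsto_0_at_infinity:
  fixes P :: "complex poly"
  assumes "(poly P \<longlongrightarrow> 0) at_infinity"
  shows "P = 0"
proof (cases "Polynomial.degree P = 0")
  case True
  then obtain c where c: "P = [:c:]" by (meson degree_eq_zeroE)
  then have "poly P = (\<lambda>_. c)" by auto
  then have "((\<lambda>_::complex. c) \<longlongrightarrow> 0) at_infinity" using assms by simp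
  from tendsto_unique[OF trivial_limit_at_infinity tendsto_const this] have "c = 0" .
  then show ?thesis using c by simp
next
  case False
  then have "filterlim (poly P) at_infinity at_infinity" by (intro filterlim_poly_at_infinity) auto
  then show ?thesis using assms not_tendsto_and_filterlim_at_infinity[OF trivial_limit_at_infinity] by blast
qed

text \<open>Split f into a polynomial N and a proper fraction. N (z) - N (z + t) is a polynomial
  tending to 0, hence zero; a polynomial with a nonzero period is constant.\<close>

lemma rational_almost_periodic_limit:
  fixes f :: "complex \<Rightarrow> complex" and t :: complex
  assumes f: "rational_function f" and t: "t \<noteq> 0"
    and lim: "((\<lambda>z. f z - f (z + t)) \<longlongrightarrow> 0) at_infinity"
  shows "\<exists>l. (f \<longlongrightarrow> l) at_infinity"
proof -
  obtain P Q where Q: "Q \<noteq> 0" "\<And>z. poly Q z \<noteq> 0 \<Longrightarrow> f z = poly P z / poly Q z"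
    using f unfolding rational_function_def by blast
  define N R where "N = P div Q" and "R = P mod Q"
  have "((\<lambda>z. poly R z / poly Q z) \<longlongrightarrow> 0) at_infinity"
  proof (cases "R = 0")
    case False
    then have "Polynomial.degree R < Polynomial.degree Q"
      using degree_mod_less'[OF Q(1)] by (simp add: R_def)
    then show ?thesis by (rule poly_divide_tendsto_0_at_infinity)
  qed simp
  then have R: "((\<lambda>z. f z - poly N z) \<longlongrightarrow> 0) at_infinity"
  proof (rule Lim_transform_eventually)
    have "\<forall>\<^sub>F z in at_infinity. poly Q z \<noteq> 0"
      using poly_roots_finite[OF Q(1)] by (intro eventually_at_infinity_cofinite) (simp add: eventually_cofinite)
    then show "\<forall>\<^sub>F z in at_infinity. poly R z / poly Q z = f z - poly N z"
    proof eventually_elim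
      case (elim z)
      have "P = N * Q + R" by (simp add: N_def R_def)
      then have "poly P z = poly N z * poly Q z + poly R z" by (metis poly_add poly_mult)
      then show ?case using elim by (simp add: Q(2) add_divide_distrib)
    qed
  qed
  have sh: "filterlim (\<lambda>z::complex. z + t) at_infinity at_infinity"
    using tendsto_add_filterlim_at_infinity[OF tendsto_const[of t] filterlim_ident[of "at_infinity :: complex filter"]]
    by (simp add: add.commute)
  have R': "((\<lambda>z. f (z + t) - poly N (z + t)) \<longlongrightarrow> 0) at_infinity"
    by (rule filterlim_compose[OF R sh])
  define D where "D = N - pcompose N [:t, 1:]"
  have D: "poly D z = poly N z - poly N (z + t)" for z
    by (simp add: D_def poly_pcompose add.commute)
  have "((\<lambda>z. (f z - f (z + t)) - (f z - poly N z) + (f (z + t) - poly N (z + t))) \<longlongrightarrow> 0 - 0 + 0) at_infinity"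
    by (intro tendsto_add tendsto_diff lim R R')
  then have "(poly D \<longlongrightarrow> 0) at_infinity" by (simp add: D [abs_def])
  then have "D = 0" by (rule poly_tendsto_0_at_infinity)
  then have per: "poly N (z + t) = poly N z" for z using D[of z] by simp
  have "poly N (of_nat n * t) = poly N 0" for n
    by (induction n) (simp_all add: distrib_right add.commute[of t] per)
  then have "range (\<lambda>n. of_nat n * t) \<subseteq> {z. poly (N - [:poly N 0:]) z = 0}" by auto
  moreover have "infinite (range (\<lambda>n. of_nat n * t))"
    using t by (intro range_inj_infinite) (auto simp: inj_def)
  ultimately have "infinite {z. poly (N - [:poly N 0:]) z = 0}" using finite_subset by blast
  then have "N - [:poly N 0:] = 0" using poly_roots_finite by blast
  then have "poly N z = poly N 0" for z by (metis eq_iff_diff_eq_0 poly_const_conv poly_pCons poly_0 mult_zero_right add_0_right)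
  then have "(\<lambda>z. f z - poly N z) = (\<lambda>z. f z - poly N 0)" by (intro ext) simp
  then have "((\<lambda>z. f z - poly N 0) \<longlongrightarrow> 0) at_infinity" using R by simp
  then show ?thesis using LIM_zero_cancel by blast
qed

context hecke
begin

text \<open>A (x - x') = sqrt D gives D^(k/2) = A^k (x - x')^k, and A^k cancels against the k-th
  power of the factored form.\<close>

lemma q_hyp_eq:
  assumes x: "x \<in> hyperbolic_fixed_points p"
  shows "q_hyp p k x = principal_part (of_real x) (pole_fun k x (hecke_conjugate p x))"
proof -
  define Q x' where "Q = hyperbolic_form p x" and "x' = hecke_conjugate p x"
  note h = hyperbolic_form_props[OF x, folded Q_def]
  note c = conjugate_props[OF x, folded Q_def x'_def]
  have "discriminant Q powr (real k / 2) = (discriminant Q powr (1 / 2)) powr real k"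
    by (simp add: powr_powr)
  also have "\<dots> = sqrt (discriminant Q) ^ k"
    using h(2) by (simp add: powr_half_sqrt powr_realpow)
  finally have D: "discriminant Q powr (real k / 2) = coeff_A Q ^ k * (x - x') ^ k"
    unfolding c(1)[symmetric] by (simp add: power_mult_distrib)
  have "(\<lambda>z. of_real (discriminant Q powr (real k / 2)) / eval_bqf Q z 1 ^ k) = pole_fun k x x'"
    unfolding c(5) D pole_fun_def [abs_def] using h(1) by (simp add: power_mult_distrib)
  then show ?thesis by (simp add: q_hyp_def Q_def[symmetric] x'_def[symmetric])
qed

end

section \<open>Subtracting the principal parts\<close>

context rpf
begin

text \<open>Summed over single poles for local analysis; \<open>correction_by_classes\<close>
  regroups the terms into cycles.\<close>

definition correction :: "complex \<Rightarrow> complex" where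
  "correction z = (\<Sum>x\<in>real_poles. pole_coeff x * (q_hyp p k x z - q_hyp p k (moebius_map hecke_T x) z))"

definition remainder :: "complex \<Rightarrow> complex" where
  "remainder z = q z - correction z"

lemma real_pole_T:
  assumes "x \<in> real_poles"
  shows "moebius_map hecke_T x \<in> hyperbolic_fixed_points p" "moebius_map hecke_T x < 0"
    "hecke_conjugate p (moebius_map hecke_T x) = moebius_map hecke_T (hecke_conjugate p x)"
  using real_pole_props(1,2)[OF assms] hyperbolic_fixed_points_moebius[of x hecke_T] hyperbolic_form_moebius(2)[of x hecke_T]
  by (simp_all add: moebius_map_T)

lemma q_hyp_regular: "x \<in> hyperbolic_fixed_points p \<Longrightarrow> a \<noteq> of_real x \<Longrightarrow> regular (q_hyp p k x) a"
  by (simp add: q_hyp_eq principal_part_regular)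

lemma q_hyp_rational: "x \<in> hyperbolic_fixed_points p \<Longrightarrow> rational_function (q_hyp p k x)"
  by (simp add: q_hyp_eq principal_part_rational)

lemma q_hyp_at_infinity: "x \<in> hyperbolic_fixed_points p \<Longrightarrow> (q_hyp p k x \<longlongrightarrow> 0) at_infinity"
  by (simp add: q_hyp_eq principal_part_at_infinity)

lemma q_hyp_local: "x \<in> hyperbolic_fixed_points p \<Longrightarrow> regular (\<lambda>z. local_form x z - q_hyp p k x z) (of_real x)"
  by (simp add: q_hyp_eq regular_diff_principal_part pole_fun_meromorphic)

lemma term_regular:
  assumes "x \<in> real_poles" "a \<noteq> of_real x" "a \<noteq> of_real (moebius_map hecke_T x)"
  shows "regular (\<lambda>z. pole_coeff x * (q_hyp p k x z - q_hyp p k (moebius_map hecke_T x) z)) a"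
  using assms real_pole_props(1) real_pole_T(1)
  by (intro regular_cmult regular_diff q_hyp_regular) auto

text \<open>Isolates the one summand that can be singular at a.\<close>

lemma correction_split:
  assumes x: "x \<in> real_poles"
    and other: "\<And>y. y \<in> real_poles \<Longrightarrow> y \<noteq> x \<Longrightarrow> a \<noteq> of_real y \<and> a \<noteq> of_real (moebius_map hecke_T y)"
    and r: "regular (\<lambda>z. q z - pole_coeff x * (q_hyp p k x z - q_hyp p k (moebius_map hecke_T x) z)) a"
  shows "regular remainder a"
proof -
  have "regular (\<lambda>z. (q z - pole_coeff x * (q_hyp p k x z - q_hyp p k (moebius_map hecke_T x) z)) -
      (\<Sum>y\<in>real_poles - {x}. pole_coeff y * (q_hyp p k y z - q_hyp p k (moebius_map hecke_T y) z))) a"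
    using other by (intro regular_diff[OF r] regular_sum term_regular) auto
  moreover have "correction z = pole_coeff x * (q_hyp p k x z - q_hyp p k (moebius_map hecke_T x) z) +
      (\<Sum>y\<in>real_poles - {x}. pole_coeff y * (q_hyp p k y z - q_hyp p k (moebius_map hecke_T y) z))" for z
    unfolding correction_def by (rule sum.remove[OF finite_real_poles x])
  ultimately show ?thesis by (simp add: remainder_def [abs_def] diff_diff_eq)
qed

text \<open>The right half plane uses the local coefficients, the imaginary axis has neither poles
  nor correction terms, and the left half plane is carried to the right one by T.\<close>

lemma remainder_regular:
  assumes a: "a \<noteq> 0"
  shows "regular remainder a"
proof -
  have T_inj: "x = y" if "moebius_map hecke_T x = moebius_map hecke_T y" for x y :: real
    using that by (simp add: moebius_map_T)
  have none: "regular remainder a" if "regular q a"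
      "\<And>y. y \<in> real_poles \<Longrightarrow> a \<noteq> of_real y \<and> a \<noteq> of_real (moebius_map hecke_T y)"
    unfolding remainder_def [abs_def] correction_def using that by (intro regular_diff regular_sum term_regular) auto
  consider "Re a > 0" | "Re a = 0" | "Re a < 0" by linarith
  then show ?thesis
  proof cases
    case 1
    then have notT: "a \<noteq> of_real (moebius_map hecke_T y)" if "y \<in> real_poles" for y
      using real_pole_T(2)[OF that] by auto
    show ?thesis
    proof (cases "regular q a")
      case True
      then show ?thesis using notT by (intro none) (auto simp: real_poles_def)
    next
      case False
      then have "a \<in> poles" using 1 by (simp add: poles_def)
      then obtain x where x: "x \<in> real_poles" "a = of_real x" by (rule poles_real)
      have "regular (\<lambda>z. (q z - pole_coeff x * local_form x z) + pole_coeff x * (local_form x z - q_hyp p k x z)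
          + pole_coeff x * q_hyp p k (moebius_map hecke_T x) z) a"
        using pole_coeff[OF x(1)] q_hyp_local[OF real_pole_props(1)[OF x(1)]] notT[OF x(1)] real_pole_T(1)[OF x(1)]
        by (intro regular_add regular_cmult q_hyp_regular) (simp_all add: x(2))
      then have "regular (\<lambda>z. q z - pole_coeff x * (q_hyp p k x z - q_hyp p k (moebius_map hecke_T x) z)) a"
        by (simp add: algebra_simps)
      then show ?thesis
        by (rule correction_split[OF x(1), rotated]) (use notT x(2) in auto)
    qed
  next
    case 2
    have "a \<noteq> of_real y \<and> a \<noteq> of_real (moebius_map hecke_T y)" if "y \<in> real_poles" for y
      using 2 real_pole_T(2)[OF that] real_pole_props(2)[OF that] by auto
    then show ?thesis by (intro none q_regular_imaginary[OF 2 a]) auto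
  next
    case 3
    then have notp: "a \<noteq> of_real y" if "y \<in> real_poles" for y
      using that by (auto simp: real_poles_def)
    define b where "b = moebius_map hecke_T a"
    have ab: "a = moebius_map hecke_T b" "b \<noteq> 0" using a by (auto simp: b_def moebius_map_T)
    have Re_b: "Re b > 0"
    proof -
      have "Re b = - (Re a / ((Re a)\<^sup>2 + (Im a)\<^sup>2))" by (simp add: b_def moebius_map_T Re_divide)
      moreover have "Re a / ((Re a)\<^sup>2 + (Im a)\<^sup>2) < 0"
        using 3 by (intro divide_neg_pos add_pos_nonneg) auto
      ultimately show ?thesis by simp
    qed
    show ?thesis
    proof (cases "regular q b")
      case True
      then have "regular q a" using q_regular_T[OF a] by (simp add: b_def moebius_map_T)
      moreover have "a \<noteq> of_real (moebius_map hecke_T y)" if "y \<in> real_poles" for y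
      proof
        assume "a = of_real (moebius_map hecke_T y)"
        then have "b = of_real y" by (simp add: b_def moebius_map_T)
        then show False using True that by (simp add: real_poles_def)
      qed
      ultimately show ?thesis using notp by (intro none) auto
    next
      case False
      then have "b \<in> poles" using Re_b by (simp add: poles_def)
      then obtain x where x: "x \<in> real_poles" "b = of_real x" by (rule poles_real)
      define y where "y = moebius_map hecke_T x"
      note h = real_pole_props[OF x(1)]
      note t = real_pole_T[OF x(1), folded y_def]
      have ay: "a = of_real y" using x(2) ab by (simp add: y_def moebius_map_T)
      have Tb: "moebius_map hecke_T a = of_real x" using x(2) by (simp add: b_def)
      have y0: "y \<noteq> 0" "hecke_conjugate p y \<noteq> 0"
        using t h by (auto simp: moebius_map_T)
      have xy: "x = moebius_map hecke_T y" "hecke_conjugate p x = moebius_map hecke_T (hecke_conjugate p y)"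
        unfolding t(3) by (simp_all add: y_def moebius_map_T)
      \<comment> \<open>Together with q | T = -q this gives q at T x the opposite coefficient, which
        explains the minus sign in \<open>correction\<close>.\<close>
      have inv: "slash k (local_form x) hecke_T z = local_form y z" if "z \<noteq> 0" for z
        using pole_fun_moebius[of hecke_T y "hecke_conjugate p y" z k] y0 that
        unfolding xy(1)[symmetric] xy(2)[symmetric] by simp
      have "regular (slash k (\<lambda>z. q z - pole_coeff x * local_form x z) hecke_T) a"
        using a pole_coeff[OF x(1)] by (intro regular_slash) (simp_all add: Tb)
      then have "regular (\<lambda>z. - slash k (\<lambda>z. q z - pole_coeff x * local_form x z) hecke_T z) a"
        by (rule regular_minus)
      moreover have "\<forall>\<^sub>F z in at a. - slash k (\<lambda>z. q z - pole_coeff x * local_form x z) hecke_T z =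
          q z + pole_coeff x * local_form y z"
      proof -
        have "\<forall>\<^sub>F z in cofinite. z \<noteq> (0::complex)" by (simp add: eventually_cofinite)
        then have "\<forall>\<^sub>F z in at a. z \<noteq> 0" by (rule eventually_at_cofinite)
        then show ?thesis using eventually_at_cofinite[OF q_slash_T]
        proof eventually_elim
          case (elim z)
          have "slash k (\<lambda>z. q z - pole_coeff x * local_form x z) hecke_T z =
              slash k q hecke_T z - pole_coeff x * slash k (local_form x) hecke_T z"
            by (simp add: slash_alt diff_divide_distrib)
          then show ?case using inv[OF elim(1)] elim(2) by simp
        qed
      qed
      ultimately have q1: "regular (\<lambda>z. q z + pole_coeff x * local_form y z) a"
        by (rule regular_cong[rotated])
      have "regular (\<lambda>z. (q z + pole_coeff x * local_form y z) - pole_coeff x * (local_form y z - q_hyp p k y z)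
          - pole_coeff x * q_hyp p k x z) a"
        using q1 q_hyp_local[OF t(1)] notp[OF x(1)] h(1)
        by (intro regular_diff[OF regular_diff] regular_cmult q_hyp_regular) (simp_all add: ay)
      then have "regular (\<lambda>z. q z - pole_coeff x * (q_hyp p k x z - q_hyp p k (moebius_map hecke_T x) z)) a"
        by (simp add: algebra_simps y_def)
      then show ?thesis
        by (rule correction_split[OF x(1), rotated]) (use notp T_inj in \<open>auto simp: ay y_def\<close>)
    qed
  qed
qed

lemma correction_regular_0: "regular correction 0"
  unfolding correction_def [abs_def]
proof (intro regular_sum term_regular)
  fix x assume x: "x \<in> real_poles"
  then show "0 \<noteq> complex_of_real x" "0 \<noteq> complex_of_real (moebius_map hecke_T x)"
    using real_pole_T(2)[OF x] real_pole_props(2)[OF x] by auto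
qed

lemma correction_at_infinity: "(correction \<longlongrightarrow> 0) at_infinity"
  unfolding correction_def [abs_def]
proof (rule tendsto_null_sum)
  fix x assume x: "x \<in> real_poles"
  have "((\<lambda>z. pole_coeff x * (q_hyp p k x z - q_hyp p k (moebius_map hecke_T x) z)) \<longlongrightarrow> pole_coeff x * (0 - 0)) at_infinity"
    by (intro tendsto_intros q_hyp_at_infinity real_pole_props(1)[OF x] real_pole_T(1)[OF x])
  then show "((\<lambda>z. pole_coeff x * (q_hyp p k x z - q_hyp p k (moebius_map hecke_T x) z)) \<longlongrightarrow> 0) at_infinity"
    by simp
qed

lemma remainder_rational: "rational_function remainder"
  unfolding remainder_def [abs_def] correction_def
  by (intro rational_diff rational_sum rational_mult rational_const q_rational q_hyp_rational real_pole_props(1) real_pole_T(1))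

text \<open>Multiplying by \<open>z\<^sup>2\<^sup>k\<close> removes the only finite singularity of the remainder, so a polynomial is left,
  whose extreme coefficients are related by \<open>q + q | T = 0\<close>.\<close>
lemma remainder_form:
  "\<exists>a0 c. \<forall>\<^sub>F z in cofinite. remainder z = a0 * (1 - 1 / z ^ (2 * k)) + (\<Sum>n=1..2*k-1. c n / z ^ n)"
proof -
  have lam: "complex_of_real (hecke_lambda p) \<noteq> 0"
    unfolding hecke_lambda_eq using sn_pos[of 2] p_ge_3 by simp
  obtain a0 where a0: "(q \<longlongrightarrow> a0) at_infinity"
    using rational_almost_periodic_limit[OF q_rational lam q_shift_at_infinity] by blast
  have Rinf: "(remainder \<longlongrightarrow> a0) at_infinity"
    unfolding remainder_def [abs_def] using tendsto_diff[OF a0 correction_at_infinity] by simp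
  define F where "F z = z ^ (2 * k) * remainder z" for z
  have ratF: "rational_function F"
  proof -
    have "rational_function (\<lambda>z. poly ([:0, 1:] ^ (2 * k)) z * remainder z)"
      by (intro rational_mult rational_poly remainder_rational)
    then show ?thesis by (simp add: F_def [abs_def] poly_power)
  qed
  have ne0: "\<forall>\<^sub>F z in cofinite. z \<noteq> (0::complex)" by (simp add: eventually_cofinite)
  \<comment> \<open>By the T relation z^(2k) q(z) = -q(-1/z), and -1/z tends to infinity.\<close>
  have F0: "(F \<longlongrightarrow> - a0) (at 0)"
  proof (rule Lim_transform_eventually)
    obtain l where l: "(correction \<longlongrightarrow> l) (at 0)" using correction_regular_0 by (auto simp: regular_def)
    have "filterlim (\<lambda>z::complex. - inverse z) at_infinity (at 0)"
      using tendsto_mult_filterlim_at_infinity[OF tendsto_const[of "-1 :: complex"] _ filterlim_inverse_at_infinity]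
      by simp
    then have "((\<lambda>z. q (- inverse z)) \<longlongrightarrow> a0) (at 0)" by (rule filterlim_compose[OF a0])
    then have "((\<lambda>z. - q (- inverse z) - z ^ (2 * k) * correction z) \<longlongrightarrow> - a0 - 0 ^ (2 * k) * l) (at 0)"
      using l by (intro tendsto_intros)
    then show "((\<lambda>z. - q (- inverse z) - z ^ (2 * k) * correction z) \<longlongrightarrow> - a0) (at 0)"
      using k_pos by (simp add: zero_power)
    show "\<forall>\<^sub>F z in at 0. - q (- inverse z) - z ^ (2 * k) * correction z = F z"
      using eventually_at_cofinite[OF q_slash_T] eventually_at_cofinite[OF ne0]
      by eventually_elim (simp add: F_def remainder_def slash_alt moebius_map_T right_diff_distrib inverse_eq_divide)
  qed
  have "regular F a" for a
  proof (cases "a = 0")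
    case True
    then show ?thesis using F0 by (auto intro: regularI)
  next
    case False
    have "regular (\<lambda>z. z ^ (2 * k)) a" by (intro regular_isCont continuous_intros)
    then show ?thesis unfolding F_def [abs_def] by (intro regular_mult remainder_regular[OF False])
  qed
  then obtain H where H: "\<forall>\<^sub>F z in cofinite. F z = poly H z"
    using rational_regular_imp_poly[OF ratF] by blast
  have H0: "poly H 0 = - a0"
  proof -
    have "(poly H \<longlongrightarrow> - a0) (at 0)"
      using F0 eventually_at_cofinite[OF H] by (rule Lim_transform_eventually)
    moreover have "(poly H \<longlongrightarrow> poly H 0) (at 0)" using poly_isCont[of 0 H] by (simp add: isCont_def)
    ultimately show ?thesis using tendsto_unique[OF trivial_limit_at] by blast
  qed
  \<comment> \<open>H2 / z^(2k) is the remainder minus its limit at infinity; its decay forces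
    degree below 2k.\<close>
  define H2 where "H2 = H - Polynomial.monom a0 (2 * k)"
  have H2z: "poly H2 z = poly H z - a0 * z ^ (2 * k)" for z by (simp add: H2_def poly_monom)
  have H2lim: "((\<lambda>z. poly H2 z / z ^ (2 * k)) \<longlongrightarrow> 0) at_infinity"
  proof (rule Lim_transform_eventually)
    show "((\<lambda>z. remainder z - a0) \<longlongrightarrow> 0) at_infinity" using Rinf by (rule LIM_zero)
    show "\<forall>\<^sub>F z in at_infinity. remainder z - a0 = poly H2 z / z ^ (2 * k)"
      using eventually_at_infinity_cofinite[OF H] eventually_at_infinity_cofinite[OF ne0]
    proof eventually_elim
      case (elim z)
      then show ?case unfolding H2z elim(1)[symmetric] F_def by (simp add: diff_divide_distrib)
    qed
  qed
  have H2c: "Polynomial.coeff H2 n = 0" if n: "n \<ge> 2 * k" for n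
  proof (cases "Polynomial.degree H2 < 2 * k")
    case True
    then show ?thesis using n by (intro coeff_eq_0) simp
  next
    case False
    define d where "d = Polynomial.degree H2"
    have inv: "((\<lambda>z::complex. inverse z) \<longlongrightarrow> 0) at_infinity" by (rule tendsto_inverse_0)
    \<comment> \<open>If the degree d were at least 2k, this quotient would tend to the leading
      coefficient; the factor 0 takes care of 0^0 when d = 2k.\<close>
    have "((\<lambda>z. poly H2 z / z ^ (2 * k) * inverse z ^ (d - 2 * k)) \<longlongrightarrow> 0 * 0 ^ (d - 2 * k)) at_infinity"
      by (intro tendsto_mult tendsto_power H2lim inv)
    moreover have "poly H2 z / z ^ (2 * k) * inverse z ^ (d - 2 * k) = poly H2 z / z ^ d" for z
    proof -
      have "d = 2 * k + (d - 2 * k)" using False by (simp add: d_def)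
      then have "z ^ d = z ^ (2 * k) * z ^ (d - 2 * k)" by (metis power_add)
      then show ?thesis by (simp add: divide_inverse power_inverse mult_ac)
    qed
    ultimately have "((\<lambda>z. poly H2 z / z ^ d) \<longlongrightarrow> 0) at_infinity" by simp
    then have "Polynomial.lead_coeff H2 = 0"
      using tendsto_unique[OF trivial_limit_at_infinity poly_divide_tendsto_aux[of H2]] by (simp add: d_def)
    then show ?thesis by simp
  qed
  have H2p: "poly H2 z = (\<Sum>n<2*k. Polynomial.coeff H2 n * z ^ n)" for z
  proof -
    have "poly H2 z = (\<Sum>n\<le>Polynomial.degree H2. Polynomial.coeff H2 n * z ^ n)" by (rule poly_altdef)
    also have "\<dots> = (\<Sum>n<2*k. Polynomial.coeff H2 n * z ^ n)"
      by (rule sum.mono_neutral_cong) (auto simp: H2c not_less intro: coeff_eq_0)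
    finally show ?thesis .
  qed
  have c0: "Polynomial.coeff H2 0 = - a0"
    using H0 H2z[of 0] k_pos by (simp add: poly_0_coeff_0 zero_power)
  \<comment> \<open>Dividing by z^(2k) turns the exponent 2k - n into -n.\<close>
  define c where "c n = Polynomial.coeff H2 (2 * k - n)" for n
  have "\<forall>\<^sub>F z in cofinite. remainder z = a0 * (1 - 1 / z ^ (2 * k)) + (\<Sum>n=1..2*k-1. c n / z ^ n)"
    using H ne0
  proof eventually_elim
    case (elim z)
    have "remainder z = (poly H2 z + a0 * z ^ (2 * k)) / z ^ (2 * k)"
      using elim by (simp add: H2z F_def flip: elim(1))
    also have "\<dots> = poly H2 z / z ^ (2 * k) + a0"
      using elim(2) by (simp add: add_divide_distrib)
    also have "poly H2 z = - a0 + (\<Sum>n=1..2*k-1. Polynomial.coeff H2 n * z ^ n)"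
    proof -
      have "{..<2*k} = insert 0 {1..2*k-1}" using k_pos by auto
      then show ?thesis unfolding H2p by (simp add: c0)
    qed
    also have "(\<Sum>n=1..2*k-1. Polynomial.coeff H2 n * z ^ n) = (\<Sum>n=1..2*k-1. c n * z ^ (2 * k - n))"
      by (rule sum.reindex_bij_witness[of _ "\<lambda>n. 2 * k - n" "\<lambda>n. 2 * k - n"]) (auto simp: c_def)
    finally have "remainder z = a0 - a0 / z ^ (2 * k) + (\<Sum>n=1..2*k-1. c n * z ^ (2 * k - n) / z ^ (2 * k))"
      by (simp add: add_divide_distrib diff_divide_distrib sum_divide_distrib)
    also have "(\<Sum>n=1..2*k-1. c n * z ^ (2 * k - n) / z ^ (2 * k)) = (\<Sum>n=1..2*k-1. c n / z ^ n)"
    proof (rule sum.cong[OF refl])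
      fix n assume n: "n \<in> {1..2*k-1}"
      then have "2 * k = (2 * k - n) + n" by auto
      then have "z ^ (2 * k) = z ^ (2 * k - n) * z ^ n" by (metis power_add)
      then show "c n * z ^ (2 * k - n) / z ^ (2 * k) = c n / z ^ n" using elim(2) by simp
    qed
    finally show ?case by (simp add: right_diff_distrib)
  qed
  then show ?thesis by blast
qed

text \<open>Poles are grouped by their form class. Each group is a full cycle with constant
  coefficient by \<open>pole_cycle_real_pole\<close>, so a representative supplies C.\<close>

lemma correction_by_classes:
  "\<exists>(L::nat) \<A> C. (\<forall>l\<in>{1..L}. hyperbolic_class p (\<A> l)) \<and>
    (\<forall>z. correction z = (\<Sum>l=1..L. C l *
        (\<Sum>\<alpha>\<in>pole_cycle p (\<A> l). q_hyp p k \<alpha> z - q_hyp p k (moebius_map hecke_T \<alpha>) z)))"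
proof -
  define K where "K = form_class ` real_poles"
  have "finite K" using finite_real_poles by (simp add: K_def)
  then obtain \<A> where A: "bij_betw \<A> {1..card K} K" using ex_bij_betw_nat_finite_1 by blast
  define rep where "rep Q = (SOME x. x \<in> real_poles \<and> form_class x = Q)" for Q
  have rep: "rep Q \<in> real_poles \<and> form_class (rep Q) = Q" if "Q \<in> K" for Q
    unfolding rep_def by (rule someI_ex) (use that in \<open>auto simp: K_def\<close>)
  define t where "t z x = q_hyp p k x z - q_hyp p k (moebius_map hecke_T x) z" for z x
  have cyc: "pole_cycle p Q = {y \<in> real_poles. form_class y = Q}"
    "\<And>y. y \<in> pole_cycle p Q \<Longrightarrow> pole_coeff y = pole_coeff (rep Q)" if "Q \<in> K" for Q
  proof -
    have x: "rep Q \<in> real_poles" "form_class (rep Q) = Q" using rep[OF that] by auto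
    show "pole_cycle p Q = {y \<in> real_poles. form_class y = Q}"
      using pole_cycle_real_pole(1)[OF x(1)] unfolding x(2) .
    show "\<And>y. y \<in> pole_cycle p Q \<Longrightarrow> pole_coeff y = pole_coeff (rep Q)"
      using pole_cycle_real_pole(2)[OF x(1)] unfolding x(2) .
  qed
  have "correction z = (\<Sum>l=1..card K. pole_coeff (rep (\<A> l)) * (\<Sum>\<alpha>\<in>pole_cycle p (\<A> l). t z \<alpha>))" for z
  proof -
    have "correction z = (\<Sum>Q\<in>K. \<Sum>x\<in>{x \<in> real_poles. form_class x = Q}. pole_coeff x * t z x)"
      unfolding correction_def K_def t_def by (rule sum.image_gen[OF finite_real_poles])
    also have "\<dots> = (\<Sum>Q\<in>K. pole_coeff (rep Q) * (\<Sum>\<alpha>\<in>pole_cycle p Q. t z \<alpha>))"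
    proof (rule sum.cong[OF refl])
      fix Q assume Q: "Q \<in> K"
      show "(\<Sum>x\<in>{x \<in> real_poles. form_class x = Q}. pole_coeff x * t z x) =
          pole_coeff (rep Q) * (\<Sum>\<alpha>\<in>pole_cycle p Q. t z \<alpha>)"
        unfolding cyc(1)[OF Q, symmetric] sum_distrib_left
        by (rule sum.cong[OF refl]) (simp add: cyc(2)[OF Q])
    qed
    also have "\<dots> = (\<Sum>l=1..card K. pole_coeff (rep (\<A> l)) * (\<Sum>\<alpha>\<in>pole_cycle p (\<A> l). t z \<alpha>))"
      by (rule sum.reindex_bij_betw[OF A, symmetric])
    finally show ?thesis .
  qed
  moreover have "hyperbolic_class p (\<A> l)" if "l \<in> {1..card K}" for l
  proof -
    have "\<A> l \<in> K" using A that by (auto simp: bij_betw_def)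
    then show ?thesis using hyperbolic_class_form_class real_pole_props(1) by (auto simp: K_def)
  qed
  ultimately show ?thesis unfolding t_def
    by (intro exI[of _ "card K"] exI[of _ \<A>] exI[of _ "\<lambda>l. pole_coeff (rep (\<A> l))"]) blast
qed

end

theorem theorem1:
  fixes p k :: nat and q :: "complex \<Rightarrow> complex"
  assumes "p \<ge> 3" and "k \<ge> 1" and "rational_period_function p k q"
  shows "(\<exists>(L::nat) (\<A> :: nat \<Rightarrow> bqf set) (C :: nat \<Rightarrow> complex) (a\<^sub>0::complex) (b\<^sub>1::complex)
            (c :: nat \<Rightarrow> complex).
            (\<forall>l\<in>{1..L}. hyperbolic_class p (\<A> l)) \<and>
            (\<forall>\<^sub>F z in cofinite.
               q z = (\<Sum>l=1..L. C l *
                        (\<Sum>\<alpha>\<in>pole_cycle p (\<A> l). q_hyp p k \<alpha> z - q_hyp p k (moebius_map hecke_T \<alpha>) z))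
                     + c 0 * q_zero k a\<^sub>0 b\<^sub>1 z
                     + (\<Sum>n=1..2*k-1. c n / z ^ n)))
       \<and> (\<forall>\<alpha>\<in>hyperbolic_fixed_points p.
            q_hyp p k \<alpha> =
              principal_part (of_real \<alpha>)
                (\<lambda>z. of_real ((\<alpha> - hecke_conjugate p \<alpha>) ^ k) /
                     ((z - of_real \<alpha>) ^ k * (z - of_real (hecke_conjugate p \<alpha>)) ^ k)))"
proof -
  interpret rpf p k q
    by unfold_locales (use assms in auto)
  obtain L :: nat and \<A> C where cor: "\<forall>l\<in>{1..L}. hyperbolic_class p (\<A> l)"
    "\<And>z. correction z = (\<Sum>l=1..L. C l *
        (\<Sum>\<alpha>\<in>pole_cycle p (\<A> l). q_hyp p k \<alpha> z - q_hyp p k (moebius_map hecke_T \<alpha>) z))"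
    using correction_by_classes by blast
  obtain a0 c where rem:
    "\<forall>\<^sub>F z in cofinite. remainder z = a0 * (1 - 1 / z ^ (2 * k)) + (\<Sum>n=1..2*k-1. c n / z ^ n)"
    using remainder_form by blast
  \<comment> \<open>The coefficient \<open>c 0\<close> is set to 1, with the constant kept in a0;
    the final sum starts at n = 1 and is unaffected. For k = 1 the 1/z term is carried by
    \<open>c 1\<close>, whence 0 for b1.\<close>
  have "\<forall>\<^sub>F z in cofinite. q z = (\<Sum>l=1..L. C l *
        (\<Sum>\<alpha>\<in>pole_cycle p (\<A> l). q_hyp p k \<alpha> z - q_hyp p k (moebius_map hecke_T \<alpha>) z))
      + (c(0 := 1)) 0 * q_zero k a0 0 z + (\<Sum>n=1..2*k-1. (c(0 := 1)) n / z ^ n)"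
    using rem
  proof eventually_elim
    case (elim z)
    have "q_zero k a0 0 z = a0 * (1 - 1 / z ^ (2 * k))"
      by (simp add: q_zero_def)
    moreover have "(\<Sum>n=1..2*k-1. (c(0 := 1)) n / z ^ n) = (\<Sum>n=1..2*k-1. c n / z ^ n)"
      by (rule sum.cong) auto
    moreover have "q z = correction z + remainder z"
      by (simp add: remainder_def)
    ultimately show ?case
      using elim cor(2)[of z] by (simp add: add.assoc)
  qed
  moreover have "\<forall>\<alpha>\<in>hyperbolic_fixed_points p. q_hyp p k \<alpha> =
      principal_part (of_real \<alpha>)
        (\<lambda>z. of_real ((\<alpha> - hecke_conjugate p \<alpha>) ^ k) /
             ((z - of_real \<alpha>) ^ k * (z - of_real (hecke_conjugate p \<alpha>)) ^ k))"
    using q_hyp_eq by (simp add: pole_fun_def [abs_def])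
  ultimately show ?thesis
    using cor(1) by blast
qed

end
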